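(* Let $s,t,k\geq 2$ be integers and $K\geq 1$ a real number. Let $(G_n)$ be a sequence of graphs such that $G_n$ is a $K$-almost-regular graph on $n$ vertices with minimum degree $\delta_n$, where $\delta_n/n^{\frac{s-1}{sk}}\to\infty$ as $n\to\infty$. Then for all sufficiently large $n$, $G_n$ contains $K_{s,t}^k$ as a subgraph.
   Context: A graph $G$ is $K$-almost-regular if $\max_{v} d(v)\leq K\min_{v} d(v)$, where $d(v)$ is the degree of $v$. For a graph $F$, the $k$-subdivision $F^k$ is obtained by replacing each edge of $F$ by a path of length $k$, these paths being internally vertex-disjoint. $K_{s,t}$ is the complete bipartite graph with parts of sizes $s$ and $t$. *)

theory Defs
  imports Complex_Main "Graph_Theory.Graph_Theory"
begin

text \<open>
  A finite simple graph is a \<^locale>\<open>pair_graph\<close>: a finite vertex set with a symmetric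
  irreflexive arc relation. The edge \<open>uv\<close> is the pair of arcs \<open>(u,v)\<close>, \<open>(v,u)\<close>, so the degree
  of a vertex is its \<^const>\<open>out_degree\<close>. The minimum and maximum degree of the graph without
  vertices are unspecified.
\<close>

definition min_degree :: "'a pair_pre_digraph \<Rightarrow> nat" where
  "min_degree G = Min (out_degree G ` pverts G)"

definition max_degree :: "'a pair_pre_digraph \<Rightarrow> nat" where
  "max_degree G = Max (out_degree G ` pverts G)"

definition almost_regular :: "real \<Rightarrow> 'a pair_pre_digraph \<Rightarrow> bool" where
  "almost_regular K G \<longleftrightarrow> real (max_degree G) \<le> K * real (min_degree G)"

definition inner_vertices :: "'a vwalk \<Rightarrow> 'a set" where
  "inner_vertices p = set (butlast (tl p))"

text \<open>
  \<open>k_subdivision k F H\<close>: the graph \<open>H\<close> is a \<open>k\<close>-subdivision of \<open>F\<close>, realised on a superset of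
  the vertices of \<open>F\<close> (so \<open>H\<close> is determined by \<open>k\<close> and \<open>F\<close> up to isomorphism). The path \<open>P (u, v)\<close>
  replaces the edge \<open>uv\<close>; as \<open>uv\<close> consists of two arcs, \<open>P (v, u)\<close> is the same path
  read backwards.
\<close>

definition k_subdivision :: "nat \<Rightarrow> 'a pair_pre_digraph \<Rightarrow> 'a pair_pre_digraph \<Rightarrow> bool" where
  "k_subdivision k F H \<longleftrightarrow> (\<exists>P :: 'a \<times> 'a \<Rightarrow> 'a vwalk.
     (\<forall>(u, v) \<in> parcs F.
        vpath (P (u, v)) H \<and> vwalk_length (P (u, v)) = k \<and>
        hd (P (u, v)) = u \<and> last (P (u, v)) = v \<and>
        P (v, u) = rev (P (u, v)) \<and>
        inner_vertices (P (u, v)) \<inter> pverts F = {}) \<and>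
     (\<forall>(u, v) \<in> parcs F. \<forall>(x, y) \<in> parcs F. {u, v} \<noteq> {x, y} \<longrightarrow>
        inner_vertices (P (u, v)) \<inter> inner_vertices (P (x, y)) = {}) \<and>
     pverts H = pverts F \<union> (\<Union>e \<in> parcs F. set (P e)) \<and>
     parcs H = (\<Union>e \<in> parcs F. set (vwalk_arcs (P e))))"

end

theory Submission
  imports Defs "HOL-Library.FuncSet"
begin

text \<open>
  Consider all copies in a graph of the spider with \<open>s\<close> legs of length \<open>k\<close>; if all degrees lie between
  \<open>D/K\<close> and \<open>D\<close>, there are at least \<open>c n D^(sk)\<close> of them. Run through the subpaths of the legs and then
  through the smaller spiders with the same centre, in order of size, each time discarding the copies
  whose restriction to the smaller tree has too many companions with the same leaves. If this
  never discards more than half of the copies, then in the end a tuple of \<open>s\<close> leaves determines the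
  copy up to a bounded number of choices, so \<open>D^(sk) = O(n^(s-1))\<close>.

  Otherwise some smaller tree has a positive proportion of copies in which the leaves are joined by many other
  copies. Since the trees treated before have few companions, no vertex lies in many of these
  copies. Deleting copies which extend in few ways leaves a robust family: a leaf can be moved in many
  ways, and the leaves are joined by a copy avoiding any given bounded set. Zigzagging between a
  leaf and its neighbour therefore lengthens every leg to \<open>k\<close>, and \<open>t\<close> such lengthened spiders
  with the same end points form the subdivision. When the smaller tree is a path, the pairs of
  its end points contain a complete bipartite graph by a Kovari-Sos-Turan argument, and its edges
  are replaced by zigzag paths.
\<close>

section \<open>Spiders\<close>

text \<open>The large spider has \<open>s * k\<close> edges and \<open>s\<close> leaves: about n
  D^(sk) copies share at most n^s tuples of leaves, whence the exponent (s-1)/(sk). Many companions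
  alone do not allow a bounded set to be avoided, since all of them might pass through one vertex;
  this dictates the order of treatment. Fixing a non-leaf splits a tree into trees treated before,
  so only boundedly many companions pass through any vertex. Parity is the other obstacle. An odd
  zigzag ends at the neighbour of the leaf, so two legs of length 1 would both end at the centre.
  Spiders with two such legs are bounded differently: their cherry, a path of length 2, is treated
  beforehand and leaves few choices for the centre. A path lengthened by an even amount keeps its
  ends; an odd difference calls for other pairs, namely one end and the neighbour of the other. For
  paths of length 2 these would be adjacent vertices, among which no complete bipartite graph can be
  expected, so that case has an argument of its own. Each discarding step costs at most half of the
  density and there are finitely many trees, so all constants are independent of the graph.\<close>

lemma iterated_deletion:
  fixes key :: "'i \<Rightarrow> 'p \<Rightarrow> 'k" and \<tau> :: "'i \<Rightarrow> real"
  assumes fin: "finite P0" "finite I" and nonneg: "\<And>i. \<tau> i \<ge> 0"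
    and lt: "(\<Sum>i\<in>I. \<tau> i * real (card (key i ` P0))) < real (card P0)"
  shows "\<exists>P\<subseteq>P0. P \<noteq> {} \<and> (\<forall>p\<in>P. \<forall>i\<in>I. \<tau> i \<le> real (card {p'\<in>P. key i p' = key i p}))"
proof (rule ccontr)
  assume neg: "\<not> ?thesis"
  \<comment> \<open>The potential charges \<tau> \<open>i\<close> for every value of key
    \<open>i\<close>. Removing a whole class of fewer than \<tau> \<open>i\<close> elements loses
    less than \<tau> \<open>i\<close> and refunds at least \<tau> \<open>i\<close>, so the potential
    stays positive, while the empty family has potential 0.\<close>
  define \<phi> where "\<phi> P = real (card P) - (\<Sum>i\<in>I. \<tau> i * real (card (key i ` P)))" for P
  have step: "\<exists>Q. Q \<subset> P \<and> \<phi> Q > 0" if P: "P \<subseteq> P0" "\<phi> P > 0" for P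
  proof -
    have finP: "finite P" using P fin finite_subset by blast
    have "P \<noteq> {}" using P by (auto simp: \<phi>_def)
    hence "\<not> (\<forall>p\<in>P. \<forall>i\<in>I. \<tau> i \<le> real (card {p'\<in>P. key i p' = key i p}))"
      using neg P(1) by blast
    then obtain p i where p: "p \<in> P" "i \<in> I" "real (card {p'\<in>P. key i p' = key i p}) < \<tau> i"
      by (auto simp: not_le)
    define R where "R = {p'\<in>P. key i p' = key i p}"
    have pR: "p \<in> R" "R \<subseteq> P" "real (card R) < \<tau> i" using p by (auto simp: R_def)
    have others: "\<tau> j * real (card (key j ` (P - R))) \<le> \<tau> j * real (card (key j ` P))" for j
      using finP nonneg by (intro mult_left_mono) (auto intro!: card_mono)
    have ki: "key i ` (P - R) = key i ` P - {key i p}"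
      by (auto simp: R_def)
    have ci: "real (card (key i ` (P - R))) = real (card (key i ` P)) - 1"
    proof -
      have "card (key i ` P) > 0" using p(1) finP by (auto simp: card_gt_0_iff)
      moreover have "card (key i ` P - {key i p}) = card (key i ` P) - 1"
        using p(1) by (intro card_Diff_singleton) blast
      ultimately show ?thesis unfolding ki by (simp add: of_nat_diff)
    qed
    have "(\<Sum>j\<in>I. \<tau> j * real (card (key j ` (P - R)))) =
       \<tau> i * real (card (key i ` (P - R))) + (\<Sum>j\<in>I - {i}. \<tau> j * real (card (key j ` (P - R))))"
      by (rule sum.remove) (use p fin in auto)
    also have "\<dots> \<le> \<tau> i * (real (card (key i ` P)) - 1) + (\<Sum>j\<in>I - {i}. \<tau> j * real (card (key j ` P)))"
      unfolding ci by (intro add_left_mono sum_mono others)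
    also have "\<dots> = (\<Sum>j\<in>I. \<tau> j * real (card (key j ` P))) - \<tau> i"
      using sum.remove[OF fin(2) p(2), of "\<lambda>j. \<tau> j * real (card (key j ` P))"] by (simp add: algebra_simps)
    finally have *: "(\<Sum>j\<in>I. \<tau> j * real (card (key j ` (P - R)))) \<le> (\<Sum>j\<in>I. \<tau> j * real (card (key j ` P))) - \<tau> i" .
    have "real (card (P - R)) = real (card P) - real (card R)"
      using pR finP by (simp add: card_Diff_subset finite_subset of_nat_diff card_mono)
    hence "\<phi> (P - R) \<ge> \<phi> P" using * pR(3) by (simp add: \<phi>_def)
    hence "\<phi> (P - R) > 0" using P(2) by simp
    moreover have "P - R \<subset> P" using pR(1) p(1) by blast
    ultimately show ?thesis by blast
  qed
  have "False" if "P \<subseteq> P0" "\<phi> P > 0" for P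
    using finite_subset[OF that(1) fin(1)] that
  proof (induction P rule: finite_psubset_induct)
    case (psubset A)
    then obtain Q where "Q \<subset> A" "\<phi> Q > 0" using step[of A] by blast
    then show ?case using psubset.IH[of Q] psubset.prems(1) by blast
  qed
  moreover have "\<phi> P0 > 0" using lt by (simp add: \<phi>_def)
  ultimately show False by blast
qed

lemma exists_outside:
  assumes "finite W" "card W \<le> m" "card A > m" "finite A"
  shows "\<exists>x\<in>A. x \<notin> W"
  using assms by (meson card_mono finite_subset leD order.trans subsetI)

type_synonym 'a spider = "'a \<times> (nat \<Rightarrow> 'a list)"

text \<open>
  A spider consists of its centre and of its legs, each listed from the leaf towards the
  centre, the centre excluded. Unused legs are empty.

  The first component of the leaf key adds no information: it only gives the two keys below the
  same type.
\<close>

definition leaf_key :: "'a spider \<Rightarrow> 'a spider" where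
  "leaf_key S = (hd (snd S 0), \<lambda>i. take 1 (snd S i))"

text \<open>A fibre of \<open>drop_key e\<close> consists of the spiders that differ only in the
  outer \<open>e i\<close> vertices of each leg \<open>i\<close>; its size measures in how many ways
  the inner part extends.\<close>

definition drop_key :: "(nat \<Rightarrow> nat) \<Rightarrow> 'a spider \<Rightarrow> 'a spider" where
  "drop_key e S = (fst S, \<lambda>i. drop (e i) (snd S i))"

definition non_leaves :: "'a spider \<Rightarrow> 'a set" where
  "non_leaves S = insert (fst S) (\<Union>i. set (tl (snd S i)))"

definition replace_leaf :: "nat \<Rightarrow> 'a \<Rightarrow> 'a spider \<Rightarrow> 'a spider" where
  "replace_leaf i x S = (fst S, (snd S)(i := x # tl (snd S i)))"

text \<open>Neighbourhood functions let the host graph and the index tree of the large spider be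
  instances of one locale, so that both share the notion of spider.\<close>

locale bounded_graph =
  fixes V :: "'a set" and nb :: "'a \<Rightarrow> 'a set" and D :: nat
  assumes finV: "finite V" and nb_V: "nb x \<subseteq> V" and nb_sym: "y \<in> nb x \<Longrightarrow> x \<in> nb y"
    and nb_irrefl: "x \<notin> nb x" and card_nb: "card (nb x) \<le> D"
begin

definition wlk :: "'a list \<Rightarrow> bool" where
  "wlk p \<longleftrightarrow> successively (\<lambda>x y. y \<in> nb x) p \<and> set p \<subseteq> V"

text \<open>Leg lengths are a function on all naturals, so spiders with different numbers of legs
  have the same type; a leg of length 0 is absent. Distinctness and disjointness make the members
  embedded copies.\<close>

definition sp :: "(nat \<Rightarrow> nat) \<Rightarrow> 'a spider set" where
  "sp \<kappa> = {(c, L). c \<in> V \<and> (\<forall>i. length (L i) = \<kappa> i \<and> wlk (L i @ [c]) \<and> distinct (L i @ [c])) \<and>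
      (\<forall>i j. i \<noteq> j \<longrightarrow> set (L i) \<inter> set (L j) = {})}"

lemma fin_nb [simp]: "finite (nb x)"
  using finV nb_V finite_subset by blast

lemma wlk_Cons: "p \<noteq> [] \<Longrightarrow> wlk (x # p) \<longleftrightarrow> hd p \<in> nb x \<and> wlk p"
  using nb_V nb_sym unfolding wlk_def by (auto simp: successively_Cons)

lemma wlk_rev: "wlk (rev p) = wlk p"
proof -
  have "successively (\<lambda>x y. x \<in> nb y) p = successively (\<lambda>x y. y \<in> nb x) p"
    by (intro successively_cong) (auto intro: nb_sym)
  thus ?thesis unfolding wlk_def by (simp add: successively_rev)
qed

lemma wlk_append: "p \<noteq> [] \<Longrightarrow> q \<noteq> [] \<Longrightarrow> wlk (p @ q) \<longleftrightarrow> wlk p \<and> wlk q \<and> hd q \<in> nb (last p)"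
  unfolding wlk_def by (auto simp: successively_append_iff)

lemma wlk_drop: "wlk p \<Longrightarrow> wlk (drop n p)"
  unfolding wlk_def
  by (metis (no_types, lifting) append_take_drop_id set_drop_subset subset_trans successively_append_iff)

lemma sp_drop_key:
  assumes "S \<in> sp \<kappa>"
  shows "drop_key e S \<in> sp (\<lambda>i. \<kappa> i - e i)"
proof -
  obtain c L where S: "S = (c, L)" by force
  have "wlk (drop (e i) (L i) @ [c])" for i
  proof (cases "e i \<le> length (L i)")
    case True
    hence "drop (e i) (L i) @ [c] = drop (e i) (L i @ [c])" by simp
    thus ?thesis using assms S wlk_drop by (metis (mono_tags, lifting) case_prodD mem_Collect_eq sp_def)
  next
    case False
    thus ?thesis using assms S by (auto simp: sp_def wlk_def)
  qed
  moreover have "set (drop (e i) (L i)) \<subseteq> set (L i)" for i by (rule set_drop_subset)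
  ultimately show ?thesis using assms S
    by (auto simp: sp_def drop_key_def disjoint_iff dest!: in_set_dropD)
qed

text \<open>The centre has \<open>card V\<close> choices and every further vertex, chosen outwards,
  at most \<open>D\<close>. The induction removes the outermost vertex of some leg.\<close>

lemma card_sp:
  assumes "\<And>i. i \<ge> r \<Longrightarrow> \<kappa> i = 0"
  shows "finite (sp \<kappa>) \<and> card (sp \<kappa>) \<le> card V * D ^ (\<Sum>i<r. \<kappa> i)"
  using assms
proof (induction "\<Sum>i<r. \<kappa> i" arbitrary: \<kappa>)
  case 0
  hence "\<kappa> i = 0" for i by (metis finite_lessThan lessThan_iff not_le sum_eq_0_iff)
  hence sub: "sp \<kappa> \<subseteq> (\<lambda>c. (c, \<lambda>_. [])) ` V" by (auto simp: sp_def image_iff)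
  hence "card (sp \<kappa>) \<le> card V" using finV by (meson card_image_le card_mono finite_imageI order.trans)
  thus ?case using sub finV 0 by (auto intro: finite_subset)
next
  case (Suc m)
  have "(\<Sum>i<r. \<kappa> i) \<noteq> 0" using Suc.hyps(2) by linarith
  then obtain i where i: "i < r" "\<kappa> i > 0" by (meson lessThan_iff not_gr_zero sum.neutral)
  define \<kappa>' where "\<kappa>' = \<kappa>(i := \<kappa> i - 1)"
  have "(\<Sum>j<r. \<kappa> j) = \<kappa> i + (\<Sum>j\<in>{..<r}-{i}. \<kappa> j)" using i by (simp add: sum.remove)
  moreover have "(\<Sum>j<r. \<kappa>' j) = \<kappa>' i + (\<Sum>j\<in>{..<r}-{i}. \<kappa>' j)" using i by (simp add: sum.remove)
  moreover have "(\<Sum>j\<in>{..<r}-{i}. \<kappa>' j) = (\<Sum>j\<in>{..<r}-{i}. \<kappa> j)" by (intro sum.cong) (auto simp: \<kappa>'_def)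
  ultimately have m: "m = (\<Sum>j<r. \<kappa>' j)" using Suc.hyps(2) i by (simp add: \<kappa>'_def)
  have IH: "finite (sp \<kappa>')" "card (sp \<kappa>') \<le> card V * D ^ m"
  proof -
    have "\<kappa>' j = 0" if "j \<ge> r" for j using Suc.prems[OF that] that i by (auto simp: \<kappa>'_def)
    from Suc.hyps(1)[OF m this] show "finite (sp \<kappa>')" "card (sp \<kappa>') \<le> card V * D ^ m"
      unfolding m by auto
  qed
  define ext where "ext S = (\<lambda>x. (fst S, (snd S)(i := x # snd S i))) ` nb (hd (snd S i @ [fst S]))" for S :: "'a spider"
  have "sp \<kappa> \<subseteq> (\<Union>S\<in>sp \<kappa>'. ext S)"
  proof
    fix S assume S: "S \<in> sp \<kappa>"
    obtain c L where cL: "S = (c, L)" by force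
    define e :: "nat \<Rightarrow> nat" where "e = (\<lambda>j. if j = i then 1 else 0)"
    have "drop_key e S \<in> sp \<kappa>'"
    proof -
      have "(\<lambda>j. \<kappa> j - e j) = \<kappa>'" by (auto simp: \<kappa>'_def e_def)
      thus ?thesis using sp_drop_key[OF S, of e] by simp
    qed
    moreover have "S \<in> ext (drop_key e S)"
    proof -
      have Li: "length (L i) = \<kappa> i" "wlk (L i @ [c])" using S cL by (auto simp: sp_def)
      then obtain x l where xl: "L i = x # l" using i by (cases "L i") auto
      have "x \<in> nb (hd (l @ [c]))" using Li(2) xl by (simp add: wlk_Cons nb_sym)
      moreover have "snd (drop_key e S) = L(i := l)" using cL xl by (auto simp: drop_key_def e_def)
      moreover have "fst (drop_key e S) = c" using cL by (simp add: drop_key_def)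
      moreover have "S = (c, (L(i := l))(i := x # (L(i := l)) i))" using cL xl by auto
      ultimately show ?thesis unfolding ext_def by auto
    qed
    ultimately show "S \<in> (\<Union>S\<in>sp \<kappa>'. ext S)" by blast
  qed
  note sub = this
  have fe: "finite (ext S)" for S by (simp add: ext_def)
  have ce: "card (ext S) \<le> D" for S
    unfolding ext_def by (meson card_image_le card_nb fin_nb order.trans)
  have fU: "finite (\<Union>S\<in>sp \<kappa>'. ext S)" using IH(1) fe by blast
  have "card (\<Union>S\<in>sp \<kappa>'. ext S) \<le> (\<Sum>S\<in>sp \<kappa>'. card (ext S))"
    using IH(1) by (rule card_UN_le)
  also have "\<dots> \<le> (\<Sum>S\<in>sp \<kappa>'. D)" by (intro sum_mono ce)
  also have "\<dots> \<le> card V * D ^ Suc m" using mult_le_mono1[OF IH(2), of D] by (simp add: mult_ac)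
  finally have "card (sp \<kappa>) \<le> card V * D ^ Suc m" using card_mono[OF fU sub] by linarith
  thus ?case using finite_subset[OF sub fU] Suc.hyps(2) by simp
qed

text \<open>Iterated deletion, with leaf tuples and cut spiders as keys. By \<open>card_sp\<close>
  the cuts by one \<open>e\<close> cost at most \<eta> times the maximal number of spiders, and
  \<eta> is chosen so that all cuts together cost at most a quarter of \<open>P0\<close>. The leaf
  tuples cost another quarter.\<close>

lemma robust_subset:
  fixes \<epsilon> \<tau> \<eta> :: real
  assumes supp: "\<And>i. i \<ge> r \<Longrightarrow> \<kappa> i = 0"
    and P0: "P0 \<subseteq> sp \<kappa>" and pos: "\<epsilon> > 0" "V \<noteq> {}" "D > 0"
    and dense: "real (card P0) \<ge> \<epsilon> * card V * real D ^ (\<Sum>i<r. \<kappa> i)"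
    and E: "finite E" "\<And>e. e \<in> E \<Longrightarrow> e \<le> \<kappa>"
    and \<tau>: "\<tau> \<ge> 0" "4 * \<tau> * real (card (leaf_key ` P0)) \<le> real (card P0)"
    and \<eta>: "\<eta> = \<epsilon> / (4 * (real (card E) + 1))"
  shows "\<exists>P\<subseteq>P0. P \<noteq> {} \<and> (\<forall>S\<in>P. \<tau> \<le> real (card {S'\<in>P. leaf_key S' = leaf_key S}) \<and>
     (\<forall>e\<in>E. \<eta> * real D ^ (\<Sum>i<r. e i) \<le> real (card {S'\<in>P. drop_key e S' = drop_key e S})))"
proof -
  define I where "I = insert None (Some ` E)"
  define key :: "(nat \<Rightarrow> nat) option \<Rightarrow> 'a spider \<Rightarrow> 'a spider" where
    "key = case_option leaf_key drop_key"
  define th where "th = case_option \<tau> (\<lambda>e. \<eta> * real D ^ (\<Sum>i<r. e i))"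
  have finP: "finite P0" 
    by (rule finite_subset[OF P0], rule conjunct1, rule card_sp[of r], erule supp)
  have \<eta>0: "\<eta> > 0" unfolding \<eta> using pos(1) by simp
  have cV: "real (card V) > 0" using pos(2) finV by (simp add: card_gt_0_iff)
  have "0 < \<epsilon> * card V * real D ^ (\<Sum>i<r. \<kappa> i)" using pos(1,3) cV by simp
  hence P0pos: "real (card P0) > 0" using dense by linarith
  have b: "\<eta> * real D ^ (\<Sum>i<r. e i) * real (card (drop_key e ` P0)) \<le> \<eta> * real (card V) * real D ^ (\<Sum>i<r. \<kappa> i)" (is "?l \<le> _")
    if e: "e \<in> E" for e
  proof -
    have "drop_key e ` P0 \<subseteq> sp (\<lambda>i. \<kappa> i - e i)" using P0 sp_drop_key by blast
    moreover have s: "finite (sp (\<lambda>i. \<kappa> i - e i)) \<and> card (sp (\<lambda>i. \<kappa> i - e i)) \<le> card V * D ^ (\<Sum>i<r. \<kappa> i - e i)"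
      by (rule card_sp) (use supp in simp)
    ultimately have "card (drop_key e ` P0) \<le> card V * D ^ (\<Sum>i<r. \<kappa> i - e i)"
      by (meson card_mono order.trans)
    hence "real (card (drop_key e ` P0)) \<le> real (card V) * real D ^ (\<Sum>i<r. \<kappa> i - e i)"
      by (metis of_nat_le_iff of_nat_mult of_nat_power)
    hence "?l \<le> \<eta> * real D ^ (\<Sum>i<r. e i) * (real (card V) * real D ^ (\<Sum>i<r. \<kappa> i - e i))"
      using \<eta>0 by (intro mult_left_mono) auto
    also have "\<dots> = \<eta> * real (card V) * real D ^ ((\<Sum>i<r. e i) + (\<Sum>i<r. \<kappa> i - e i))"
      by (simp add: power_add)
    \<comment> \<open>Subtraction is truncated, so this is where \<open>e \<le> \<kappa>\<close>
      enters.\<close>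
    also have "(\<Sum>i<r. e i) + (\<Sum>i<r. \<kappa> i - e i) = (\<Sum>i<r. \<kappa> i)"
      using E(2)[OF e] by (simp add: sum.distrib[symmetric] le_fun_def)
    finally show ?thesis .
  qed
  have "(\<Sum>i\<in>I. th i * real (card (key i ` P0))) = \<tau> * real (card (leaf_key ` P0))
     + (\<Sum>e\<in>E. \<eta> * real D ^ (\<Sum>i<r. e i) * real (card (drop_key e ` P0)))"
  proof -
    have "(\<Sum>i\<in>I. th i * real (card (key i ` P0))) = th None * real (card (key None ` P0))
      + (\<Sum>i\<in>Some ` E. th i * real (card (key i ` P0)))"
      unfolding I_def using E(1) by (intro sum.insert) auto
    also have "(\<Sum>i\<in>Some ` E. th i * real (card (key i ` P0))) = (\<Sum>e\<in>E. th (Some e) * real (card (key (Some e) ` P0)))"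
      by (subst sum.reindex) (auto simp: o_def)
    finally show ?thesis by (simp only: th_def key_def option.case)
  qed
  also have "\<dots> \<le> real (card P0) / 4 + (\<Sum>e\<in>E. \<eta> * real (card V) * real D ^ (\<Sum>i<r. \<kappa> i))"
    using b \<tau> by (intro add_mono sum_mono) auto
  also have "(\<Sum>e\<in>E. \<eta> * real (card V) * real D ^ (\<Sum>i<r. \<kappa> i)) =
     (card E / (4 * (real (card E) + 1))) * (\<epsilon> * card V * real D ^ (\<Sum>i<r. \<kappa> i))"
    unfolding \<eta> by (simp only: sum_constant) (simp add: field_simps)
  also have "\<dots> \<le> (1/4) * (\<epsilon> * card V * real D ^ (\<Sum>i<r. \<kappa> i))"
    using \<open>0 < \<epsilon> * card V * real D ^ (\<Sum>i<r. \<kappa> i)\<close>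
    by (intro mult_right_mono) (simp_all add: field_simps del: of_nat_power)
  also have "\<dots> \<le> (1/4) * real (card P0)" using dense by linarith
  finally have "(\<Sum>i\<in>I. th i * real (card (key i ` P0))) \<le> real (card P0) / 4 + 1 / 4 * real (card P0)"
    by linarith
  hence "(\<Sum>i\<in>I. th i * real (card (key i ` P0))) < real (card P0)" using P0pos by linarith
  moreover have "finite I" using E(1) by (simp add: I_def)
  moreover have "th i \<ge> 0" for i
    using \<tau>(1) \<eta>0 by (auto simp: th_def split: option.splits)
  ultimately obtain P where P: "P \<subseteq> P0" "P \<noteq> {}"
      "\<forall>p\<in>P. \<forall>i\<in>I. th i \<le> real (card {p'\<in>P. key i p' = key i p})"
    using iterated_deletion[OF finP, of I th key] by blast
  have "\<tau> \<le> real (card {S'\<in>P. leaf_key S' = leaf_key S})" if "S \<in> P" for S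
    using P(3)[rule_format, OF that, of None] by (simp add: I_def th_def key_def)
  moreover have "\<eta> * real D ^ (\<Sum>i<r. e i) \<le> real (card {S'\<in>P. drop_key e S' = drop_key e S})"
    if "S \<in> P" "e \<in> E" for S e
    using P(3)[rule_format, OF that(1), of "Some e"] that(2) by (simp add: I_def th_def key_def)
  ultimately show ?thesis using P(1,2) by blast
qed

end

section \<open>Zigzagging\<close>

text \<open>The end point of leg \<open>i\<close> after it has been lengthened by \<open>g i\<close> zigzag steps at its leaf.\<close>

definition zig :: "(nat \<Rightarrow> nat) \<Rightarrow> 'a spider \<Rightarrow> nat \<Rightarrow> 'a" where
  "zig g S i = (if even (g i) then hd (snd S i) else hd (tl (snd S i) @ [fst S]))"

lemma leaf_key_eq_hd:
  assumes "leaf_key S' = leaf_key S"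
  shows "snd S i \<noteq> [] \<Longrightarrow> hd (snd S' i) = hd (snd S i)"
  using fun_cong[OF arg_cong[OF assms, of snd], of i]
  by (cases "snd S i"; cases "snd S' i") (auto simp: leaf_key_def)

lemma set_tl_subset: "set (tl xs) \<subseteq> set xs"
  by (cases xs) auto

context bounded_graph begin

text \<open>The number \<open>m\<close> is a single budget for all vertices that ever have to be
  avoided. The first closure property reroutes between fixed leaves, the second moves one leaf and
  keeps everything else; these are the two kinds of zigzag step.\<close>

definition robust :: "(nat \<Rightarrow> nat) \<Rightarrow> nat \<Rightarrow> nat \<Rightarrow> 'a spider set \<Rightarrow> bool" where
  "robust \<kappa> r m P \<longleftrightarrow> P \<subseteq> sp \<kappa> \<and>
    (\<forall>S\<in>P. \<forall>W. finite W \<and> card W \<le> m \<longrightarrow> (\<exists>S'\<in>P. leaf_key S' = leaf_key S \<and> non_leaves S' \<inter> W = {})) \<and>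
    (\<forall>S\<in>P. \<forall>i<r. \<forall>W. finite W \<and> card W \<le> m \<longrightarrow> (\<exists>x. x \<notin> W \<and> replace_leaf i x S \<in> P))"

lemma robust_sp: "robust \<kappa> r m P \<Longrightarrow> P \<subseteq> sp \<kappa>"
  unfolding robust_def by (rule conjunct1)

lemma robust_avoid:
  assumes "robust \<kappa> r m P" "S \<in> P" "finite W" "card W \<le> m"
  obtains S' where "S' \<in> P" "leaf_key S' = leaf_key S" "non_leaves S' \<inter> W = {}"
  using assms(1)[unfolded robust_def, THEN conjunct2, THEN conjunct1, rule_format, OF assms(2), of W] assms(3,4)
  by blast

lemma robust_replace:
  assumes "robust \<kappa> r m P" "S \<in> P" "i < r" "finite W" "card W \<le> m"
  obtains x where "x \<notin> W" "replace_leaf i x S \<in> P"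
  using assms(1)[unfolded robust_def, THEN conjunct2, THEN conjunct2, rule_format, OF assms(2,3), of W] assms(4,5)
  by blast

lemma spD:
  assumes "(c, L) \<in> sp \<kappa>"
  shows "c \<in> V" "length (L i) = \<kappa> i" "wlk (L i @ [c])" "distinct (L i)" "c \<notin> set (L i)"
    "i \<noteq> j \<Longrightarrow> set (L i) \<inter> set (L j) = {}"
  using assms unfolding sp_def by auto

lemma sp_extend:
  assumes S: "(v, L) \<in> sp \<kappa>" and i: "L i \<noteq> []" and z: "z \<in> nb (hd (L i))" "z \<noteq> v" "\<And>j. z \<notin> set (L j)"
  shows "(v, L(i := z # L i)) \<in> sp (\<kappa>(i := Suc (\<kappa> i)))"
proof -
  have "wlk (z # L i @ [v])" using i z spD(3)[OF S, of i] nb_sym by (subst wlk_Cons) auto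
  thus ?thesis using S z unfolding sp_def by auto
qed

lemma leaf_not_non_leaf:
  assumes S: "S \<in> sp \<kappa>" and "snd S i \<noteq> []"
  shows "hd (snd S i) \<notin> non_leaves S"
proof -
  obtain c L where cL: "S = (c, L)" by force
  obtain x l where x: "L i = x # l" using assms(2) cL by (cases "L i") auto
  have "x \<notin> set (tl (L j))" for j
  proof (cases "j = i")
    case True thus ?thesis using spD(4)[OF S[unfolded cL], of i] x by auto
  next
    case False thus ?thesis using spD(6)[OF S[unfolded cL], of j i] x by (cases "L j") auto
  qed
  thus ?thesis using spD(5)[OF S[unfolded cL], of i] x by (auto simp: non_leaves_def cL)
qed

lemma leaves_inj:
  assumes S: "S \<in> sp \<kappa>" and "\<And>i. i < r \<Longrightarrow> \<kappa> i > 0"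
  shows "inj_on (\<lambda>i. hd (snd S i)) {..<r}"
proof
  fix i j assume ij: "i \<in> {..<r}" "j \<in> {..<r}" and eq: "hd (snd S i) = hd (snd S j)"
  obtain c L where cL: "S = (c, L)" by force
  have "L l \<noteq> []" if "l < r" for l using spD(2)[OF S[unfolded cL], of l] assms(2)[OF that] by auto
  hence "L i \<noteq> []" "L j \<noteq> []" using ij by auto
  hence "hd (L i) \<in> set (L i)" "hd (L j) \<in> set (L j)" by auto
  thus "i = j" using spD(6)[OF S[unfolded cL], of i j] eq cL by auto
qed

text \<open>The induction peels off the last step of one leg: its end point \<open>z\<close> is
  adjacent to the end point that the same leg has with one step less, in a suitable member of
  \<open>P\<close>. Adding \<open>z\<close> to \<open>W\<close> keeps the shorter spider off
  \<open>z\<close>, and the budget is unchanged because one step less remains. The summand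
  \<open>r\<close> pays for avoiding the end points when a leaf is moved.\<close>

lemma zigzag:
  assumes rob: "robust \<kappa> r m P" and \<kappa>: "\<And>i. i < r \<Longrightarrow> \<kappa> i > 0" "\<And>i. i \<ge> r \<Longrightarrow> \<kappa> i = 0"
    and S: "S \<in> P" and g: "\<And>i. i \<ge> r \<Longrightarrow> g i = 0"
    and inj: "inj_on (zig g S) {..<r}" and W: "finite W" "card W + (\<Sum>i<r. g i) + r \<le> m"
  shows "\<exists>T. T \<in> sp (\<lambda>i. \<kappa> i + g i) \<and> (\<forall>i<r. hd (snd T i) = zig g S i) \<and> non_leaves T \<inter> W = {}"
  using S g inj W
proof (induction "\<Sum>i<r. g i" arbitrary: S g W)
  case 0
  have "(\<Sum>i<r. g i) = 0" using 0(1) by linarith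
  hence "g i = 0" if "i < r" for i using that by simp
  hence g0: "g i = 0" for i using 0(3)[of i] by (cases "i < r") auto
  have "card W \<le> m" using 0(6) by linarith
  then obtain S' where S': "S' \<in> P" "leaf_key S' = leaf_key S" "non_leaves S' \<inter> W = {}"
    by (rule robust_avoid[OF rob 0(2,5)])
  have "S \<in> sp \<kappa>" using 0(2) robust_sp[OF rob] by blast
  hence "snd S i \<noteq> []" if "i < r" for i using \<kappa>(1)[OF that] spD(2)[of "fst S" "snd S" \<kappa> i] by (cases S) auto
  hence "hd (snd S' i) = zig g S i" if "i < r" for i
    using leaf_key_eq_hd[OF S'(2)] that g0 by (auto simp: zig_def)
  moreover have "S' \<in> sp \<kappa>" using S'(1) robust_sp[OF rob] by blast
  moreover have "(\<lambda>i. \<kappa> i + g i) = \<kappa>" by (simp add: g0)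
  ultimately show ?case using S'(3) by metis
next
  case (Suc N)
  note IH = Suc.hyps(1) and N = Suc.hyps(2) and SP = Suc.prems(1) and g = Suc.prems(2) and inj = Suc.prems(3)
    and W = Suc.prems(4,5)
  have Psp: "P \<subseteq> sp \<kappa>" by (rule robust_sp[OF rob])
  have ne: "snd T i \<noteq> []" if "T \<in> P" "i < r" for T i
    using \<kappa>(1)[OF that(2)] spD(2)[of "fst T" "snd T" \<kappa> i] subsetD[OF Psp that(1)] by (cases T) auto
  \<comment> \<open>Both parities end alike: the induction hypothesis for \<open>S1\<close> yields a
    spider whose leg \<open>i\<close> is one step shorter, and \<open>z\<close> is prepended to that
    leg. Injectivity of the end points keeps \<open>z\<close> off the other leaves, which
    \<open>W\<close> does not protect.\<close>
  have finish: ?case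
    if i: "i < r" "g i > 0" and S1: "S1 \<in> P"
      and zj: "\<And>j. j < r \<Longrightarrow> j \<noteq> i \<Longrightarrow> zig (g(i := g i - 1)) S1 j = zig g S j"
      and inj1: "inj_on (zig (g(i := g i - 1)) S1) {..<r}"
      and x: "zig (g(i := g i - 1)) S1 i \<notin> W" "zig g S i \<in> nb (zig (g(i := g i - 1)) S1 i)"
    for i S1
  proof -
    define g1 where "g1 = g(i := g i - 1)"
    define z where "z = zig g S i"
    have "(\<Sum>j<r. g j) = g i + (\<Sum>j\<in>{..<r}-{i}. g j)" using i by (simp add: sum.remove)
    moreover have "(\<Sum>j<r. g1 j) = g1 i + (\<Sum>j\<in>{..<r}-{i}. g1 j)" using i by (simp add: sum.remove)
    moreover have "(\<Sum>j\<in>{..<r}-{i}. g1 j) = (\<Sum>j\<in>{..<r}-{i}. g j)" by (intro sum.cong) (auto simp: g1_def)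
    ultimately have N1: "N = (\<Sum>j<r. g1 j)" using N i by (simp add: g1_def)
    have "g1 j = 0" if "j \<ge> r" for j using g that by (simp add: g1_def)
    moreover have "card (insert z W) \<le> Suc (card W)" by (simp add: card_insert_if W(1))
    hence "card (insert z W) + (\<Sum>j<r. g1 j) + r \<le> m"
      using W(2) N N1 by linarith
    ultimately obtain T where T: "T \<in> sp (\<lambda>i. \<kappa> i + g1 i)" "\<forall>j<r. hd (snd T j) = zig g1 S1 j"
        "non_leaves T \<inter> insert z W = {}"
      using IH[OF N1 S1 _ inj1[folded g1_def], of "insert z W"] W(1) by blast
    obtain v L where vL: "T = (v, L)" by force
    have Lr: "length (L j) = \<kappa> j + g1 j" for j using spD(2)[OF T(1)[unfolded vL]] by simp
    have Li: "L i \<noteq> []" using Lr[of i] \<kappa>(1)[OF i(1)] by auto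
    have zL: "z \<notin> set (L j)" for j
    proof (cases "j < r")
      case False
      hence "length (L j) = 0" using Lr[of j] \<kappa>(2)[of j] g[of j] i(1) by (auto simp: g1_def)
      thus ?thesis by simp
    next
      case True
      hence Lj: "L j \<noteq> []" using Lr[of j] \<kappa>(1)[of j] by auto
      have "z \<noteq> hd (L j)"
      proof (cases "j = i")
        case True
        thus ?thesis using T(2) i vL x(2) nb_irrefl unfolding z_def g1_def by force
      next
        case False
        have "hd (L j) = zig g S j" using T(2) zj[OF True False] True vL unfolding g1_def by simp
        thus ?thesis using inj True False i(1) unfolding z_def by (auto dest: inj_onD)
      qed
      moreover have "z \<notin> set (tl (L j))" using T(3) vL by (auto simp: non_leaves_def)
      ultimately show ?thesis using Lj by (cases "L j") auto
    qed
    have zv: "z \<noteq> v" using T(3) vL by (auto simp: non_leaves_def)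
    have hdi: "hd (L i) = zig g1 S1 i" using T(2) i vL by simp
    define T' where "T' = (v, L(i := z # L i))"
    have "T' \<in> sp ((\<lambda>i. \<kappa> i + g1 i)(i := Suc (\<kappa> i + g1 i)))"
      unfolding T'_def by (rule sp_extend[OF T(1)[unfolded vL] Li _ zv zL]) (use x hdi in \<open>simp add: z_def g1_def\<close>)
    moreover have "(\<lambda>i. \<kappa> i + g1 i)(i := Suc (\<kappa> i + g1 i)) = (\<lambda>i. \<kappa> i + g i)"
      using i by (auto simp: g1_def)
    moreover have "\<forall>j<r. hd (snd T' j) = zig g S j"
      using T(2) zj vL unfolding T'_def g1_def z_def by auto
    moreover have "non_leaves T' \<inter> W = {}"
    proof -
      have tlW: "x \<notin> W" if "x \<in> set (tl (L j))" for x j using T(3) that vL unfolding non_leaves_def by auto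
      have iW: "x \<notin> W" if "x \<in> set (L i)" for x
      proof (cases "x = hd (L i)")
        case True
        thus ?thesis using x(1) hdi by (simp add: g1_def)
      next
        case False
        hence "x \<in> set (tl (L i))" using that by (cases "L i") auto
        thus ?thesis by (rule tlW)
      qed
      have "x \<notin> W" if "x \<in> set (tl ((L(i := z # L i)) j))" for x j
        using that iW tlW by (cases "j = i") auto
      moreover have "v \<notin> W" using T(3) vL by (auto simp: non_leaves_def)
      ultimately show ?thesis unfolding non_leaves_def T'_def by auto
    qed
    ultimately show ?thesis by metis
  qed
  show ?case
  proof (cases "\<exists>i<r. odd (g i)")
    case True
    then obtain i where i: "i < r" "odd (g i)" by blast
    \<comment> \<open>An odd leg ends at the neighbour of its leaf. Only the leaf is exchanged, so
      the new leaf \<open>x\<close> is adjacent to the same neighbour; it has to differ from all end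
      points for injectivity.\<close>
    define W1 where "W1 = W \<union> zig g S ` {..<r}"
    have "card W1 \<le> card W + r" unfolding W1_def
      by (metis card_Un_le card_image inj card_lessThan)
    hence "card W1 \<le> m" using W(2) by linarith
    moreover have "finite W1" using W(1) by (simp add: W1_def)
    ultimately obtain x where x: "x \<notin> W1" "replace_leaf i x S \<in> P"
      using robust_replace[OF rob SP i(1)] by blast
    define S1 where "S1 = replace_leaf i x S"
    have zi: "zig (g(i := g i - 1)) S1 i = x" using i by (auto simp: zig_def S1_def replace_leaf_def)
    have zj: "zig (g(i := g i - 1)) S1 j = zig g S j" if "j \<noteq> i" for j
      using that by (auto simp: zig_def S1_def replace_leaf_def)
    show ?thesis
    proof (rule finish[OF i(1) _ x(2)[folded S1_def]])
      show "0 < g i" using i by (auto intro: Nat.gr0I)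
      show "zig (g(i := g i - 1)) S1 j = zig g S j" if "j < r" "j \<noteq> i" for j using zj that by auto
      show "inj_on (zig (g(i := g i - 1)) S1) {..<r}"
      proof
        fix a b assume ab: "a \<in> {..<r}" "b \<in> {..<r}" "zig (g(i := g i - 1)) S1 a = zig (g(i := g i - 1)) S1 b"
        show "a = b"
          using ab zi zj x(1) inj_onD[OF inj _ ab(1,2)] unfolding W1_def
          by (metis UnCI image_eqI)
      qed
      show "zig (g(i := g i - 1)) S1 i \<notin> W" using zi x by (simp add: W1_def)
      have "S1 \<in> sp \<kappa>" using x Psp S1_def by blast
      hence "wlk ((x # tl (snd S i)) @ [fst S])"
        using spD(3)[of "fst S1" "snd S1" \<kappa> i] by (simp add: S1_def replace_leaf_def)
      hence "hd (tl (snd S i) @ [fst S]) \<in> nb x" by (simp add: wlk_Cons)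
      thus "zig g S i \<in> nb (zig (g(i := g i - 1)) S1 i)" using zi i by (simp add: zig_def)
    qed
  next
    case False
    have "(\<Sum>i<r. g i) \<noteq> 0" using N by linarith
    then obtain i where i: "i < r" "g i \<noteq> 0" by (meson lessThan_iff sum.neutral)
    \<comment> \<open>Now all end points are leaves, so they do not change when \<open>S\<close> is
      replaced by a member with the same leaves. In a member avoiding \<open>W\<close> the neighbour
      of leaf \<open>i\<close> is a legitimate new end point.\<close>
    have "card W \<le> m" using W(2) by linarith
    then obtain S1 where S1: "S1 \<in> P" "leaf_key S1 = leaf_key S" "non_leaves S1 \<inter> W = {}"
      by (rule robust_avoid[OF rob SP W(1)])
    have S1sp: "S1 \<in> sp \<kappa>" using S1 Psp by blast
    have ev: "even (g j)" if "j < r" for j using False that by blast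
    have zj: "zig (g(i := g i - 1)) S1 j = hd (snd S1 j)" if "j < r" "j \<noteq> i" for j
      using that ev by (auto simp: zig_def)
    have zi: "zig (g(i := g i - 1)) S1 i = hd (tl (snd S1 i) @ [fst S1])"
      using ev[OF i(1)] i by (auto simp: zig_def)
    have mem: "zig (g(i := g i - 1)) S1 i \<in> non_leaves S1"
      unfolding zi by (cases "tl (snd S1 i)") (auto simp: non_leaves_def intro!: exI[of _ i])
    have lfs: "hd (snd S1 j) = hd (snd S j)" if "j < r" for j
      using leaf_key_eq_hd[OF S1(2)] ne[OF SP that] by blast
    show ?thesis
    proof (rule finish[OF i(1) _ S1(1)])
      show "0 < g i" using i by simp
      show "zig (g(i := g i - 1)) S1 j = zig g S j" if "j < r" "j \<noteq> i" for j
        using zj[OF that] lfs[OF that(1)] ev[OF that(1)] by (simp add: zig_def)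
      show "inj_on (zig (g(i := g i - 1)) S1) {..<r}"
      proof
        fix a b assume ab: "a \<in> {..<r}" "b \<in> {..<r}" "zig (g(i := g i - 1)) S1 a = zig (g(i := g i - 1)) S1 b"
        have nl: "hd (snd S1 j) \<notin> non_leaves S1" if "j < r" for j
          using leaf_not_non_leaf[OF S1sp ne[OF S1(1) that]] .
        show "a = b"
          using ab zj nl mem inj_onD[OF leaves_inj[OF S1sp \<kappa>(1)], of r a b]
          by (metis lessThan_iff)
      qed
      show "zig (g(i := g i - 1)) S1 i \<notin> W" using mem S1(3) by blast
      obtain y l where yl: "snd S1 i = y # l" using ne[OF S1(1) i(1)] by (cases "snd S1 i") auto
      have "wlk ((y # l) @ [fst S1])"
        using spD(3)[of "fst S1" "snd S1" \<kappa> i] S1sp yl by simp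
      hence "hd (l @ [fst S1]) \<in> nb y" by (simp add: wlk_Cons)
      hence "zig (g(i := g i - 1)) S1 i \<in> nb y" using zi yl by simp
      moreover have "zig g S i = y" using ev[OF i(1)] lfs[OF i(1)] yl by (simp add: zig_def)
      ultimately show "zig g S i \<in> nb (zig (g(i := g i - 1)) S1 i)" using nb_sym by blast
    qed
  qed
qed

lemma card_non_leaves:
  assumes S: "S \<in> sp \<kappa>" and "\<And>i. i \<ge> r \<Longrightarrow> \<kappa> i = 0"
  shows "finite (non_leaves S)" "card (non_leaves S) \<le> Suc (\<Sum>i<r. \<kappa> i)"
proof -
  obtain c L where cL: "S = (c, L)" by force
  have len: "length (L i) = \<kappa> i" for i using spD(2) S cL by blast
  have "(\<Union>i. set (tl (L i))) = (\<Union>i<r. set (tl (L i)))"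
  proof (intro equalityI UN_least subsetI)
    fix i x assume x: "x \<in> set (tl (L i))"
    hence "i < r" using len[of i] assms(2)[of i] by (cases "i < r") auto
    thus "x \<in> (\<Union>i<r. set (tl (L i)))" using x by blast
  qed auto
  hence eq: "non_leaves S = insert c (\<Union>i<r. set (tl (L i)))" by (simp add: non_leaves_def cL)
  show "finite (non_leaves S)" unfolding eq by simp
  have "card (\<Union>i<r. set (tl (L i))) \<le> (\<Sum>i<r. card (set (tl (L i))))" by (rule card_UN_le) simp
  also have "\<dots> \<le> (\<Sum>i<r. \<kappa> i)"
    by (intro sum_mono) (metis card_length diff_le_self dual_order.trans len length_tl)
  finally have "card (\<Union>i<r. set (tl (L i))) \<le> (\<Sum>i<r. \<kappa> i)" .
  thus "card (non_leaves S) \<le> Suc (\<Sum>i<r. \<kappa> i)" unfolding eq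
    by (simp add: card_insert_if)
qed


section \<open>Subdivisions built greedily from a robust family of spiders\<close>

definition is_path :: "nat \<Rightarrow> 'a \<Rightarrow> 'a \<Rightarrow> 'a list \<Rightarrow> bool" where
  "is_path k a b p \<longleftrightarrow> wlk p \<and> distinct p \<and> length p = Suc k \<and> hd p = a \<and> last p = b"

text \<open>Branch vertices and paths as indexed families keep the combinatorial part free of
  digraphs; the translation is made once, at the end.\<close>

definition has_subdivision :: "nat \<Rightarrow> nat \<Rightarrow> nat \<Rightarrow> bool" where
  "has_subdivision s t k \<longleftrightarrow> (\<exists>a b p. inj_on a {..<s} \<and> inj_on b {..<t} \<and> a ` {..<s} \<inter> b ` {..<t} = {} \<and>
     (\<forall>i<s. \<forall>j<t. is_path k (a i) (b j) (p i j) \<and> inner_vertices (p i j) \<inter> (a ` {..<s} \<union> b ` {..<t}) = {}) \<and>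
     (\<forall>i<s. \<forall>j<t. \<forall>i'<s. \<forall>j'<t. (i, j) \<noteq> (i', j') \<longrightarrow> inner_vertices (p i j) \<inter> inner_vertices (p i' j') = {}))"

text \<open>Such an end point lies on its own leg, except that a leg of length 1 may end at the
  centre; at most one leg can do so.\<close>

lemma zig_inj:
  assumes S: "S \<in> sp \<kappa>" and \<kappa>: "\<And>i. i < r \<Longrightarrow> \<kappa> i > 0"
    and one: "\<And>i j. i < r \<Longrightarrow> j < r \<Longrightarrow> \<kappa> i = 1 \<Longrightarrow> \<kappa> j = 1 \<Longrightarrow> i = j"
  shows "inj_on (zig g S) {..<r}"
proof -
  obtain c L where cL: "S = (c, L)" by force
  note D = spD[OF S[unfolded cL]]
  have z: "(zig g S i \<in> set (L i)) \<or> (zig g S i = c \<and> \<kappa> i = 1)" if "i < r" for i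
  proof -
    have "L i \<noteq> []" using D(2)[of i] \<kappa>[OF that] by auto
    then obtain x l where xl: "L i = x # l" by (cases "L i") auto
    show ?thesis using D(2)[of i] xl by (cases l) (auto simp: zig_def cL)
  qed
  show ?thesis
  proof
    fix i j assume ij: "i \<in> {..<r}" "j \<in> {..<r}" and eq: "zig g S i = zig g S j"
    show "i = j"
    proof (rule ccontr)
      assume ne: "i \<noteq> j"
      have "set (L i) \<inter> set (L j) = {}" using D(6)[OF ne] .
      moreover have "c \<notin> set (L i)" "c \<notin> set (L j)" using D(5) by auto
      ultimately show False using z[of i] z[of j] one[of i j] ij eq ne by (metis disjoint_iff lessThan_iff)
    qed
  qed
qed

text \<open>The common end points of \<open>t\<close> lengthened spiders form one side and their
  centres the other. The spiders are found one at a time, and the summands of \<open>m\<close> pay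
  for the \<open>s\<close> end points, for at most \<open>Suc (s * k)\<close> non-leaves of each of
  \<open>t\<close> spiders, for at most \<open>s * k\<close> zigzag steps, and for the summand
  \<open>r\<close> in \<open>zigzag\<close>.\<close>

lemma spiders_imp_subdivision:
  assumes rob: "robust \<kappa> s m P" and PS: "S \<in> P" and \<kappa>: "\<And>i. i < s \<Longrightarrow> 0 < \<kappa> i \<and> \<kappa> i \<le> k" "\<And>i. i \<ge> s \<Longrightarrow> \<kappa> i = 0"
    and one: "\<And>i j. i < s \<Longrightarrow> j < s \<Longrightarrow> \<kappa> i = 1 \<Longrightarrow> \<kappa> j = 1 \<Longrightarrow> i = j"
    and m: "m \<ge> s + t * Suc (s * k) + s * k + s" and k: "k > 0"
  shows "has_subdivision s t k"
proof -
  define g where "g = (\<lambda>i. if i < s then k - \<kappa> i else 0)"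
  define a where "a = zig g S"
  define A where "A = a ` {..<s}"
  define full where "full = (\<lambda>i. if i < s then k else 0 :: nat)"
  have Ssp: "S \<in> sp \<kappa>" using PS robust_sp[OF rob] by blast
  have inj: "inj_on (zig g S) {..<s}" by (rule zig_inj[OF Ssp _ one]) (use \<kappa>(1) in auto)
  have fe: "(\<lambda>i. \<kappa> i + g i) = full"
  proof
    fix i show "\<kappa> i + g i = full i" using \<kappa>(1)[of i] \<kappa>(2)[of i] by (auto simp: g_def full_def)
  qed
  have gs: "(\<Sum>i<s. g i) \<le> s * k"
    using sum_bounded_above[of "{..<s}" g k] by (auto simp: g_def)
  have fs: "(\<Sum>i<s. full i) = s * k" by (simp add: full_def)
  have cA: "finite A" "card A \<le> s" unfolding A_def using card_image_le[of "{..<s}" a] by auto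
  define good where "good T n \<longleftrightarrow> (\<forall>j<n. T j \<in> sp full \<and> (\<forall>i<s. hd (snd (T j) i) = a i) \<and> non_leaves (T j) \<inter> A = {}) \<and>
    (\<forall>j<n. \<forall>j'<n. j \<noteq> j' \<longrightarrow> non_leaves (T j) \<inter> non_leaves (T j') = {})" for T and n :: nat
  have goodD: "T j \<in> sp full" "i < s \<Longrightarrow> hd (snd (T j) i) = a i" "non_leaves (T j) \<inter> A = {}"
    "j' < n \<Longrightarrow> j \<noteq> j' \<Longrightarrow> non_leaves (T j) \<inter> non_leaves (T j') = {}"
    if "good T n" "j < n" for T n i j j' using that unfolding good_def by auto
  have "\<exists>T. good T n" if "n \<le> t" for n
    using that
  proof (induction n)
    case (Suc n)
    then obtain T where "good T n" by auto
    note T = goodD[OF this]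
    define W where "W = A \<union> (\<Union>j<n. non_leaves (T j))"
    have nl: "finite (non_leaves (T j)) \<and> card (non_leaves (T j)) \<le> Suc (s * k)" if "j < n" for j
      using card_non_leaves[OF T(1)[OF that], of s] fs by (simp add: full_def)
    have finW: "finite W" unfolding W_def using cA(1) nl by auto
    have "card (\<Union>j<n. non_leaves (T j)) \<le> (\<Sum>j<n. card (non_leaves (T j)))" by (rule card_UN_le) simp
    also have "\<dots> \<le> (\<Sum>j<n. Suc (s * k))" by (intro sum_mono) (use nl in auto)
    also have "\<dots> = n * Suc (s * k)" by simp
    also have "\<dots> \<le> t * Suc (s * k)" using Suc.prems by (intro mult_le_mono1) simp
    finally have "card W \<le> s + t * Suc (s * k)"
      unfolding W_def using card_Un_le[of A "\<Union>j<n. non_leaves (T j)"] cA(2) by linarith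
    hence cW: "card W + (\<Sum>i<s. g i) + s \<le> m" using m gs by linarith
    have "\<And>i. i < s \<Longrightarrow> 0 < \<kappa> i" "\<And>i. s \<le> i \<Longrightarrow> g i = 0" using \<kappa>(1) by (auto simp: g_def)
    from zigzag[OF rob this(1) \<kappa>(2) PS this(2) inj finW cW]
    obtain X where X: "X \<in> sp full" "\<forall>i<s. hd (snd X i) = a i" "non_leaves X \<inter> W = {}"
      unfolding fe a_def by blast
    define T' where "T' = T(n := X)"
    have XA: "non_leaves X \<inter> A = {}" "\<And>j. j < n \<Longrightarrow> non_leaves X \<inter> non_leaves (T j) = {}"
      using X(3) unfolding W_def by blast+
    have "T' j \<in> sp full \<and> (\<forall>i<s. hd (snd (T' j) i) = a i) \<and> non_leaves (T' j) \<inter> A = {}" if "j < Suc n" for j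
      using that T(1)[of j] T(2,3)[of j] X XA by (cases "j = n") (simp_all add: T'_def)
    moreover have "non_leaves (T' j) \<inter> non_leaves (T' j') = {}" if "j < Suc n" "j' < Suc n" "j \<noteq> j'" for j j'
    proof -
      have "j = n \<and> j' < n \<or> j' = n \<and> j < n \<or> j < n \<and> j' < n" using that by linarith
      thus ?thesis using XA(2)[of j] XA(2)[of j'] T(4)[of j j'] that(3) by (auto simp: T'_def)
    qed
    ultimately have "good T' (Suc n)" unfolding good_def by blast
    thus ?case by blast
  qed (simp add: good_def)
  then obtain T where "good T t" by blast
  note T = goodD[OF this]
  define b where "b = (\<lambda>j. fst (T j))"
  define L where "L = (\<lambda>j. snd (T j))"
  have TL: "T j = (b j, L j)" for j by (simp add: b_def L_def)
  note D = spD[OF T(1)[unfolded TL]]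
  have len: "length (L j i) = k" if "i < s" "j < t" for i j using D(2)[OF that(2), of i] that by (simp add: full_def)
  have ne: "L j i \<noteq> []" if "i < s" "j < t" for i j using len[OF that] k by auto
  have nl: "b j \<in> non_leaves (T j)" "set (tl (L j i)) \<subseteq> non_leaves (T j)" for i j
    unfolding TL non_leaves_def by auto
  define p where "p = (\<lambda>i j. L j i @ [b j])"
  have inner: "inner_vertices (p i j) = set (tl (L j i))" if "i < s" "j < t" for i j
    using ne[OF that] by (simp add: p_def inner_vertices_def butlast_append)
  have bA: "b j \<notin> A" if "j < t" for j using T(3)[OF that] nl(1)[of j] by blast
  have bb: "b j \<noteq> b j'" if "j < t" "j' < t" "j \<noteq> j'" for j j' using T(4)[OF that] nl(1)[of j] nl(1)[of j'] by auto
  show ?thesis unfolding has_subdivision_def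
  proof (rule exI[of _ a], rule exI[of _ b], rule exI[of _ p], intro conjI allI impI)
    show "inj_on a {..<s}" using inj by (simp add: a_def)
    show "inj_on b {..<t}" using bb by (auto simp: inj_on_def)
    show "a ` {..<s} \<inter> b ` {..<t} = {}"
    proof -
      have "a i \<noteq> b j" if "i < s" "j < t" for i j
        using bA[OF that(2)] that(1) unfolding A_def by (metis imageI lessThan_iff)
      thus ?thesis by auto
    qed
  next
    fix i j assume ij: "i < s" "j < t"
    show "is_path k (a i) (b j) (p i j)"
      using D(3-5)[OF ij(2), of i] len[OF ij] ne[OF ij] T(2)[OF ij(2,1)]
      by (simp add: is_path_def p_def L_def)
    have "b j' \<notin> set (tl (L j i))" if "j' < t" for j'
    proof (cases "j' = j")
      case True
      thus ?thesis using D(5)[OF ij(2), of i] by (cases "L j i") auto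
    next
      case False
      thus ?thesis using T(4)[OF ij(2) that] nl(1)[of j'] nl(2)[of j i] by blast
    qed
    thus "inner_vertices (p i j) \<inter> (a ` {..<s} \<union> b ` {..<t}) = {}"
      using T(3)[OF ij(2)] nl(2)[of j i] unfolding inner[OF ij] A_def by blast
  next
    fix i j i' j' assume ij: "i < s" "j < t" "i' < s" "j' < t" "(i, j) \<noteq> (i', j')"
    show "inner_vertices (p i j) \<inter> inner_vertices (p i' j') = {}"
    proof (cases "j = j'")
      case True
      hence dis: "set (L j i) \<inter> set (L j i') = {}" using D(6)[OF ij(2), of i i'] ij(5) by simp
      have "set (tl (L j i)) \<inter> set (tl (L j i')) \<subseteq> set (L j i) \<inter> set (L j i')"
        by (intro Int_mono set_tl_subset)
      hence "set (tl (L j i)) \<inter> set (tl (L j i')) = {}" unfolding dis by simp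
      moreover have "L j' = L j" using True by simp
      ultimately show ?thesis using inner[OF ij(1,2)] inner[OF ij(3,4)] by metis
    next
      case False
      thus ?thesis using T(4)[OF ij(2,4)] nl(2)[of j i] nl(2)[of j' i'] 
        unfolding inner[OF ij(1,2)] inner[OF ij(3,4)] by blast
    qed
  qed
qed

section \<open>Robust subfamilies of dense families\<close>

text \<open>Unit vectors are added to \<open>E\<close>, because a fibre of \<open>drop_key\<close>
  for a unit vector lists the ways to move one leaf. A spider with more than \<open>m * q\<close>
  companions, at most \<open>q\<close> of them through any vertex, has one that misses
  \<open>m\<close> given vertices: hence the factor \<open>Suc (m * q)\<close>. The factor 4 is that
  of \<open>robust_subset\<close>.\<close>

lemma robust_exists:
  fixes \<epsilon> \<eta> :: real
  assumes supp: "\<And>i. i \<ge> r \<Longrightarrow> \<kappa> i = 0" and pos\<kappa>: "\<And>i. i < r \<Longrightarrow> \<kappa> i > 0"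
    and P0: "P0 \<subseteq> sp \<kappa>" and pos: "\<epsilon> > 0" "V \<noteq> {}" "D > 0"
    and dense: "real (card P0) \<ge> \<epsilon> * card V * real D ^ (\<Sum>i<r. \<kappa> i)"
    and E: "finite E" "\<And>e. e \<in> E \<Longrightarrow> e \<le> \<kappa>"
    and via: "\<And>S w. S \<in> P0 \<Longrightarrow> card {S'\<in>P0. leaf_key S' = leaf_key S \<and> w \<in> non_leaves S'} \<le> q"
    and many: "4 * Suc (m * q) * card (leaf_key ` P0) \<le> card P0"
    and \<eta>: "\<eta> * (4 * (real (card E) + r + 1)) = \<epsilon>" and D: "real m < \<eta> * D"
  shows "\<exists>P\<subseteq>P0. P \<noteq> {} \<and> robust \<kappa> r m P \<and>
     (\<forall>S\<in>P. \<forall>e\<in>E. \<eta> * real D ^ (\<Sum>i<r. e i) \<le> real (card {S'\<in>P. drop_key e S' = drop_key e S})) \<and>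
     (\<forall>S\<in>P. \<forall>i<r. \<eta> * D \<le> real (card {x. replace_leaf i x S \<in> P}))"
proof -
  define u where "u = (\<lambda>i j :: nat. if j = i then 1 else 0 :: nat)"
  define E' where "E' = E \<union> u ` {..<r}"
  define \<eta>' where "\<eta>' = \<epsilon> / (4 * (real (card E') + 1))"
  have fP0: "finite P0" by (rule finite_subset[OF P0], rule conjunct1, rule card_sp[of r], erule supp)
  have fE: "finite E'" using E(1) by (simp add: E'_def)
  have le: "e \<le> \<kappa>" if "e \<in> E'" for e
    using that E(2) pos\<kappa> by (auto simp: E'_def u_def Suc_leI le_fun_def)
  have "card E' \<le> card E + r" unfolding E'_def
    using card_Un_le[of E "u ` {..<r}"] card_image_le[of "{..<r}" u] by simp
  hence cE: "real (card E') \<le> real (card E) + r" by (metis of_nat_add of_nat_le_iff)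
  have \<eta>\<eta>: "\<eta> = \<epsilon> / (4 * (real (card E) + r + 1))"
    using \<eta> by (simp add: field_simps)
  have "\<eta> \<le> \<eta>'" unfolding \<eta>\<eta> \<eta>'_def using cE pos(1) by (intro divide_left_mono) auto
  have many': "4 * real (Suc (m * q)) * real (card (leaf_key ` P0)) \<le> real (card P0)"
    using of_nat_mono[OF many, where 'a = real] by (simp only: of_nat_mult of_nat_numeral)
  have "0 \<le> real (Suc (m * q))" by simp
  from robust_subset[of r \<kappa> P0 \<epsilon> E' "real (Suc (m * q))" \<eta>', OF supp P0 pos dense fE le this many' \<eta>'_def]
  obtain P where P: "P \<subseteq> P0" "P \<noteq> {}" 
    "\<And>S. S \<in> P \<Longrightarrow> real (Suc (m * q)) \<le> real (card {S'\<in>P. leaf_key S' = leaf_key S})"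
    "\<And>S e. S \<in> P \<Longrightarrow> e \<in> E' \<Longrightarrow> \<eta>' * real D ^ (\<Sum>i<r. e i) \<le> real (card {S'\<in>P. drop_key e S' = drop_key e S})"
    by auto
  have fP: "finite P" using P(1) fP0 finite_subset by blast
  have dk: "\<eta> * real D ^ (\<Sum>i<r. e i) \<le> real (card {S'\<in>P. drop_key e S' = drop_key e S})" if "S \<in> P" "e \<in> E'" for S e
    using P(4)[OF that] mult_right_mono[OF \<open>\<eta> \<le> \<eta>'\<close>, of "real D ^ (\<Sum>i<r. e i)"] by simp
  have fx: "finite {x. replace_leaf i x S \<in> P}" for i S
  proof (rule finite_imageD)
    show "finite ((\<lambda>x. replace_leaf i x S) ` {x. replace_leaf i x S \<in> P})"
      by (rule finite_subset[OF _ fP]) auto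
    show "inj_on (\<lambda>x. replace_leaf i x S) {x. replace_leaf i x S \<in> P}"
      by (auto simp: inj_on_def replace_leaf_def dest: fun_cong[of _ _ i])
  qed
  have rep: "\<eta> * D \<le> real (card {x. replace_leaf i x S \<in> P})" if "S \<in> P" "i < r" for S i
  proof -
    have "(\<Sum>j<r. u i j) = 1" using that by (simp add: u_def)
    hence "\<eta> * D \<le> real (card {S'\<in>P. drop_key (u i) S' = drop_key (u i) S})"
      using dk[OF that(1), of "u i"] that by (simp add: E'_def)
    also have "{S'\<in>P. drop_key (u i) S' = drop_key (u i) S} \<subseteq> (\<lambda>x. replace_leaf i x S) ` {x. replace_leaf i x S \<in> P}"
    proof
      fix S' assume "S' \<in> {S'\<in>P. drop_key (u i) S' = drop_key (u i) S}"
      hence S': "S' \<in> P" "drop_key (u i) S' = drop_key (u i) S" by auto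
      hence e: "fst S' = fst S" "drop (u i j) (snd S' j) = drop (u i j) (snd S j)" for j
        unfolding drop_key_def by (auto dest: fun_cong[of _ _ j])
      have "S' \<in> sp \<kappa>" using S'(1) P(1) P0 by blast
      hence "snd S' i \<noteq> []" using spD(2)[of "fst S'" "snd S'" \<kappa> i] pos\<kappa>[OF that(2)] by auto
      then obtain x l where x: "snd S' i = x # l" by (cases "snd S' i") auto
      have "snd S' = (snd S)(i := x # tl (snd S i))"
      proof
        fix j show "snd S' j = ((snd S)(i := x # tl (snd S i))) j"
          using e(2)[of j] x by (cases "j = i") (auto simp: u_def drop_Suc)
      qed
      hence "S' = replace_leaf i x S" using e(1) by (simp add: replace_leaf_def prod_eq_iff)
      thus "S' \<in> (\<lambda>x. replace_leaf i x S) ` {x. replace_leaf i x S \<in> P}" using S'(1) by auto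
    qed
    hence "card {S'\<in>P. drop_key (u i) S' = drop_key (u i) S} \<le> card {x. replace_leaf i x S \<in> P}"
      using fx by (meson card_image_le card_mono finite_imageI order.trans)
    finally show ?thesis by simp
  qed
  have "robust \<kappa> r m P" unfolding robust_def
  proof (intro conjI ballI allI impI)
    show "P \<subseteq> sp \<kappa>" using P(1) P0 by blast
  next
    fix S and W :: "'a set" assume S: "S \<in> P" and W: "finite W \<and> card W \<le> m"
    show "\<exists>S'\<in>P. leaf_key S' = leaf_key S \<and> non_leaves S' \<inter> W = {}"
    proof (rule ccontr)
      assume neg: "\<not> ?thesis"
      have f: "finite {S'\<in>P0. leaf_key S' = leaf_key S \<and> w \<in> non_leaves S'}" for w using fP0 by simp
      have "{S'\<in>P. leaf_key S' = leaf_key S} \<subseteq> (\<Union>w\<in>W. {S'\<in>P0. leaf_key S' = leaf_key S \<and> w \<in> non_leaves S'})"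
        using neg P(1) by blast
      hence "card {S'\<in>P. leaf_key S' = leaf_key S} \<le> card (\<Union>w\<in>W. {S'\<in>P0. leaf_key S' = leaf_key S \<and> w \<in> non_leaves S'})"
        using W f by (intro card_mono) auto
      also have "\<dots> \<le> (\<Sum>w\<in>W. card {S'\<in>P0. leaf_key S' = leaf_key S \<and> w \<in> non_leaves S'})"
        using W by (intro card_UN_le) simp
      also have "\<dots> \<le> card W * q"
        using sum_bounded_above[of W "\<lambda>w. card {S'\<in>P0. leaf_key S' = leaf_key S \<and> w \<in> non_leaves S'}" q] via[of S] S P(1) by auto
      also have "\<dots> \<le> m * q" using W by (intro mult_le_mono1) simp
      finally show False using P(3)[OF S] by linarith
    qed
  next
    fix S i and W :: "'a set" assume a: "S \<in> P" "i < r" "finite W \<and> card W \<le> m"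
    have "real m < real (card {x. replace_leaf i x S \<in> P})" using rep[OF a(1,2)] D by linarith
    hence "m < card {x. replace_leaf i x S \<in> P}" by simp
    thus "\<exists>x. x \<notin> W \<and> replace_leaf i x S \<in> P" using exists_outside[of W m _, OF _ _ _ fx] a(3) by blast
  qed
  thus ?thesis using P(1,2) dk rep unfolding E'_def by (intro exI[of _ P]) blast
qed

end

section \<open>Dense families of paths\<close>

text \<open>Pairs are counted from both sides: an \<open>x\<close> with fewer than \<open>t\<close>
  partners contributes at most \<open>t\<close>, any other at most \<open>card Y\<close>.\<close>

lemma double_count:
  fixes \<rho> :: real
  assumes fin: "finite X" "finite Y" and deg: "\<And>y. y \<in> Y \<Longrightarrow> \<rho> \<le> card {x\<in>X. Q x y}" and "card X \<le> D"
  shows "card Y * \<rho> \<le> real t * D + card Y * real (card {x\<in>X. t \<le> card {y\<in>Y. Q x y}})"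
proof -
  define X' where "X' = {x\<in>X. t \<le> card {y\<in>Y. Q x y}}"
  have "(\<Sum>y\<in>Y. card {x\<in>X. Q x y}) = (\<Sum>x\<in>X. card {y\<in>Y. Q x y})"
    using sum.swap_restrict[OF fin, of "\<lambda>_ _. 1 :: nat" Q] by simp
  also have "\<dots> \<le> (\<Sum>x\<in>X. t + (if x \<in> X' then card Y else 0))"
  proof (rule sum_mono)
    fix x assume "x \<in> X"
    moreover have "card {y\<in>Y. Q x y} \<le> card Y" using fin by (intro card_mono) auto
    ultimately show "card {y\<in>Y. Q x y} \<le> t + (if x \<in> X' then card Y else 0)"
      by (auto simp: X'_def)
  qed
  also have "\<dots> = t * card X + (\<Sum>x\<in>X. if x \<in> X' then card Y else 0)" by (simp add: sum.distrib)
  also have "(\<Sum>x\<in>X. if x \<in> X' then card Y else 0) = card Y * card X'"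
  proof -
    have "X \<inter> X' = X'" by (auto simp: X'_def)
    thus ?thesis using fin(1) by (simp add: sum.inter_restrict[symmetric])
  qed
  also have "t * card X \<le> t * D" using assms(4) by simp
  finally have "(\<Sum>y\<in>Y. card {x\<in>X. Q x y}) \<le> t * D + card Y * card X'" by simp
  hence "real (\<Sum>y\<in>Y. card {x\<in>X. Q x y}) \<le> real (t * D + card Y * card X')" by (rule of_nat_mono)
  moreover have "card Y * \<rho> \<le> (\<Sum>y\<in>Y. real (card {x\<in>X. Q x y}))"
    using sum_mono[of Y "\<lambda>_. \<rho>" "\<lambda>y. real (card {x\<in>X. Q x y})"] deg by simp
  ultimately show ?thesis by (simp add: X'_def)
qed

text \<open>A Kovari-Sos-Turan argument with \<open>Y\<close> of bounded size. By the bound on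
  \<open>t\<close>, the \<open>x\<close> with fewer than \<open>t\<close> partners account for at
  most half of the pairs, so at least \<open>\<rho> * D / 2\<close> vertices have \<open>t\<close>
  partners; as \<open>Y\<close> has \<open>2 ^ card Y\<close> subsets, \<open>s\<close> of them have
  the same partners.\<close>

lemma complete_pair:
  fixes \<rho> :: real
  assumes fin: "finite X" "finite Y" and deg: "\<And>y. y \<in> Y \<Longrightarrow> \<rho> * D \<le> card {x\<in>X. Q x y}" and X: "card X \<le> D"
    and h: "2 * t \<le> card Y * \<rho>" and D: "2 * s * 2 ^ card Y \<le> D * \<rho>" and pos: "s > 0" "t > 0"
  shows "\<exists>A\<subseteq>X. \<exists>B\<subseteq>Y. card A = s \<and> card B = t \<and> (\<forall>a\<in>A. \<forall>b\<in>B. Q a b)"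
proof -
  define X' where "X' = {x\<in>X. t \<le> card {y\<in>Y. Q x y}}"
  have Y0: "card Y > 0" using h pos by (cases "card Y = 0") auto
  have "card Y * (\<rho> * D) \<le> real t * D + card Y * real (card X')"
    unfolding X'_def by (rule double_count[OF fin deg X])
  moreover have "real t * D \<le> card Y * \<rho> * D / 2" using mult_right_mono[OF h, of "real D"] by simp
  ultimately have "card Y * (\<rho> * D / 2) \<le> card Y * real (card X')" by (simp add: field_simps)
  hence "\<rho> * D / 2 \<le> real (card X')" using Y0 by simp
  hence "real s * 2 ^ card Y \<le> real (card X')" using D by (simp add: mult_ac)
  hence "real (s * 2 ^ card Y) \<le> real (card X')" by simp
  hence cX': "s * 2 ^ card Y \<le> card X'" by (simp only: of_nat_le_iff)
  define f where "f x = {y\<in>Y. Q x y}" for x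
  have "\<exists>Z\<in>Pow Y. s \<le> card {x\<in>X'. f x = Z}"
  proof (rule ccontr)
    assume neg: "\<not> ?thesis"
    have "f x \<in> Pow Y" for x by (auto simp: f_def)
    hence "X' = (\<Union>Z\<in>Pow Y. {x\<in>X'. f x = Z})" by blast
    hence "card X' \<le> (\<Sum>Z\<in>Pow Y. card {x\<in>X'. f x = Z})"
      using card_UN_le[of "Pow Y" "\<lambda>Z. {x\<in>X'. f x = Z}"] fin by simp
    also have "\<dots> \<le> (\<Sum>Z\<in>Pow Y. s - 1)"
    proof (rule sum_mono)
      fix Z assume "Z \<in> Pow Y"
      hence "\<not> s \<le> card {x\<in>X'. f x = Z}" using neg by blast
      thus "card {x\<in>X'. f x = Z} \<le> s - 1" by linarith
    qed
    also have "\<dots> = (s - 1) * 2 ^ card Y" using fin by (simp add: card_Pow)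
    also have "\<dots> < s * 2 ^ card Y" using pos by simp
    finally show False using cX' by simp
  qed
  then obtain Z where Z: "Z \<subseteq> Y" "s \<le> card {x\<in>X'. f x = Z}" by auto
  obtain A where A: "A \<subseteq> {x\<in>X'. f x = Z}" "card A = s" using obtain_subset_with_card_n[OF Z(2)] by metis
  have "A \<noteq> {}" using A(2) pos by auto
  then obtain x where "x \<in> X'" "f x = Z" using A(1) by blast
  hence "t \<le> card Z" by (auto simp: X'_def f_def)
  then obtain B where B: "B \<subseteq> Z" "card B = t" using obtain_subset_with_card_n by metis
  have "Q a b" if "a \<in> A" "b \<in> B" for a b
  proof -
    have "f a = Z" "b \<in> Z" using that A(1) B(1) by auto
    thus ?thesis by (auto simp: f_def)
  qed
  moreover have "A \<subseteq> X" using A(1) by (auto simp: X'_def)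
  ultimately show ?thesis using A(2) B(2) order.trans[OF B(1) Z(1)] by blast
qed

text \<open>At least \<open>\<eta> * D / 2\<close> vertices of \<open>Y\<close> have at least that
  many partners. Only \<open>h\<close> of them are kept, a number that does not grow with
  \<open>D\<close>, so that the pigeonhole principle over subsets applies.\<close>

lemma dense_complete_pair:
  fixes \<eta> :: real
  assumes fin: "finite X" "finite Y" and E: "E \<subseteq> X \<times> Y" and c: "card X \<le> D" "card Y \<le> D"
    and dense: "\<eta> * real D ^ 2 \<le> card E"
    and h: "4 * t \<le> h * \<eta>" and D: "4 * s * 2 ^ h \<le> D * \<eta>" "2 * h \<le> D * \<eta>" and pos: "s > 0" "t > 0" "D > 0"
  shows "\<exists>A\<subseteq>X. \<exists>B\<subseteq>Y. card A = s \<and> card B = t \<and> A \<times> B \<subseteq> E"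
proof -
  define H where "H = {y\<in>Y. \<eta> / 2 * D \<le> card {x\<in>X. (x, y) \<in> E}}"
  have "E = (\<Union>y\<in>Y. (\<lambda>x. (x, y)) ` {x\<in>X. (x, y) \<in> E})" using E by auto
  hence "card E \<le> (\<Sum>y\<in>Y. card ((\<lambda>x. (x, y)) ` {x\<in>X. (x, y) \<in> E}))"
    using card_UN_le[OF fin(2), of "\<lambda>y. (\<lambda>x. (x, y)) ` {x\<in>X. (x, y) \<in> E}"] by simp
  also have "\<dots> = (\<Sum>y\<in>Y. card {x\<in>X. (x, y) \<in> E})"
    by (intro sum.cong refl card_image) (auto simp: inj_on_def)
  finally have "real (card E) \<le> real (\<Sum>y\<in>Y. card {x\<in>X. (x, y) \<in> E})" by (rule of_nat_mono)
  also have "\<dots> = (\<Sum>y\<in>Y. real (card {x\<in>X. (x, y) \<in> E}))" by simp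
  also have "\<dots> \<le> (\<Sum>y\<in>Y. \<eta> / 2 * D + (if y \<in> H then real D else 0))"
  proof (rule sum_mono)
    fix y assume y: "y \<in> Y"
    have "card {x\<in>X. (x, y) \<in> E} \<le> card X" using fin by (intro card_mono) auto
    hence "real (card {x\<in>X. (x, y) \<in> E}) \<le> real D" using c(1) by simp
    moreover have "0 \<le> \<eta> * D" using D(2) of_nat_0_le_iff[of h, where 'a = real] by (simp add: mult.commute)
    ultimately show "real (card {x\<in>X. (x, y) \<in> E}) \<le> \<eta> / 2 * D + (if y \<in> H then real D else 0)"
      using y by (auto simp: H_def not_le)
  qed
  also have "\<dots> = card Y * (\<eta> / 2 * D) + (\<Sum>y\<in>Y. if y \<in> H then real D else 0)" by (simp add: sum.distrib)
  also have "(\<Sum>y\<in>Y. if y \<in> H then real D else 0) = card H * D"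
  proof -
    have "Y \<inter> H = H" by (auto simp: H_def)
    thus ?thesis using fin(2) by (simp add: sum.inter_restrict[symmetric])
  qed
  also have "card Y * (\<eta> / 2 * D) \<le> D * (\<eta> / 2 * D)"
    using c(2) D(2) by (intro mult_right_mono) (auto simp: mult_ac intro: order.trans[OF of_nat_0_le_iff])
  finally have "\<eta> * real D ^ 2 \<le> D * (\<eta> / 2 * D) + card H * D" using dense by linarith
  hence "(\<eta> / 2 * D) * D \<le> card H * real D" by (simp add: power2_eq_square algebra_simps)
  hence "\<eta> / 2 * D \<le> card H" using pos(3) by simp
  hence "real h \<le> card H" using D(2) by (simp add: mult_ac)
  then obtain Y' where Y': "Y' \<subseteq> H" "card Y' = h" using obtain_subset_with_card_n[of h H] by auto
  have sub: "Y' \<subseteq> Y" using Y'(1) by (auto simp: H_def)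
  have "\<exists>A\<subseteq>X. \<exists>B\<subseteq>Y'. card A = s \<and> card B = t \<and> (\<forall>a\<in>A. \<forall>b\<in>B. (a, b) \<in> E)"
  proof (rule complete_pair[where \<rho> = "\<eta> / 2" and D = D])
    show "finite Y'" using sub fin(2) finite_subset by blast
    show "\<eta> / 2 * D \<le> card {x\<in>X. (x, y) \<in> E}" if "y \<in> Y'" for y using that Y'(1) by (auto simp: H_def)
    show "2 * real t \<le> card Y' * (\<eta> / 2)" using h Y'(2) by simp
    show "2 * real s * 2 ^ card Y' \<le> D * (\<eta> / 2)" using D(1) Y'(2) by simp
  qed (use fin c pos in auto)
  thus ?thesis using sub by (metis (no_types, lifting) SigmaE order.trans subsetI)
qed

text \<open>A path of length \<open>l\<close> is regarded as a spider centred at its second vertex.\<close>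

definition path_type :: "nat \<Rightarrow> nat \<Rightarrow> nat" where
  "path_type l = (\<lambda>i. if i = 0 then 1 else if i = 1 then l - 1 else 0)"

section \<open>Pairs of vertices linked by zigzag paths\<close>

context bounded_graph begin

definition linked :: "nat \<Rightarrow> nat \<Rightarrow> 'a \<Rightarrow> 'a \<Rightarrow> bool" where
  "linked k m a b \<longleftrightarrow> a \<noteq> b \<and>
     (\<forall>W. finite W \<and> card W \<le> m \<longrightarrow> (\<exists>p. is_path k a b p \<and> inner_vertices p \<inter> W = {}))"

lemma linkedD:
  assumes "linked k m a b" "finite W" "card W \<le> m"
  obtains p where "is_path k a b p" "inner_vertices p \<inter> W = {}"
  using assms unfolding linked_def by metis

lemma path_set:
  assumes p: "is_path k a b p" and k: "k > 0"
  shows "p = a # butlast (tl p) @ [b]" "tl p = butlast (tl p) @ [b]"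
    "set p = insert a (insert b (inner_vertices p))"
proof -
  obtain x q where q: "p = x # q" "length q = k" "x = a" using p by (cases p) (auto simp: is_path_def)
  hence "q \<noteq> []" using k by auto
  moreover have "last q = b" using p q \<open>q \<noteq> []\<close> by (simp add: is_path_def)
  ultimately have *: "q = butlast q @ [b]" by (metis append_butlast_last_id)
  show "p = a # butlast (tl p) @ [b]" "tl p = butlast (tl p) @ [b]" using * q by simp_all
  have "set q = insert b (set (butlast q))" using arg_cong[OF *, of set] by simp
  thus "set p = insert a (insert b (inner_vertices p))" using q by (simp add: inner_vertices_def)
qed

lemma card_inner: "is_path k a b p \<Longrightarrow> finite (inner_vertices p) \<and> card (inner_vertices p) \<le> k"
  unfolding inner_vertices_def is_path_def
  by (metis List.finite_set card_length diff_le_self diff_Suc_1 le_trans length_butlast length_tl)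

text \<open>The \<open>s * t\<close> paths are chosen one after another, each avoiding both sides
  and the at most \<open>k\<close> inner vertices of every earlier path.\<close>

lemma linked_imp_subdivision:
  assumes A: "card A = s" and B: "card B = t" and pos: "s > 0" "t > 0"
    and l: "\<And>a b. a \<in> A \<Longrightarrow> b \<in> B \<Longrightarrow> linked k m a b" and m: "m \<ge> s + t + s * t * k"
  shows "has_subdivision s t k"
proof -
  have fin: "finite A" "finite B" using A B pos by (auto intro: card_ge_0_finite)
  obtain a where a: "bij_betw a {..<s} A" using ex_bij_betw_nat_finite[OF fin(1)] A by (auto simp: atLeast0LessThan)
  obtain b where b: "bij_betw b {..<t} B" using ex_bij_betw_nat_finite[OF fin(2)] B by (auto simp: atLeast0LessThan)
  have aA: "a i \<in> A" if "i < s" for i using a that by (auto simp: bij_betw_def)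
  have bB: "b i \<in> B" if "i < t" for i using b that by (auto simp: bij_betw_def)
  define good where "good p X \<longleftrightarrow> (\<forall>x\<in>X. is_path k (a (fst x)) (b (snd x)) (p x) \<and> inner_vertices (p x) \<inter> (A \<union> B) = {}) \<and>
     (\<forall>x\<in>X. \<forall>y\<in>X. x \<noteq> y \<longrightarrow> inner_vertices (p x) \<inter> inner_vertices (p y) = {})" for p X
  have "\<exists>p. good p X" if "finite X" "X \<subseteq> {..<s} \<times> {..<t}" for X
    using that
  proof (induction X rule: finite_induct)
    case empty
    thus ?case by (simp add: good_def)
  next
    case (insert x X)
    obtain p where p: "good p X" using insert by auto
    define W where "W = A \<union> B \<union> (\<Union>y\<in>X. inner_vertices (p y))"
    have ci: "finite (inner_vertices (p y)) \<and> card (inner_vertices (p y)) \<le> k" if "y \<in> X" for y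
      using p that card_inner unfolding good_def by blast
    have "card X \<le> s * t" using card_mono[of "{..<s} \<times> {..<t}" X] insert.prems by simp
    have "card (\<Union>y\<in>X. inner_vertices (p y)) \<le> (\<Sum>y\<in>X. card (inner_vertices (p y)))"
      by (rule card_UN_le[OF insert.hyps(1)])
    also have "\<dots> \<le> card X * k" using sum_bounded_above[of X "\<lambda>y. card (inner_vertices (p y))" k] ci by simp
    also have "\<dots> \<le> s * t * k" using \<open>card X \<le> s * t\<close> by simp
    finally have "card W \<le> m"
      unfolding W_def using card_Un_le[of "A \<union> B" "\<Union>y\<in>X. inner_vertices (p y)"] card_Un_le[of A B] A B m by linarith
    moreover have "finite W" unfolding W_def using fin insert.hyps(1) ci by auto
    moreover have "fst x < s" "snd x < t" using insert.prems by auto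
    hence "linked k m (a (fst x)) (b (snd x))" using l aA bB by blast
    ultimately obtain q where q: "is_path k (a (fst x)) (b (snd x)) q" "inner_vertices q \<inter> W = {}"
      using linkedD by metis
    have q1: "inner_vertices q \<inter> (A \<union> B) = {}" using q(2) by (auto simp: W_def)
    have q2: "inner_vertices q \<inter> inner_vertices (p y) = {}" "inner_vertices (p y) \<inter> inner_vertices q = {}"
      if "y \<in> X" for y using q(2) that by (auto simp: W_def)
    have px: "(p(x := q)) y = p y" if "y \<in> X" for y using that insert.hyps(2) by auto
    have "good (p(x := q)) (insert x X)"
      unfolding good_def
    proof (intro conjI ballI impI)
      fix y assume "y \<in> insert x X"
      thus "is_path k (a (fst y)) (b (snd y)) ((p(x := q)) y)"
        using q(1) px p unfolding good_def by (metis fun_upd_same insertE)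
    next
      fix y assume "y \<in> insert x X"
      thus "inner_vertices ((p(x := q)) y) \<inter> (A \<union> B) = {}"
        using q1 px p unfolding good_def by (metis fun_upd_same insertE)
    next
      fix y z assume "y \<in> insert x X" "z \<in> insert x X" "y \<noteq> z"
      moreover have "inner_vertices (p y) \<inter> inner_vertices (p z) = {}" if "y \<in> X" "z \<in> X"
        using p that \<open>y \<noteq> z\<close> unfolding good_def by blast
      ultimately show "inner_vertices ((p(x := q)) y) \<inter> inner_vertices ((p(x := q)) z) = {}"
        using q2(1)[of z] q2(2)[of y] by (cases "y = x"; cases "z = x") simp_all
    qed
    thus ?case by blast
  qed
  from this[of "{..<s} \<times> {..<t}"] obtain p where p: "good p ({..<s} \<times> {..<t})" by auto
  have AB: "a ` {..<s} = A" "b ` {..<t} = B" using a b by (auto simp: bij_betw_def)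
  have p1: "is_path k (a i) (b j) (p (i, j))" "inner_vertices (p (i, j)) \<inter> (A \<union> B) = {}" if "i < s" "j < t" for i j
    using p that unfolding good_def by auto
  have p2: "inner_vertices (p (i, j)) \<inter> inner_vertices (p (i', j')) = {}"
    if "i < s" "j < t" "i' < s" "j' < t" "(i, j) \<noteq> (i', j')" for i j i' j'
    using p that unfolding good_def by (metis lessThan_iff mem_Sigma_iff)
  have "A \<inter> B = {}" using l unfolding linked_def by blast
  note AB0 = this
  show ?thesis unfolding has_subdivision_def AB
  proof (rule exI[of _ a], rule exI[of _ b], rule exI[of _ "\<lambda>i j. p (i, j)"], intro conjI allI impI)
    show "inj_on a {..<s}" "inj_on b {..<t}" using a b by (simp_all add: bij_betw_def)
    show "a ` {..<s} \<inter> b ` {..<t} = {}" using AB0 by (simp only: AB)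
  qed (use p1 p2 in \<open>simp_all add: AB\<close>)
qed

text \<open>All zigzag steps are made on leg 1. Their number is even, so the leg ends at its own
  leaf again and both ends of the path stay fixed while the length grows from \<open>l\<close> to
  \<open>k\<close>.\<close>

lemma linked_even:
  assumes rob: "robust (path_type l) 2 M P" and S: "S \<in> P" and l: "2 \<le> l" "l \<le> k" "even (k - l)"
    and M: "M \<ge> m + k + 2"
  shows "linked k m (hd (snd S 0)) (hd (snd S 1))"
proof -
  define g :: "nat \<Rightarrow> nat" where "g = (\<lambda>i. if i = 1 then k - l else 0)"
  have pt: "path_type l i > 0" if "i < 2" for i using that l by (auto simp: path_type_def)
  have pt0: "path_type l i = 0" if "i \<ge> 2" for i using that by (auto simp: path_type_def)
  have Ssp: "S \<in> sp (path_type l)" using S robust_sp[OF rob] by blast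
  have zg: "zig g S = (\<lambda>i. hd (snd S i))" using l(3) by (auto simp: zig_def g_def)
  have inj: "inj_on (zig g S) {..<2}" unfolding zg by (rule leaves_inj[OF Ssp pt])
  have g0: "g i = 0" if "i \<ge> 2" for i using that by (simp add: g_def)
  have sg: "(\<Sum>i<2. g i) = k - l" by (simp add: g_def numeral_2_eq_2)
  define a b where "a = hd (snd S 0)" and "b = hd (snd S 1)"
  have "a \<noteq> b" using inj_onD[OF inj, of 0 1] unfolding zg a_def b_def by auto
  moreover have "\<exists>p. is_path k a b p \<and> inner_vertices p \<inter> W = {}" if W: "finite W" "card W \<le> m" for W
  proof -
    have "card W + (\<Sum>i<2. g i) + 2 \<le> M" using W(2) M sg by linarith
    from zigzag[OF rob pt pt0 S g0 inj W(1) this]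
    obtain T where T: "T \<in> sp (\<lambda>i. path_type l i + g i)" "\<forall>i<2. hd (snd T i) = zig g S i" "non_leaves T \<inter> W = {}"
      by blast
    obtain v L where vL: "T = (v, L)" by force
    note D = spD[OF T(1)[unfolded vL]]
    have "length (L 0) = 1" using D(2)[of 0] by (simp add: path_type_def g_def)
    hence "L 0 = [hd (L 0)]" by (cases "L 0") auto
    moreover have "hd (L 0) = a" using T(2) vL by (simp add: zg a_def)
    ultimately have L0: "L 0 = [a]" by simp
    have len1: "length (L 1) = k - 1" using D(2)[of 1] l by (simp add: path_type_def g_def)
    hence ne1: "L 1 \<noteq> []" using l by auto
    have "hd (L 1) = b" using T(2) vL by (simp add: zg b_def)
    hence L1: "L 1 = b # tl (L 1)" using ne1 by (cases "L 1") auto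
    define p where "p = a # v # rev (L 1)"
    have rv: "rev (L 1 @ [v]) = v # rev (L 1)" by simp
    have "v \<in> nb a" using D(3)[of 0] L0 by (simp add: wlk_Cons)
    hence w: "wlk p" unfolding p_def using D(3)[of 1] wlk_rev[of "L 1 @ [v]"] unfolding rv by (simp add: wlk_Cons)
    have "a \<notin> set (L 1)" using D(6)[of 0 1] L0 by auto
    moreover have "a \<noteq> v" using D(5)[of 0] L0 by auto
    ultimately have d: "distinct p" unfolding p_def using D(4)[of 1] D(5)[of 1] by simp
    have "last p = b" unfolding p_def using ne1 \<open>hd (L 1) = b\<close> by (simp add: last_rev)
    hence "is_path k a b p" using w d len1 l by (simp add: is_path_def p_def)
    moreover have "inner_vertices p = insert v (set (tl (L 1)))"
    proof -
      obtain l' where "L 1 = b # l'" using L1 by metis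
      thus ?thesis by (simp add: inner_vertices_def p_def butlast_append)
    qed
    hence "inner_vertices p \<inter> W = {}" using T(3) unfolding vL non_leaves_def by auto
    ultimately show ?thesis by blast
  qed
  ultimately show ?thesis unfolding linked_def a_def b_def by blast
qed

definition leaf_pairs :: "'a spider set \<Rightarrow> ('a \<times> 'a) set" where
  "leaf_pairs P = (\<lambda>S. (hd (snd S 0), hd (snd S 1))) ` P"

text \<open>The path consists of a path of length \<open>k - 1\<close> from \<open>a\<close> to a
  neighbour \<open>b\<close> of \<open>c\<close>, where the difference to \<open>l\<close> is even,
  and of the edge from \<open>b\<close> to \<open>c\<close>. More than \<open>m\<close> candidates
  leave a \<open>b\<close> outside \<open>W\<close>; the first part must avoid \<open>c\<close> too,
  hence the budget \<open>m + 1\<close> there.\<close>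

lemma linked_odd:
  assumes rob: "robust (path_type l) 2 M P" and l: "2 \<le> l" "l \<le> k" "odd (k - l)"
    and M: "M \<ge> m + k + 3" and ac: "a \<noteq> c" and many: "m < card {b\<in>nb c. (a, b) \<in> leaf_pairs P}"
  shows "linked k m a c"
proof -
  have "\<exists>p. is_path k a c p \<and> inner_vertices p \<inter> W = {}" if W: "finite W" "card W \<le> m" for W
  proof -
    obtain b where b: "b \<in> nb c" "(a, b) \<in> leaf_pairs P" "b \<notin> W"
      using exists_outside[OF W many] by auto
    obtain S where S: "S \<in> P" "a = hd (snd S 0)" "b = hd (snd S 1)" using b(2) by (auto simp: leaf_pairs_def)
    have k: "l < k" using l by (metis diff_self_eq_0 even_zero le_neq_implies_less)
    hence k1: "l \<le> k - 1" "even (k - 1 - l)" using l(3) by auto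
    have "M \<ge> (m + 1) + (k - 1) + 2" using M by linarith
    hence lk: "linked (k - 1) (m + 1) a b" using linked_even[OF rob S(1) l(1) k1] S by simp
    have "card (insert c W) \<le> m + 1" using W by (simp add: card_insert_if)
    then obtain p where p: "is_path (k - 1) a b p" "inner_vertices p \<inter> insert c W = {}"
      using linkedD[OF lk] W(1) by (metis finite_insert)
    have kp: "k - 1 > 0" using k l by linarith
    note ps = path_set[OF p(1) kp]
    have "c \<noteq> b" using b(1) nb_irrefl by blast
    hence "c \<notin> set p" using ps(3) p(2) ac by auto
    moreover have "wlk (p @ [c])"
    proof -
      have "wlk p" "p \<noteq> []" "last p = b" using p(1) by (auto simp: is_path_def)
      moreover have "c \<in> nb b" using b(1) nb_sym by blast
      moreover have "c \<in> V" using \<open>c \<in> nb b\<close> nb_V by blast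
      ultimately show ?thesis by (simp add: wlk_append) (simp add: wlk_def)
    qed
    moreover have "hd (p @ [c]) = a" using p(1) ps(1) by (metis append_Cons list.sel(1))
    ultimately have "is_path k a c (p @ [c])" using p(1) kp by (auto simp: is_path_def)
    moreover have "inner_vertices (p @ [c]) = insert b (inner_vertices p)"
    proof -
      have "tl (p @ [c]) = tl p @ [c]" using ps(1) by (metis list.discI tl_append2)
      hence "inner_vertices (p @ [c]) = set (tl p)" by (simp add: inner_vertices_def)
      also have "\<dots> = set (butlast (tl p) @ [b])" by (rule arg_cong[OF ps(2)])
      finally show ?thesis by (simp add: inner_vertices_def)
    qed
    ultimately show ?thesis using p(2) b(3) by (intro exI[of _ "p @ [c]"]) auto
  qed
  thus ?thesis using ac unfolding linked_def by blast
qed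

text \<open>Appending the centre makes \<open>hd\<close> the next vertex inwards even if the leg has
  length 1.\<close>

lemma leg_step:
  assumes "S \<in> sp \<kappa>" "snd S i \<noteq> []"
  shows "hd (snd S i) \<in> nb (hd (tl (snd S i) @ [fst S]))"
proof -
  obtain x l where x: "snd S i = x # l" using assms(2) by (cases "snd S i") auto
  have "wlk ((x # l) @ [fst S])" using spD(3)[of "fst S" "snd S" \<kappa> i] assms(1) x by simp
  thus ?thesis using x nb_sym by (simp add: wlk_Cons)
qed

lemma path_spider_cong:
  assumes "S \<in> sp (path_type l)" "S' \<in> sp (path_type l)" "fst S = fst S'" "snd S 0 = snd S' 0" "snd S 1 = snd S' 1"
  shows "S = S'"
proof -
  have "snd S i = snd S' i" for i
  proof (cases "i < 2")
    case True
    thus ?thesis using assms(4,5) by (auto simp: less_2_cases_iff)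
  next
    case False
    hence "length (snd S i) = 0" "length (snd S' i) = 0"
      using spD(2)[of "fst S" "snd S" "path_type l" i] spD(2)[of "fst S'" "snd S'" "path_type l" i] assms(1,2)
      by (auto simp: path_type_def)
    thus ?thesis by simp
  qed
  thus ?thesis using assms(3) by (auto simp: prod_eq_iff)
qed

lemma path_spider_ne:
  assumes "S \<in> sp (path_type l)" "l \<ge> 2"
  shows "snd S 0 \<noteq> []" "snd S 1 \<noteq> []"
  using spD(2)[of "fst S" "snd S" "path_type l" 0] spD(2)[of "fst S" "snd S" "path_type l" 1] assms
  by (auto simp: path_type_def)

section \<open>The parity cases for paths\<close>

text \<open>With all inner vertices fixed, the two ends range over the neighbourhoods of two fixed
  vertices, and a positive proportion of all pairs occurs. A complete bipartite graph formed by
  these linked pairs turns into the subdivision.\<close>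

lemma paths_even:
  fixes \<eta> :: real
  assumes rob: "robust (path_type l) 2 M P" and S: "S \<in> P" and l: "2 \<le> l" "l \<le> k" "even (k - l)"
    and M: "M \<ge> s + t + s * t * k + k + 2"
    and dense: "\<eta> * real D ^ 2 \<le> card {S'\<in>P. drop_key (\<lambda>i. if i < 2 then 1 else 0) S' = drop_key (\<lambda>i. if i < 2 then 1 else 0) S}"
    and h: "4 * t \<le> h * \<eta>" and D: "4 * s * 2 ^ h \<le> D * \<eta>" "2 * h \<le> D * \<eta>" and pos: "s > 0" "t > 0" "D > 0"
  shows "has_subdivision s t k"
proof -
  define e where "e = (\<lambda>i :: nat. if i < 2 then 1 else 0 :: nat)"
  define F where "F = {S'\<in>P. drop_key e S' = drop_key e S}"
  define f where "f S = (hd (snd S 0), hd (snd S 1))" for S :: "'a spider"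
  have sub: "P \<subseteq> sp (path_type l)" by (rule robust_sp[OF rob])
  have FD: "S' \<in> P" "fst S' = fst S" "tl (snd S' 0) = tl (snd S 0)" "tl (snd S' 1) = tl (snd S 1)" if "S' \<in> F" for S'
  proof -
    have "drop_key e S' = drop_key e S" using that by (simp add: F_def)
    hence "fst S' = fst S" "(\<lambda>i. drop (e i) (snd S' i)) = (\<lambda>i. drop (e i) (snd S i))" by (simp_all add: drop_key_def)
    thus "fst S' = fst S" "tl (snd S' 0) = tl (snd S 0)" "tl (snd S' 1) = tl (snd S 1)"
      using fun_cong[of _ _ 0] fun_cong[of _ _ 1] by (fastforce simp: e_def drop_Suc)+
  qed (use that in \<open>simp add: F_def\<close>)
  have ne: "snd S' 0 \<noteq> []" "snd S' 1 \<noteq> []" if "S' \<in> F" for S'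
    using path_spider_ne[OF subsetD[OF sub FD(1)[OF that]] l(1)] by auto
  have "inj_on f F"
  proof
    fix S1 S2 assume S12: "S1 \<in> F" "S2 \<in> F" "f S1 = f S2"
    have "snd S1 0 = snd S2 0"
      using S12(3) FD(3)[OF S12(1)] FD(3)[OF S12(2)] ne(1)[OF S12(1)] ne(1)[OF S12(2)] unfolding f_def
      by (metis Pair_inject list.collapse)
    moreover have "snd S1 1 = snd S2 1"
      using S12(3) FD(4)[OF S12(1)] FD(4)[OF S12(2)] ne(2)[OF S12(1)] ne(2)[OF S12(2)] unfolding f_def
      by (metis Pair_inject list.collapse)
    moreover have "fst S1 = fst S2" using FD(2)[OF S12(1)] FD(2)[OF S12(2)] by simp
    ultimately show "S1 = S2"
      using path_spider_cong subsetD[OF sub FD(1)[OF S12(1)]] subsetD[OF sub FD(1)[OF S12(2)]] by blast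
  qed
  hence "card (f ` F) = card F" by (rule card_image)
  hence dens: "\<eta> * real D ^ 2 \<le> card (f ` F)" using dense by (simp add: F_def e_def)
  have "f ` F \<subseteq> nb (hd (tl (snd S 0) @ [fst S])) \<times> nb (hd (tl (snd S 1) @ [fst S]))"
  proof
    fix z assume "z \<in> f ` F"
    then obtain S' where S': "S' \<in> F" "z = f S'" by auto
    have "S' \<in> sp (path_type l)" using S' FD sub by blast
    from leg_step[OF this ne(1)[OF S'(1)]] leg_step[OF this ne(2)[OF S'(1)]]
    show "z \<in> nb (hd (tl (snd S 0) @ [fst S])) \<times> nb (hd (tl (snd S 1) @ [fst S]))"
      using S' FD(2-4)[OF S'(1)] by (simp add: f_def)
  qed
  from dense_complete_pair[OF fin_nb fin_nb this card_nb card_nb dens h D pos]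
  obtain A B where AB: "card A = s" "card B = t" "A \<times> B \<subseteq> f ` F" by blast
  show ?thesis
  proof (rule linked_imp_subdivision[OF AB(1,2) pos(1,2) _ order.refl])
    fix a b assume "a \<in> A" "b \<in> B"
    then obtain S' where "S' \<in> F" "(a, b) = f S'" using AB(3) by blast
    thus "linked k (s + t + s * t * k) a b"
      using linked_even[OF rob FD(1) l] M by (auto simp: f_def)
  qed
qed


text \<open>The pairs to be linked are the end \<open>a\<close> of leg 0 and the neighbour
  \<open>c\<close> of the other end. Moving that other end yields many neighbours of
  \<open>c\<close> that form a leaf pair with \<open>a\<close>. A pair arises from at most
  \<open>D\<close> members of the fibre, so \<open>\<eta> * D ^ 3\<close> members give
  \<open>\<eta> * D ^ 2\<close> pairs. For \<open>l \<ge> 3\<close> leg 1 has two vertices, so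
  \<open>c\<close> is not the centre and varies.\<close>

lemma paths_odd:
  fixes \<eta> :: real
  assumes rob: "robust (path_type l) 2 M P" and S: "S \<in> P" and l: "3 \<le> l" "l \<le> k" "odd (k - l)"
    and M: "M \<ge> s + t + s * t * k + k + 3"
    and dense: "\<eta> * real D ^ 3 \<le> card {S'\<in>P. drop_key (\<lambda>i. if i = 0 then 1 else if i = 1 then 2 else 0) S' =
         drop_key (\<lambda>i. if i = 0 then 1 else if i = 1 then 2 else 0) S}"
    and rep: "\<And>S. S \<in> P \<Longrightarrow> s + t + s * t * k < card {x. replace_leaf 1 x S \<in> P}"
    and h: "4 * t \<le> h * \<eta>" and D: "4 * s * 2 ^ h \<le> D * \<eta>" "2 * h \<le> D * \<eta>" and pos: "s > 0" "t > 0" "D > 0"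
  shows "has_subdivision s t k"
proof -
  define e where "e = (\<lambda>i :: nat. if i = 0 then 1 else if i = 1 then 2 else 0 :: nat)"
  define F where "F = {S'\<in>P. drop_key e S' = drop_key e S}"
  define f where "f S = (hd (snd S 0), hd (tl (snd S 1)))" for S :: "'a spider"
  define f3 where "f3 S = (f S, hd (snd S 1))" for S :: "'a spider"
  have sub: "P \<subseteq> sp (path_type l)" by (rule robust_sp[OF rob])
  have FD: "S' \<in> P" "fst S' = fst S" "tl (snd S' 0) = tl (snd S 0)" "tl (tl (snd S' 1)) = tl (tl (snd S 1))" if "S' \<in> F" for S'
  proof -
    have "drop_key e S' = drop_key e S" using that by (simp add: F_def)
    hence "fst S' = fst S" "(\<lambda>i. drop (e i) (snd S' i)) = (\<lambda>i. drop (e i) (snd S i))" by (simp_all add: drop_key_def)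
    thus "fst S' = fst S" "tl (snd S' 0) = tl (snd S 0)" "tl (tl (snd S' 1)) = tl (tl (snd S 1))"
      using fun_cong[of _ _ 0] fun_cong[of _ _ 1] by (fastforce simp: e_def drop_Suc numeral_2_eq_2)+
  qed (use that in \<open>simp add: F_def\<close>)
  have shape: "\<exists>a b c m. snd S' 0 = [a] \<and> snd S' 1 = b # c # m" if "S' \<in> P" for S'
  proof -
    have "length (snd S' 0) = 1" "length (snd S' 1) \<ge> 2"
      using spD(2)[of "fst S'" "snd S'" "path_type l" 0] spD(2)[of "fst S'" "snd S'" "path_type l" 1] subsetD[OF sub that] l
      by (auto simp: path_type_def)
    thus ?thesis by (cases "snd S' 0"; cases "snd S' 1"; cases "tl (snd S' 1)") auto
  qed
  have inj: "inj_on f3 F"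
  proof
    fix S1 S2 assume S12: "S1 \<in> F" "S2 \<in> F" "f3 S1 = f3 S2"
    obtain a b c m where 1: "snd S1 0 = [a]" "snd S1 1 = b # c # m" using shape[OF FD(1)[OF S12(1)]] by blast
    obtain a' b' c' m' where 2: "snd S2 0 = [a']" "snd S2 1 = b' # c' # m'" using shape[OF FD(1)[OF S12(2)]] by blast
    have "m = m'" using FD(4)[OF S12(1)] FD(4)[OF S12(2)] 1 2 by simp
    moreover have "a = a'" "b = b'" "c = c'" using S12(3) 1 2 by (simp_all add: f3_def f_def)
    moreover have "fst S1 = fst S2" using FD(2)[OF S12(1)] FD(2)[OF S12(2)] by simp
    ultimately show "S1 = S2"
      using path_spider_cong[of S1 l S2] subsetD[OF sub FD(1)[OF S12(1)]] subsetD[OF sub FD(1)[OF S12(2)]] 1 2 by simp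
  qed
  have f3sub: "f3 ` F \<subseteq> (\<Union>z\<in>f ` F. (\<lambda>x. (z, x)) ` nb (snd z))"
  proof
    fix y assume "y \<in> f3 ` F"
    then obtain S' where S': "S' \<in> F" "y = f3 S'" by auto
    obtain a b c m where 1: "snd S' 0 = [a]" "snd S' 1 = b # c # m" using shape[OF FD(1)[OF S'(1)]] by blast
    have "b \<in> nb c" using leg_step[OF subsetD[OF sub FD(1)[OF S'(1)]], of 1] 1 by simp
    thus "y \<in> (\<Union>z\<in>f ` F. (\<lambda>x. (z, x)) ` nb (snd z))" using S' 1 by (auto simp: f3_def f_def intro!: bexI[of _ S'])
  qed
  have finF: "finite F"
    by (rule finite_subset[of _ "sp (path_type l)"]) (use sub FD(1) card_sp[of 2 "path_type l"] in \<open>auto simp: path_type_def\<close>)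
  have "card F = card (f3 ` F)" using card_image[OF inj] by simp
  also have "\<dots> \<le> card (\<Union>z\<in>f ` F. (\<lambda>x. (z, x)) ` nb (snd z))"
    using finF by (intro card_mono[OF _ f3sub]) auto
  also have "\<dots> \<le> (\<Sum>z\<in>f ` F. card ((\<lambda>x. (z, x)) ` nb (snd z)))" using finF by (intro card_UN_le) auto
  also have "\<dots> \<le> (\<Sum>z\<in>f ` F. D)" by (intro sum_mono order.trans[OF card_image_le card_nb]) simp
  finally have "real (card F) \<le> real (card (f ` F) * D)" by (intro of_nat_mono) simp
  moreover have "\<eta> * real D ^ 3 \<le> card F" using dense by (simp add: F_def e_def)
  ultimately have "(\<eta> * real D ^ 2) * D \<le> card (f ` F) * real D" by (simp add: power2_eq_square power3_eq_cube mult_ac)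
  hence dens: "\<eta> * real D ^ 2 \<le> card (f ` F)" using pos(3) by simp
  have "f ` F \<subseteq> nb (hd (tl (snd S 0) @ [fst S])) \<times> nb (hd (tl (tl (snd S 1)) @ [fst S]))"
  proof
    fix z assume "z \<in> f ` F"
    then obtain S' where S': "S' \<in> F" "z = f S'" by auto
    obtain a b c m where 1: "snd S' 0 = [a]" "snd S' 1 = b # c # m" using shape[OF FD(1)[OF S'(1)]] by blast
    have Ssp: "S' \<in> sp (path_type l)" using S' FD sub by blast
    have "wlk ((b # c # m) @ [fst S'])" using spD(3)[of "fst S'" "snd S'" "path_type l" 1] Ssp 1 by simp
    hence "c \<in> nb (hd (m @ [fst S']))" using nb_sym by (simp add: wlk_Cons)
    moreover have "a \<in> nb (fst S')" using leg_step[OF Ssp, of 0] 1 by simp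
    ultimately show "z \<in> nb (hd (tl (snd S 0) @ [fst S])) \<times> nb (hd (tl (tl (snd S 1)) @ [fst S]))"
      using S' FD(2-4)[OF S'(1)] 1 by (simp add: f_def)
  qed
  from dense_complete_pair[OF fin_nb fin_nb this card_nb card_nb dens h D pos]
  obtain A B where AB: "card A = s" "card B = t" "A \<times> B \<subseteq> f ` F" by blast
  show ?thesis
  proof (rule linked_imp_subdivision[OF AB(1,2) pos(1,2) _ order.refl])
    fix a c assume "a \<in> A" "c \<in> B"
    then obtain S' where S': "S' \<in> F" "(a, c) = f S'" using AB(3) by blast
    obtain b m where 1: "snd S' 0 = [a]" "snd S' 1 = b # c # m" using shape[OF FD(1)[OF S'(1)]] S'(2) by (auto simp: f_def)
    have Ssp: "S' \<in> sp (path_type l)" using S' FD sub by blast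
    have "a \<noteq> c" using spD(6)[of "fst S'" "snd S'" "path_type l" 0 1] Ssp 1 by auto
    have "{x. replace_leaf 1 x S' \<in> P} \<subseteq> {b\<in>nb c. (a, b) \<in> leaf_pairs P}"
    proof
      fix x assume "x \<in> {x. replace_leaf 1 x S' \<in> P}"
      hence x: "replace_leaf 1 x S' \<in> P" by simp
      have "x \<in> nb c" using leg_step[OF subsetD[OF sub x], of 1] 1 by (simp add: replace_leaf_def)
      moreover have "(a, x) \<in> leaf_pairs P" unfolding leaf_pairs_def
        by (rule image_eqI[OF _ x]) (use 1 in \<open>simp add: replace_leaf_def\<close>)
      ultimately show "x \<in> {b\<in>nb c. (a, b) \<in> leaf_pairs P}" by simp
    qed
    hence "card {x. replace_leaf 1 x S' \<in> P} \<le> card {b\<in>nb c. (a, b) \<in> leaf_pairs P}" by (intro card_mono) auto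
    hence "s + t + s * t * k < card {b\<in>nb c. (a, b) \<in> leaf_pairs P}" using rep[OF FD(1)[OF S'(1)]] by linarith
    thus "linked k (s + t + s * t * k) a c"
      using linked_odd[OF rob _ l(2,3) _ \<open>a \<noteq> c\<close>] M l(1) by simp
  qed
qed


text \<open>
  Here leaf pairs have even distance, so an odd length needs pairs \<open>x\<close>, \<open>y\<close> such that \<open>x\<close> forms a leaf pair with
  many neighbours of \<open>y\<close>. Fix the centre \<open>v\<close> of a cherry. Counting four-cycles through \<open>v\<close> gives many vertices
  \<open>y\<close> which have many common neighbours with \<open>v\<close>, and for each of them a positive proportion of the
  neighbours \<open>x\<close> of \<open>v\<close> will do.
\<close>

lemma cherries_odd:
  fixes \<eta> :: real and \<mu> M M' h :: nat
  assumes rob: "robust (path_type 2) 2 M P" and S: "S \<in> P" and k: "2 \<le> k" "odd (k - 2)"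
    and M: "M \<ge> s + t + s * t * k + k + 3"
    and dense: "\<eta> * real D ^ 2 \<le> card {S'\<in>P. drop_key (\<lambda>i. if i < 2 then 1 else 0) S' = drop_key (\<lambda>i. if i < 2 then 1 else 0) S}"
    and rep: "\<And>S. S \<in> P \<Longrightarrow> \<eta> * D \<le> card {x. replace_leaf 0 x S \<in> P}"
    and \<mu>: "\<mu> = s + t + s * t * k + 1" and M': "real M' + real h \<le> M * \<eta>" "2 * real \<mu> \<le> M' * \<eta>"
    and h: "8 * t \<le> h * \<eta>" and D: "8 * s * 2 ^ h \<le> D * \<eta>" "4 \<le> D * \<eta>" and pos: "s > 0" "t > 0" "D > 0"
  shows "has_subdivision s t k"
proof -
  define e where "e = (\<lambda>i :: nat. if i < 2 then 1 else 0 :: nat)"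
  define cherry where "cherry v u w = (v, \<lambda>i :: nat. if i = 0 then [u] else if i = 1 then [w] else [])" for v u w :: 'a
  define v where "v = fst S"
  have sub: "P \<subseteq> sp (path_type 2)" by (rule robust_sp[OF rob])
  have shape: "S' = cherry (fst S') (hd (snd S' 0)) (hd (snd S' 1))" if "S' \<in> P" for S'
  proof -
    have len: "length (snd S' i) = path_type 2 i" for i
      using spD(2)[of "fst S'" "snd S'" "path_type 2" i] subsetD[OF sub that] by simp
    have "snd S' i = snd (cherry (fst S') (hd (snd S' 0)) (hd (snd S' 1))) i" for i
      using len[of i] by (cases "snd S' i") (auto simp: cherry_def path_type_def split: if_splits)
    hence "snd S' = snd (cherry (fst S') (hd (snd S' 0)) (hd (snd S' 1)))" by (rule ext)
    moreover have "fst S' = fst (cherry (fst S') (hd (snd S' 0)) (hd (snd S' 1)))" by (simp add: cherry_def)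
    ultimately show ?thesis by (intro prod_eqI)
  qed
  have nbs: "u \<in> nb y" "w \<in> nb y" "(u, w) \<in> leaf_pairs P" if "cherry y u w \<in> P" for y u w
  proof -
    show "u \<in> nb y" using leg_step[OF subsetD[OF sub that], of 0] by (simp add: cherry_def)
    show "w \<in> nb y" using leg_step[OF subsetD[OF sub that], of 1] by (simp add: cherry_def)
    show "(u, w) \<in> leaf_pairs P" unfolding leaf_pairs_def by (rule image_eqI[OF _ that]) (simp add: cherry_def)
  qed
  define E where "E = {z. cherry v (fst z) (snd z) \<in> P}"
  have Esub: "E \<subseteq> nb v \<times> nb v" using nbs(1,2) by (auto simp: E_def)
  have finE: "finite E" by (rule finite_subset[OF Esub]) simp
  have cE: "card E \<le> D * D"
    using card_mono[OF _ Esub] card_nb[of v] by (simp add: card_cartesian_product) (meson mult_le_mono order.trans)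
  have dE: "\<eta> * real D ^ 2 \<le> card E"
  proof -
    have "{S'\<in>P. drop_key e S' = drop_key e S} \<subseteq> (\<lambda>z. cherry v (fst z) (snd z)) ` E"
    proof
      fix S' assume "S' \<in> {S'\<in>P. drop_key e S' = drop_key e S}"
      hence S': "S' \<in> P" "fst S' = v" by (auto simp: drop_key_def v_def)
      thus "S' \<in> (\<lambda>z. cherry v (fst z) (snd z)) ` E"
        using shape[OF S'(1)] by (intro image_eqI[of _ _ "(hd (snd S' 0), hd (snd S' 1))"]) (auto simp: E_def)
    qed
    hence "card {S'\<in>P. drop_key e S' = drop_key e S} \<le> card E"
      using finE by (meson card_image_le card_mono finite_imageI order.trans)
    thus ?thesis using dense by (simp add: e_def)
  qed
  \<comment> \<open>If there were at most \<open>M\<close> centres for a pair, robustness would give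
    a cherry over that pair avoiding all of them. So there are more than \<open>M\<close>, and at
    least \<open>M\<close> besides \<open>v\<close>.\<close>
  have NM: "M \<le> card {y\<in>V - {v}. cherry y (fst z) (snd z) \<in> P}" if z: "z \<in> E" for z
  proof -
    define N where "N = {y. cherry y (fst z) (snd z) \<in> P}"
    have "y \<in> V" if "y \<in> N" for y using nb_V nb_sym nbs(1)[of y "fst z" "snd z"] that by (force simp: N_def)
    hence NV: "N \<subseteq> V" by blast
    hence finN: "finite N" using finV finite_subset by blast
    have "M < card N"
    proof (rule ccontr)
      assume "\<not> M < card N"
      hence cN: "card N \<le> M" by simp
      have zP: "cherry v (fst z) (snd z) \<in> P" using z by (simp add: E_def)
      obtain S' where S': "S' \<in> P" "leaf_key S' = leaf_key (cherry v (fst z) (snd z))" "non_leaves S' \<inter> N = {}"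
        by (rule robust_avoid[OF rob zP finN cN])
      have "hd (snd S' 0) = fst z" "hd (snd S' 1) = snd z"
        using leaf_key_eq_hd[OF S'(2), of 0] leaf_key_eq_hd[OF S'(2), of 1] by (simp_all add: cherry_def)
      hence "fst S' \<in> N" using shape[OF S'(1)] S'(1) by (simp add: N_def)
      thus False using S'(3) by (auto simp: non_leaves_def)
    qed
    moreover have "N - {v} = {y\<in>V - {v}. cherry y (fst z) (snd z) \<in> P}" using NV by (auto simp: N_def)
    moreover have "card N \<le> Suc (card (N - {v}))" using card_Suc_Diff1[of N v] finN by (cases "v \<in> N") auto
    ultimately show ?thesis by simp
  qed
  define F where "F y = {z\<in>E. cherry y (fst z) (snd z) \<in> P}" for y
  \<comment> \<open>These are the heavy \<open>y\<close>. A light \<open>y\<close> shares at most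
    its codegree with \<open>v\<close> times \<open>M'\<close> pairs with \<open>v\<close>, and the
    codegrees add up to at most \<open>D * D\<close>. A heavy one shares at most
    \<open>D * D\<close> pairs, so the \<open>M * card E\<close> incidences require at least
    \<open>M * \<eta> - M'\<close> heavy vertices.\<close>
  define H where "H = {y\<in>V - {v}. M' \<le> card (snd ` F y)}"
  have finF: "finite (F y)" for y using finE by (simp add: F_def)
  have FD2: "card (F y) \<le> D * D" for y using card_mono[OF finE, of "F y"] cE by (auto simp: F_def)
  have light: "card (F y) \<le> card {u\<in>nb v. u \<in> nb y} * M'" if "\<not> M' \<le> card (snd ` F y)" for y
  proof -
    have "F y \<subseteq> {u\<in>nb v. u \<in> nb y} \<times> snd ` F y"
    proof
      fix z assume z: "z \<in> F y"
      hence "cherry v (fst z) (snd z) \<in> P" "cherry y (fst z) (snd z) \<in> P" by (auto simp: F_def E_def)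
      from nbs(1)[OF this(1)] nbs(1)[OF this(2)] show "z \<in> {u\<in>nb v. u \<in> nb y} \<times> snd ` F y"
        using z by (cases z) force
    qed
    hence "card (F y) \<le> card {u\<in>nb v. u \<in> nb y} * card (snd ` F y)"
      using card_mono[of "{u\<in>nb v. u \<in> nb y} \<times> snd ` F y" "F y"] finF by (simp add: card_cartesian_product)
    also have "\<dots> \<le> card {u\<in>nb v. u \<in> nb y} * M'" using that by (intro mult_le_mono2) simp
    finally show ?thesis .
  qed
  have codeg: "(\<Sum>y\<in>V - {v}. card {u\<in>nb v. u \<in> nb y}) \<le> D * D"
  proof -
    have "(\<Sum>y\<in>V - {v}. card {u\<in>nb v. u \<in> nb y}) = (\<Sum>u\<in>nb v. card {y\<in>V - {v}. u \<in> nb y})"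
      using sum.swap_restrict[of "V - {v}" "nb v" "\<lambda>_ _. 1 :: nat" "\<lambda>y u. u \<in> nb y"] finV by simp
    also have "\<dots> \<le> (\<Sum>u\<in>nb v. D)"
    proof (rule sum_mono)
      fix u
      have "card {y\<in>V - {v}. u \<in> nb y} \<le> card (nb u)" using nb_sym by (intro card_mono) auto
      thus "card {y\<in>V - {v}. u \<in> nb y} \<le> D" using card_nb[of u] by linarith
    qed
    also have "\<dots> \<le> D * D" using card_nb[of v] by simp
    finally show ?thesis .
  qed
  have "M * card E \<le> (\<Sum>z\<in>E. card {y\<in>V - {v}. cherry y (fst z) (snd z) \<in> P})"
    using sum_mono[of E "\<lambda>_. M", OF NM] by (simp add: mult.commute)
  also have "\<dots> = (\<Sum>y\<in>V - {v}. card (F y))"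
    using sum.swap_restrict[of E "V - {v}" "\<lambda>_ _. 1 :: nat" "\<lambda>z y. cherry y (fst z) (snd z) \<in> P"] finV finE
    by (simp add: F_def)
  also have "\<dots> \<le> (\<Sum>y\<in>V - {v}. card {u\<in>nb v. u \<in> nb y} * M' + (if y \<in> H then D * D else 0))"
  proof (rule sum_mono)
    fix y assume "y \<in> V - {v}"
    thus "card (F y) \<le> card {u\<in>nb v. u \<in> nb y} * M' + (if y \<in> H then D * D else 0)"
      using light[of y] FD2[of y] by (auto simp: H_def intro: trans_le_add2)
  qed
  also have "\<dots> = (\<Sum>y\<in>V - {v}. card {u\<in>nb v. u \<in> nb y}) * M' + (\<Sum>y\<in>V - {v}. if y \<in> H then D * D else 0)"
    by (simp add: sum.distrib sum_distrib_right)
  also have "(\<Sum>y\<in>V - {v}. if y \<in> H then D * D else 0) = card H * (D * D)"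
  proof -
    have "(V - {v}) \<inter> H = H" by (auto simp: H_def)
    thus ?thesis using finV by (simp add: sum.inter_restrict[symmetric])
  qed
  also have "(\<Sum>y\<in>V - {v}. card {u\<in>nb v. u \<in> nb y}) * M' + card H * (D * D) \<le> (D * D) * M' + card H * (D * D)"
    using codeg by simp
  finally have "M * card E \<le> (D * D) * M' + card H * (D * D)" .
  hence "real (M * card E) \<le> real ((D * D) * M' + card H * (D * D))" by (rule of_nat_mono)
  hence "real M * card E \<le> (M' + card H) * real D ^ 2" by (simp add: power2_eq_square algebra_simps)
  moreover have "real M * (\<eta> * real D ^ 2) \<le> real M * card E" using dE by (intro mult_left_mono) auto
  ultimately have "(M * \<eta>) * real D ^ 2 \<le> (M' + card H) * real D ^ 2" by (simp add: mult_ac)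
  hence "M * \<eta> \<le> M' + card H" using pos(3) by simp
  hence "h \<le> card H" using M'(1) by linarith
  then obtain T where T: "T \<subseteq> H" "card T = h" using obtain_subset_with_card_n by metis
  have finT: "finite T" using T(1) finV by (auto simp: H_def intro: finite_subset)
  define Q where "Q x y \<longleftrightarrow> x \<noteq> y \<and> \<mu> \<le> card {b\<in>nb y. (x, b) \<in> leaf_pairs P}" for x y
  have deg: "\<eta> / 4 * D \<le> card {x\<in>nb v. Q x y}" if y: "y \<in> T" for y
  proof -
    have "M' \<le> card (snd ` F y)" using y T(1) by (auto simp: H_def)
    then obtain I where I: "I \<subseteq> snd ` F y" "card I = M'" using obtain_subset_with_card_n by metis
    have finI: "finite I" using I(1) finF finite_subset by blast
    have Iw: "\<exists>u. cherry v u w \<in> P \<and> cherry y u w \<in> P" if "w \<in> I" for w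
      using subsetD[OF I(1) that] by (force simp: F_def E_def)
    have degI: "\<eta> * D \<le> card {x\<in>nb v. cherry v x w \<in> P}" if w: "w \<in> I" for w
    proof -
      obtain u where u: "cherry v u w \<in> P" using Iw[OF w] by blast
      have "replace_leaf 0 x (cherry v u w) = cherry v x w" for x
        by (auto simp: replace_leaf_def cherry_def)
      hence "{x. replace_leaf 0 x (cherry v u w) \<in> P} = {x\<in>nb v. cherry v x w \<in> P}" using nbs(1) by auto
      thus ?thesis using rep[OF u] by simp
    qed
    \<comment> \<open>Each \<open>w\<close> in \<open>I\<close> forms a cherry at \<open>v\<close>
      with at least \<open>\<eta> * D\<close> vertices \<open>x\<close>; by double counting at least
      half as many \<open>x\<close> do so with \<mu> of the \<open>w\<close>. All these
      \<open>w\<close> are neighbours of \<open>y\<close>.\<close>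
    define U where "U = {x\<in>nb v. \<mu> \<le> card {w\<in>I. cherry v x w \<in> P}}"
    have "card I * (\<eta> * D) \<le> real \<mu> * D + card I * real (card U)"
      unfolding U_def by (rule double_count[OF fin_nb finI degI card_nb])
    moreover have "real \<mu> * D \<le> M' * \<eta> / 2 * D" using M'(2) by (intro mult_right_mono) auto
    ultimately have "M' * (\<eta> * D / 2) \<le> M' * real (card U)" unfolding I(2) by (simp add: field_simps)
    moreover have "\<mu> > 0" by (simp add: \<mu>)
    hence "0 < real M' * \<eta>" using M'(2) by (intro less_le_trans[OF _ M'(2)]) simp
    hence "M' > 0" by (cases M') auto
    ultimately have "\<eta> * D / 2 \<le> real (card U)" by simp
    moreover have finU: "finite U" by (simp add: U_def)
    moreover have "card U \<le> Suc (card (U - {y}))" using card_Suc_Diff1[of U y] finU by (cases "y \<in> U") auto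
    hence "real (card U) \<le> 1 + real (card (U - {y}))" by linarith
    \<comment> \<open>The vertex \<open>y\<close> itself may lie in \<open>U\<close>; since
      \<open>4 \<le> D * \<eta>\<close>, dropping it lowers the proportion from
      \<open>\<eta> / 2\<close> to no less than \<open>\<eta> / 4\<close>.\<close>
    ultimately have "\<eta> / 4 * D \<le> real (card (U - {y}))" using D(2) by (simp add: mult.commute)
    moreover have "U - {y} \<subseteq> {x\<in>nb v. Q x y}"
    proof
      fix x assume x: "x \<in> U - {y}"
      have "{w\<in>I. cherry v x w \<in> P} \<subseteq> {b\<in>nb y. (x, b) \<in> leaf_pairs P}"
        using Iw nbs(2,3) by blast
      hence "card {w\<in>I. cherry v x w \<in> P} \<le> card {b\<in>nb y. (x, b) \<in> leaf_pairs P}" by (intro card_mono) auto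
      thus "x \<in> {x\<in>nb v. Q x y}" using x by (auto simp: U_def Q_def)
    qed
    hence "card (U - {y}) \<le> card {x\<in>nb v. Q x y}" by (intro card_mono) auto
    ultimately show ?thesis by linarith
  qed
  have "\<exists>A\<subseteq>nb v. \<exists>B\<subseteq>T. card A = s \<and> card B = t \<and> (\<forall>a\<in>A. \<forall>b\<in>B. Q a b)"
    by (rule complete_pair[OF fin_nb finT deg card_nb _ _ pos(1,2)]) (use h D(1) T(2) in auto)
  then obtain A B where AB: "card A = s" "card B = t" "\<forall>a\<in>A. \<forall>b\<in>B. Q a b" by blast
  show ?thesis
  proof (rule linked_imp_subdivision[OF AB(1,2) pos(1,2) _ order.refl])
    fix a b assume "a \<in> A" "b \<in> B"
    hence "Q a b" using AB(3) by blast
    hence "a \<noteq> b" "s + t + s * t * k < card {b'\<in>nb b. (a, b') \<in> leaf_pairs P}" using \<mu> by (auto simp: Q_def)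
    thus "linked k (s + t + s * t * k) a b"
      using linked_odd[OF rob order.refl k] M by simp
  qed
qed

end

text \<open>
  The parameters \<open>C\<close> and \<open>D0\<close> must not depend on the graph, hence the quantification over all bounded
  graphs outside the locale; the type argument fixes the type of their vertices.
\<close>

definition forces_with :: "'a itself \<Rightarrow> nat \<Rightarrow> nat \<Rightarrow> nat \<Rightarrow> nat \<Rightarrow> (nat \<Rightarrow> nat) \<Rightarrow> real \<Rightarrow> nat \<Rightarrow> nat \<Rightarrow> nat \<Rightarrow> bool" where
  "forces_with TT s t k r \<kappa> \<epsilon> q C D0 \<longleftrightarrow> (\<forall>(V :: 'a set) nb D P0.
     bounded_graph V nb D \<longrightarrow> V \<noteq> {} \<longrightarrow> D0 \<le> D \<longrightarrow> P0 \<subseteq> bounded_graph.sp V nb \<kappa> \<longrightarrow>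
     \<epsilon> * card V * real D ^ (\<Sum>i<r. \<kappa> i) \<le> card P0 \<longrightarrow>
     (\<forall>S\<in>P0. \<forall>w. card {S'\<in>P0. leaf_key S' = leaf_key S \<and> w \<in> non_leaves S'} \<le> q) \<longrightarrow>
     C * card (leaf_key ` P0) \<le> card P0 \<longrightarrow> bounded_graph.has_subdivision V nb s t k)"

text \<open>What a type of subtree contributes to the discarding: if the subdivision is absent,
  \<open>C\<close> becomes the bound on companions that most copies must satisfy. Both constants are
  chosen after the density and the bound \<open>q\<close> on companions through a vertex.\<close>

definition forces :: "'a itself \<Rightarrow> nat \<Rightarrow> nat \<Rightarrow> nat \<Rightarrow> nat \<Rightarrow> (nat \<Rightarrow> nat) \<Rightarrow> bool" where
  "forces TT s t k r \<kappa> \<longleftrightarrow> (\<forall>\<epsilon>>0. \<forall>q. \<exists>C D0. forces_with TT s t k r \<kappa> \<epsilon> q C D0)"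

lemma ex_large:
  fixes X \<eta> :: real
  assumes "\<eta> > 0"
  obtains D0 :: nat where "D0 > 0" "\<And>D. D \<ge> D0 \<Longrightarrow> X \<le> D * \<eta>"
proof
  show "nat \<lceil>X / \<eta>\<rceil> + 1 > 0" by simp
  fix D :: nat assume D: "D \<ge> nat \<lceil>X / \<eta>\<rceil> + 1"
  have "X / \<eta> \<le> real (nat \<lceil>X / \<eta>\<rceil>)" by linarith
  also have "\<dots> \<le> real D" using D by linarith
  finally show "X \<le> D * \<eta>" using assms by (simp add: field_simps)
qed

text \<open>
  With two legs of length 1 this argument fails: when \<open>k\<close> is even, both would have to be lengthened from the same
  vertex, the centre.
\<close>

lemma spiders_force:
  assumes \<kappa>: "\<And>i. i < s \<Longrightarrow> 0 < \<kappa> i \<and> \<kappa> i \<le> k" "\<And>i. i \<ge> s \<Longrightarrow> \<kappa> i = 0"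
    and one: "\<And>i j. i < s \<Longrightarrow> j < s \<Longrightarrow> \<kappa> i = 1 \<Longrightarrow> \<kappa> j = 1 \<Longrightarrow> i = j" and k: "k > 0"
  shows "forces TYPE('a) s t k s \<kappa>"
  unfolding forces_def
proof (intro allI impI)
  fix \<epsilon> :: real and q :: nat assume \<epsilon>: "\<epsilon> > 0"
  define m where "m = s + t * Suc (s * k) + s * k + s"
  \<comment> \<open>The loss in \<open>robust_exists\<close> is \<open>4 * (card E + r + 1)\<close>;
    here no cuts are prescribed and there are \<open>s\<close> legs.\<close>
  define \<eta> where "\<eta> = \<epsilon> / (4 * (real s + 1))"
  have \<eta>: "\<eta> > 0" "\<eta> * (4 * (real (card ({} :: (nat \<Rightarrow> nat) set)) + s + 1)) = \<epsilon>"
    using \<epsilon> by (auto simp: \<eta>_def field_simps)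
  obtain D0 :: nat where D0: "D0 > 0" "\<And>D :: nat. D \<ge> D0 \<Longrightarrow> real m + 1 \<le> D * \<eta>"
    by (rule ex_large[OF \<eta>(1), of "real m + 1"]) blast
  show "\<exists>C D0. forces_with TYPE('a) s t k s \<kappa> \<epsilon> q C D0"
  proof (rule exI[of _ "4 * Suc (m * q)"], rule exI[of _ D0], unfold forces_with_def, intro allI impI)
    fix V :: "'a set" and nb D P0
    assume "bounded_graph V nb D" and V: "V \<noteq> {}" and D: "D0 \<le> D" and P0: "P0 \<subseteq> bounded_graph.sp V nb \<kappa>"
      and dense: "\<epsilon> * card V * real D ^ (\<Sum>i<s. \<kappa> i) \<le> card P0"
      and via: "\<forall>S\<in>P0. \<forall>w. card {S'\<in>P0. leaf_key S' = leaf_key S \<and> w \<in> non_leaves S'} \<le> q"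
      and C: "4 * Suc (m * q) * card (leaf_key ` P0) \<le> card P0"
    interpret bounded_graph V nb D by fact
    have Dpos: "D > 0" using D D0(1) by simp
    have mD: "real m < \<eta> * D" using D0(2)[OF D] by (simp add: mult.commute)
    have "\<exists>P\<subseteq>P0. P \<noteq> {} \<and> robust \<kappa> s m P \<and>
     (\<forall>S\<in>P. \<forall>e\<in>{}. \<eta> * real D ^ (\<Sum>i<s. e i) \<le> real (card {S'\<in>P. drop_key e S' = drop_key e S})) \<and>
     (\<forall>S\<in>P. \<forall>i<s. \<eta> * D \<le> real (card {x. replace_leaf i x S \<in> P}))"
      by (rule robust_exists[where q = q, OF \<kappa>(2) _ P0 \<epsilon> V Dpos dense _ _ _ C \<eta>(2) mD]) (use \<kappa>(1) via in auto)
    then obtain P S where "robust \<kappa> s m P" "S \<in> P" by blast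
    from spiders_imp_subdivision[OF this \<kappa> one _ k] show "has_subdivision s t k" by (simp add: m_def)
  qed
qed

lemma paths_force:
  assumes l: "2 \<le> l" "l \<le> k" and pos: "s > 0" "t > 0"
  shows "forces TYPE('a) s t k 2 (path_type l)"
  unfolding forces_def
proof (intro allI impI)
  fix \<epsilon> :: real and q :: nat assume \<epsilon>: "\<epsilon> > 0"
  \<comment> \<open>The dense fibre must vary both ends of the path; in the odd case with
    \<open>l \<ge> 3\<close> it varies the neighbour of the second end as well.\<close>
  define e :: "nat \<Rightarrow> nat" where "e = (if even (k - l) \<or> l = 2 then (\<lambda>i. if i < 2 then 1 else 0) else
     (\<lambda>i. if i = 0 then 1 else if i = 1 then 2 else 0))"
  \<comment> \<open>One prescribed cut and two legs: 4 * (1 + 2 + 1) = 16.\<close>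
  define \<eta> where "\<eta> = \<epsilon> / 16"
  have \<eta>: "\<eta> > 0" "\<eta> * (4 * (real (card {e}) + real 2 + 1)) = \<epsilon>" using \<epsilon> by (auto simp: \<eta>_def)
  define \<mu> where "\<mu> = s + t + s * t * k + 1"
  \<comment> \<open>The constants are fixed in the order \<open>h\<close>, \<open>M'\<close>,
    \<open>m\<close>, \<open>D0\<close>; each may depend on the preceding ones but not on the graph.
    The budget \<open>m\<close> also plays the part of \<open>M\<close> in the case of cherries, so
    it must dominate \<open>M' + h\<close>.\<close>
  obtain h :: nat where h: "8 * real t \<le> real h * \<eta>" using ex_large[OF \<eta>(1), of "8 * real t"] by blast
  obtain M' :: nat where M': "2 * real \<mu> \<le> real M' * \<eta>" using ex_large[OF \<eta>(1), of "2 * real \<mu>"] by blast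
  obtain M0 :: nat where M0: "M0 > 0" "\<And>M :: nat. M \<ge> M0 \<Longrightarrow> real M' + real h \<le> real M * \<eta>"
    by (rule ex_large[OF \<eta>(1), of "real M' + real h"]) blast
  define m where "m = max M0 (s + t + s * t * k + k + 3)"
  have m: "real M' + real h \<le> real m * \<eta>" "s + t + s * t * k + k + 3 \<le> m" using M0(2)[of m] by (auto simp: m_def)
  obtain D0 :: nat where D0: "D0 > 0" "\<And>D :: nat. D \<ge> D0 \<Longrightarrow> real m + 8 * real s * 2 ^ h + 2 * real h + 4 \<le> real D * \<eta>"
    by (rule ex_large[OF \<eta>(1), of "real m + 8 * real s * 2 ^ h + 2 * real h + 4"]) blast
  have le_pt: "e' \<le> path_type l" if "e' \<in> {e}" for e'
    using l that by (auto simp: e_def path_type_def le_fun_def)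
  show "\<exists>C D0. forces_with TYPE('a) s t k 2 (path_type l) \<epsilon> q C D0"
  proof (rule exI[of _ "4 * Suc (m * q)"], rule exI[of _ D0], unfold forces_with_def, intro allI impI)
    fix V :: "'a set" and nb D P0
    assume "bounded_graph V nb D" and V: "V \<noteq> {}" and D: "D0 \<le> D" and P0: "P0 \<subseteq> bounded_graph.sp V nb (path_type l)"
      and dense: "\<epsilon> * card V * real D ^ (\<Sum>i<2. path_type l i) \<le> card P0"
      and via: "\<forall>S\<in>P0. \<forall>w. card {S'\<in>P0. leaf_key S' = leaf_key S \<and> w \<in> non_leaves S'} \<le> q"
      and C: "4 * Suc (m * q) * card (leaf_key ` P0) \<le> card P0"
    interpret bounded_graph V nb D by fact
    have Dpos: "D > 0" using D D0(1) by simp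
    define z where "z = real s * 2 ^ h"
    have z: "0 \<le> z" "8 * real s * 2 ^ h = 8 * z" "4 * real s * 2 ^ h = 4 * z" by (simp_all add: z_def)
    have le: "real m + 8 * z + 2 * real h + 4 \<le> D * \<eta>" using D0(2)[OF D] unfolding z(2) .
    have DD: "real m < \<eta> * D" "8 * real s * 2 ^ h \<le> D * \<eta>" "4 * real s * 2 ^ h \<le> D * \<eta>"
      "2 * real h \<le> D * \<eta>" "4 \<le> D * \<eta>"
      unfolding z(2,3) mult.commute[of \<eta>]
      using le z(1) of_nat_0_le_iff[of m, where 'a = real] of_nat_0_le_iff[of h, where 'a = real] by linarith+
    have h4: "4 * real t \<le> real h * \<eta>" using h by simp
    have "\<exists>P\<subseteq>P0. P \<noteq> {} \<and> robust (path_type l) 2 m P \<and>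
     (\<forall>S\<in>P. \<forall>e\<in>{e}. \<eta> * real D ^ (\<Sum>i<2. e i) \<le> real (card {S'\<in>P. drop_key e S' = drop_key e S})) \<and>
     (\<forall>S\<in>P. \<forall>i<2. \<eta> * D \<le> real (card {x. replace_leaf i x S \<in> P}))"
    proof (rule robust_exists[where q = q and E = "{e}", OF _ _ P0 \<epsilon> V Dpos dense _ le_pt _ C \<eta>(2) DD(1)])
      show "path_type l i = 0" if "2 \<le> i" for i using that by (simp add: path_type_def)
      show "0 < path_type l i" if "i < 2" for i using that l by (auto simp: path_type_def)
    qed (use via in auto)
    then obtain P S where P: "robust (path_type l) 2 m P" "S \<in> P"
      "\<And>S. S \<in> P \<Longrightarrow> \<eta> * real D ^ (\<Sum>i<2. e i) \<le> real (card {S'\<in>P. drop_key e S' = drop_key e S})"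
      "\<And>S i. S \<in> P \<Longrightarrow> i < 2 \<Longrightarrow> \<eta> * D \<le> real (card {x. replace_leaf i x S \<in> P})" by blast
    consider "even (k - l)" | "odd (k - l)" "l = 2" | "odd (k - l)" "3 \<le> l" using l by linarith
    thus "has_subdivision s t k"
    proof cases
      case 1
      hence e: "e = (\<lambda>i. if i < 2 then 1 else 0)" by (simp add: e_def)
      have "(\<Sum>i<2. e i) = 2" by (simp add: e)
      hence "\<eta> * real D ^ 2 \<le> real (card {S'\<in>P. drop_key (\<lambda>i. if i < 2 then 1 else 0) S' = drop_key (\<lambda>i. if i < 2 then 1 else 0) S})"
        using P(3)[OF P(2)] by (simp add: e)
      from paths_even[OF P(1,2) l 1 _ this h4 DD(3,4) pos Dpos] show ?thesis using m(2) by simp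
    next
      case 2
      hence e: "e = (\<lambda>i. if i < 2 then 1 else 0)" by (simp add: e_def)
      have "(\<Sum>i<2. e i) = 2" by (simp add: e)
      hence d: "\<eta> * real D ^ 2 \<le> real (card {S'\<in>P. drop_key (\<lambda>i. if i < 2 then 1 else 0) S' = drop_key (\<lambda>i. if i < 2 then 1 else 0) S})"
        using P(3)[OF P(2)] by (simp add: e)
      have r: "\<eta> * real D \<le> real (card {x. replace_leaf 0 x S \<in> P})" if "S \<in> P" for S using P(4)[OF that] by simp
      show ?thesis
        using cherries_odd[OF P(1)[unfolded 2(2)] P(2) l(2)[unfolded 2(2)] 2(1)[unfolded 2(2)] m(2) d r \<mu>_def m(1) M' h DD(2,5) pos Dpos] .
    next
      case 3
      hence e: "e = (\<lambda>i. if i = 0 then 1 else if i = 1 then 2 else 0)" by (simp add: e_def)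
      have "(\<Sum>i<2. e i) = 3" by (simp add: e numeral_2_eq_2)
      hence d: "\<eta> * real D ^ 3 \<le> real (card {S'\<in>P. drop_key (\<lambda>i. if i = 0 then 1 else if i = 1 then 2 else 0) S' =
         drop_key (\<lambda>i. if i = 0 then 1 else if i = 1 then 2 else 0) S})"
        using P(3)[OF P(2)] by (simp add: e)
      have r: "s + t + s * t * k < card {x. replace_leaf 1 x S \<in> P}" if "S \<in> P" for S
      proof -
        have "real m < real (card {x. replace_leaf 1 x S \<in> P})" using P(4)[OF that, of 1] DD(1) by simp
        hence "m < card {x. replace_leaf 1 x S \<in> P}" by simp
        thus ?thesis using m(2) by linarith
      qed
      from paths_odd[OF P(1,2) 3(2) l(2) 3(1) m(2) d r h4 DD(3,4) pos Dpos] show ?thesis .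
    qed
  qed
qed

section \<open>Copies of the large spider\<close>

lemma card_image_le_determined:
  assumes "finite T" and "\<And>S S'. S \<in> T \<Longrightarrow> S' \<in> T \<Longrightarrow> g S = g S' \<Longrightarrow> f S = f S'"
  shows "card (f ` T) \<le> card (g ` T)"
proof (rule surj_card_le)
  show "f ` T \<subseteq> (\<lambda>y. f (SOME S. S \<in> T \<and> g S = y)) ` g ` T"
  proof
    fix z assume "z \<in> f ` T"
    then obtain S where S: "S \<in> T" "z = f S" by blast
    have "(SOME S'. S' \<in> T \<and> g S' = g S) \<in> T \<and> g (SOME S'. S' \<in> T \<and> g S' = g S) = g S"
      by (rule someI[of "\<lambda>S'. S' \<in> T \<and> g S' = g S" S]) (use S in simp)
    from assms(2)[OF conjunct1[OF this] S(1) conjunct2[OF this]]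
    have "f (SOME S'. S' \<in> T \<and> g S' = g S) = z" unfolding S(2) .
    thus "z \<in> (\<lambda>y. f (SOME S. S \<in> T \<and> g S = y)) ` g ` T"
      using S(1) by (intro image_eqI[of _ _ "g S"] imageI) simp_all
  qed
qed (use assms in simp)

lemma card_image_le_fibres:
  assumes "finite T" and "\<And>S0. S0 \<in> T \<Longrightarrow> card (f ` {S\<in>T. g S = g S0}) \<le> q"
  shows "card (f ` T) \<le> card (g ` T) * q"
proof -
  have "f ` T = (\<Union>y\<in>g ` T. f ` {S\<in>T. g S = y})" by auto
  hence "card (f ` T) \<le> (\<Sum>y\<in>g ` T. card (f ` {S\<in>T. g S = y}))"
    using card_UN_le[of "g ` T" "\<lambda>y. f ` {S\<in>T. g S = y}"] assms(1) by simp
  also have "\<dots> \<le> (\<Sum>y\<in>g ` T. q)" by (rule sum_mono) (use assms(2) in auto)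
  finally show ?thesis by simp
qed

lemma card_restrict_Un:
  assumes "finite T" "J \<subseteq> J1 \<union> J2"
  shows "card ((\<lambda>S. restrict S J) ` T) \<le> card ((\<lambda>S. restrict S J1) ` T) * card ((\<lambda>S. restrict S J2) ` T)"
proof -
  have "card ((\<lambda>S. restrict S J) ` T) \<le> card ((\<lambda>S. (restrict S J1, restrict S J2)) ` T)"
  proof (rule card_image_le_determined[OF assms(1)])
    fix S S' assume e: "(restrict S J1, restrict S J2) = (restrict S' J1, restrict S' J2)"
    have "S x = S' x" if "x \<in> J" for x
    proof (cases "x \<in> J1")
      case True
      have "restrict S J1 x = restrict S' J1 x" using e by simp
      thus ?thesis using True by simp
    next
      case False
      hence "x \<in> J2" using that assms(2) by blast
      moreover have "restrict S J2 x = restrict S' J2 x" using e by simp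
      ultimately show ?thesis by simp
    qed
    thus "restrict S J = restrict S' J" by (auto simp: restrict_def)
  qed
  also have "\<dots> \<le> card ((\<lambda>S. restrict S J1) ` T \<times> (\<lambda>S. restrict S J2) ` T)"
    using assms(1) by (intro card_mono) auto
  finally show ?thesis by (simp add: card_cartesian_product)
qed

lemma card_restrict_UN:
  assumes "finite T" "finite X" "\<And>i. i \<in> X \<Longrightarrow> card ((\<lambda>S. restrict S (J i)) ` T) \<le> F"
  shows "card ((\<lambda>S. restrict S (\<Union>i\<in>X. J i)) ` T) \<le> F ^ card X"
  using assms(2,3)
proof (induction X rule: finite_induct)
  case empty
  have "(\<lambda>S. restrict S (\<Union>i\<in>{}. J i)) ` T \<subseteq> {\<lambda>_. undefined}" by (auto simp: restrict_def)
  from card_mono[OF _ this]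
  have "card ((\<lambda>S. restrict S (\<Union>i\<in>{}. J i)) ` T) \<le> card {\<lambda>_ :: 'a. undefined :: 'b}"
    by blast
  thus ?case unfolding card.empty power_0 by (rule order.trans) simp
next
  case (insert x X)
  have "card ((\<lambda>S. restrict S (\<Union>i\<in>insert x X. J i)) ` T) \<le>
      card ((\<lambda>S. restrict S (J x)) ` T) * card ((\<lambda>S. restrict S (\<Union>i\<in>X. J i)) ` T)"
    by (rule card_restrict_Un[OF assms(1)]) auto
  also have "\<dots> \<le> F * F ^ card X"
  proof (rule mult_le_mono)
    show "card ((\<lambda>S. restrict S (J x)) ` T) \<le> F" by (rule insert.prems) simp
    show "card ((\<lambda>S. restrict S (\<Union>i\<in>X. J i)) ` T) \<le> F ^ card X"
      by (rule insert.IH) (rule insert.prems, simp)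
  qed
  finally show ?case unfolding card_insert_disjoint[OF insert.hyps] power_Suc .
qed

text \<open>
  A pair \<open>(J, B)\<close> stands for a subtree with vertex set \<open>J\<close> and set of leaves \<open>B\<close>; the maps in \<open>\<S>\<close> are the copies of
  the large spider.
\<close>

definition inv_bounded :: "('i \<Rightarrow> 'a) set \<Rightarrow> nat \<Rightarrow> 'i set \<times> 'i set \<Rightarrow> bool" where
  "inv_bounded \<S> F \<tau> \<longleftrightarrow> (\<forall>S0\<in>\<S>. card ((\<lambda>S. restrict S (fst \<tau>)) ` {S\<in>\<S>. \<forall>b\<in>snd \<tau>. S b = S0 b}) \<le> F)"

lemma inv_boundedD:
  assumes "inv_bounded \<S> F (J, B)" "finite \<S>" "S0 \<in> \<S>" "T \<subseteq> \<S>" "\<And>S b. S \<in> T \<Longrightarrow> b \<in> B \<Longrightarrow> S b = S0 b"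
  shows "card ((\<lambda>S. restrict S J) ` T) \<le> F"
proof -
  have "card ((\<lambda>S. restrict S J) ` T) \<le> card ((\<lambda>S. restrict S J) ` {S\<in>\<S>. \<forall>b\<in>B. S b = S0 b})"
    using assms(2,4,5) by (intro card_mono) auto
  also have "\<dots> \<le> F" using assms(1,3) by (auto simp: inv_bounded_def)
  finally show ?thesis .
qed

lemma inv_bounded_mono:
  assumes "inv_bounded \<S> F \<tau>" "finite \<S>" "\<S>' \<subseteq> \<S>" "F \<le> F'"
  shows "inv_bounded \<S>' F' \<tau>"
  unfolding inv_bounded_def
proof
  fix S0 assume "S0 \<in> \<S>'"
  hence "card ((\<lambda>S. restrict S (fst \<tau>)) ` {S\<in>\<S>'. \<forall>b\<in>snd \<tau>. S b = S0 b}) \<le> F"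
    by (intro inv_boundedD[of \<S> F _ "snd \<tau>" S0]) (use assms in auto)
  thus "card ((\<lambda>S. restrict S (fst \<tau>)) ` {S\<in>\<S>'. \<forall>b\<in>snd \<tau>. S b = S0 b}) \<le> F'" using assms(4) by simp
qed

text \<open>Vertex \<open>j\<close> of leg \<open>i\<close>; the vertices number \<open>0\<close> of all legs are the centre \<open>(0, 0)\<close>.\<close>

definition leg_pos :: "nat \<Rightarrow> nat \<Rightarrow> nat \<times> nat" where
  "leg_pos i j = (if j = 0 then (0, 0) else (i, j))"

definition parent :: "nat \<times> nat \<Rightarrow> nat \<times> nat" where
  "parent x = leg_pos (fst x) (snd x - 1)"

definition tree :: "nat \<Rightarrow> nat \<Rightarrow> (nat \<times> nat) set" where
  "tree s k = insert (0, 0) ({..<s} \<times> {1..k})"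

definition tree_nb :: "nat \<Rightarrow> nat \<Rightarrow> nat \<times> nat \<Rightarrow> (nat \<times> nat) set" where
  "tree_nb s k x = {y. x \<in> tree s k \<and> y \<in> tree s k \<and> (0 < snd y \<and> x = parent y \<or> 0 < snd x \<and> y = parent x)}"

lemma snd_leg_pos [simp]: "snd (leg_pos i j) = j"
  by (simp add: leg_pos_def)

lemma leg_pos_0 [simp]: "leg_pos i 0 = (0, 0)"
  by (simp add: leg_pos_def)

lemma finite_tree [simp]: "finite (tree s k)"
  by (simp add: tree_def)

lemma card_tree: "card (tree s k) = Suc (s * k)"
  by (simp add: tree_def)

lemma leg_pos_tree: "i < s \<Longrightarrow> j \<le> k \<Longrightarrow> leg_pos i j \<in> tree s k"
  by (auto simp: leg_pos_def tree_def)

lemma parent_tree: "x \<in> tree s k \<Longrightarrow> 0 < snd x \<Longrightarrow> parent x \<in> tree s k"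
  by (auto simp: parent_def leg_pos_def tree_def)

lemma snd_parent: "snd (parent x) = snd x - 1"
  by (simp add: parent_def)

text \<open>Subtrees of the large spider become spiders of the index tree, so \<open>tree.sp\<close>
  describes them and their images are spiders of the graph. The number of vertices serves as degree
  bound.\<close>

interpretation tree: bounded_graph "tree s k" "tree_nb s k" "Suc (s * k)" for s k
proof
  show "finite (tree s k)" by simp
  show "tree_nb s k x \<subseteq> tree s k" for x by (auto simp: tree_nb_def)
  show "y \<in> tree_nb s k x \<Longrightarrow> x \<in> tree_nb s k y" for x y by (auto simp: tree_nb_def)
  show "x \<notin> tree_nb s k x" for x
  proof
    assume "x \<in> tree_nb s k x"
    hence "0 < snd x" and e: "parent x = x" by (auto simp: tree_nb_def)
    thus False using snd_parent[of x] unfolding e by simp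
  qed
  show "card (tree_nb s k x) \<le> Suc (s * k)" for x
    unfolding card_tree[symmetric] by (intro card_mono) (auto simp: tree_nb_def)
qed

text \<open>If the centre lies in \<open>J\<close>, a position of least depth outside
  \<open>J\<close> has its parent in \<open>J\<close>; otherwise a position of least depth in
  \<open>J\<close> has its parent outside.\<close>

lemma tree_boundary:
  assumes "J \<subseteq> tree s k" "J \<noteq> {}" "J \<noteq> tree s k"
  shows "\<exists>x\<in>tree s k - J. \<exists>y\<in>J. x \<in> tree_nb s k y"
proof -
  have min: "\<exists>x\<in>X. \<forall>y\<in>X. snd x \<le> snd y" if "X \<noteq> {}" for X :: "(nat \<times> nat) set"
    using that ex_has_least_nat[of "\<lambda>x. x \<in> X" _ snd] by blast
  have snd0: "x = (0, 0)" if "x \<in> tree s k" "snd x = 0" for x using that by (auto simp: tree_def)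
  show ?thesis
  proof (cases "(0, 0) \<in> J")
    case True
    have "tree s k - J \<noteq> {}" using assms(1,3) by blast
    then obtain x where x: "x \<in> tree s k - J" "\<forall>y\<in>tree s k - J. snd x \<le> snd y"
      using min[of "tree s k - J"] by auto
    have "snd x > 0" using snd0[of x] x(1) True by (cases "snd x") auto
    moreover from this have "parent x \<in> tree s k" using parent_tree x(1) by blast
    moreover have "parent x \<in> J"
    proof (rule ccontr)
      assume "parent x \<notin> J"
      hence "snd x \<le> snd (parent x)" using x(2) \<open>parent x \<in> tree s k\<close> by blast
      thus False using snd_parent[of x] \<open>snd x > 0\<close> by simp
    qed
    ultimately show ?thesis using x(1) by (intro bexI[of _ x] bexI[of _ "parent x"]) (auto simp: tree_nb_def)
  next
    case False
    obtain y where y: "y \<in> J" "\<forall>z\<in>J. snd y \<le> snd z" using min[OF assms(2)] by blast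
    have yt: "y \<in> tree s k" using y(1) assms(1) by blast
    have "snd y > 0" using snd0[OF yt] y(1) False by (cases "snd y") auto
    moreover from this have "parent y \<in> tree s k" using parent_tree yt by blast
    moreover have "parent y \<notin> J"
    proof
      assume "parent y \<in> J"
      hence "snd y \<le> snd (parent y)" using y(2) by blast
      thus False using snd_parent[of y] \<open>snd y > 0\<close> by simp
    qed
    ultimately show ?thesis using y(1) yt by (intro bexI[of _ "parent y"] bexI[of _ y]) (auto simp: tree_nb_def)
  qed
qed

section \<open>Images of subtrees as spiders\<close>

definition spider_map :: "('i \<Rightarrow> 'a) \<Rightarrow> 'i spider \<Rightarrow> 'a spider" where
  "spider_map S \<sigma> = (S (fst \<sigma>), \<lambda>i. map S (snd \<sigma> i))"

definition spider_verts :: "'i spider \<Rightarrow> 'i set" where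
  "spider_verts \<sigma> = insert (fst \<sigma>) (\<Union>i. set (snd \<sigma> i))"

definition spider_leaves :: "'i spider \<Rightarrow> 'i set" where
  "spider_leaves \<sigma> = (\<Union>i. set (take 1 (snd \<sigma> i)))"

text \<open>A dictionary between the two views of a copied subtree: a spider of the graph on one
  side, a restriction of the whole copy on the other. The next lemmas do the same for leaves and
  non-leaves.\<close>

lemma spider_map_eq_iff: "spider_map S \<sigma> = spider_map S' \<sigma> \<longleftrightarrow> restrict S (spider_verts \<sigma>) = restrict S' (spider_verts \<sigma>)"
proof -
  have "restrict S X = restrict S' X \<longleftrightarrow> (\<forall>x\<in>X. S x = S' x)" for X
    by (metis restrict_apply' restrict_ext)
  thus ?thesis by (auto simp: spider_map_def spider_verts_def fun_eq_iff)
qed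

lemma leaf_key_spider_map: "leaf_key (spider_map S \<sigma>) = leaf_key (spider_map S' \<sigma>) \<longleftrightarrow> (\<forall>b\<in>spider_leaves \<sigma>. S b = S' b)"
proof -
  have tk: "take 1 (map S l) = take 1 (map S' l) \<longleftrightarrow> (\<forall>b\<in>set (take 1 l). S b = S' b)" for l
    by (cases l) auto
  have hd: "hd (map S l) = hd (map S' l)" if "take 1 (map S l) = take 1 (map S' l)" for l
    using that by (cases l) auto
  show ?thesis unfolding leaf_key_def spider_map_def spider_leaves_def
    using tk hd by (auto simp: fun_eq_iff)
qed

lemma non_leaves_spider_map: "non_leaves (spider_map S \<sigma>) = S ` non_leaves \<sigma>"
  by (auto simp: non_leaves_def spider_map_def map_tl[symmetric])

lemma spider_verts_split: "spider_verts \<sigma> = non_leaves \<sigma> \<union> spider_leaves \<sigma>"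
proof -
  have "x \<in> set l \<longleftrightarrow> x \<in> set (tl l) \<or> x \<in> set (take 1 l)" for l and x :: 'a by (cases l) auto
  thus ?thesis unfolding spider_verts_def non_leaves_def spider_leaves_def by blast
qed

section \<open>Counting copies of the index tree\<close>

context bounded_graph begin

text \<open>Injectivity makes these embeddings; extensionality fixes the values outside
  \<open>J\<close>, so that the maps can be counted.\<close>

definition homs :: "(nat \<times> nat) set \<Rightarrow> (nat \<times> nat \<Rightarrow> 'a) set" where
  "homs J = {S \<in> J \<rightarrow>\<^sub>E V. inj_on S J \<and> (\<forall>x\<in>J. 0 < snd x \<longrightarrow> S x \<in> nb (S (parent x)))}"

lemma finite_homs: "finite J \<Longrightarrow> finite (homs J)"
  unfolding homs_def using finV by (auto intro: finite_subset[OF _ finite_PiE[of J "\<lambda>_. V"]])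

lemma homs_nb:
  assumes "S \<in> homs (tree s k)" "y \<in> tree_nb s k x"
  shows "S y \<in> nb (S x)"
  using assms nb_sym unfolding homs_def tree_nb_def by auto

text \<open>By \<open>tree_boundary\<close> some free position is adjacent to a fixed one and has at
  most \<open>D\<close> possible images; fixing it leaves a smaller instance.\<close>

lemma card_homs_extending:
  assumes "J \<subseteq> tree s k" "J \<noteq> {}"
  shows "card {S \<in> homs (tree s k). \<forall>x\<in>J. S x = S0 x} \<le> D ^ card (tree s k - J)"
  using assms
proof (induction "card (tree s k - J)" arbitrary: J S0)
  case 0
  hence J: "J = tree s k" by (auto simp: card_eq_0_iff)
  have "S = S'" if "S \<in> {S \<in> homs (tree s k). \<forall>x\<in>J. S x = S0 x}" "S' \<in> {S \<in> homs (tree s k). \<forall>x\<in>J. S x = S0 x}" for S S'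
    by (rule PiE_ext[of S "tree s k" "\<lambda>_. V"]) (use that J in \<open>auto simp: homs_def\<close>)
  moreover have "finite {S \<in> homs (tree s k). \<forall>x\<in>J. S x = S0 x}" using finite_homs[of "tree s k"] by simp
  ultimately have "card {S \<in> homs (tree s k). \<forall>x\<in>J. S x = S0 x} \<le> Suc 0"
    by (subst card_le_Suc0_iff_eq) blast+
  thus ?case unfolding 0(1)[symmetric] power_0 by simp
next
  case (Suc m)
  have "J \<noteq> tree s k" using Suc.hyps(2) by auto
  then obtain x y where xy: "x \<in> tree s k - J" "y \<in> J" "x \<in> tree_nb s k y"
    using tree_boundary[OF Suc.prems] by blast
  have "tree s k - insert x J = (tree s k - J) - {x}" by auto
  hence m: "m = card (tree s k - insert x J)" using Suc.hyps(2) xy(1) by simp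
  have IH: "card {S \<in> homs (tree s k). \<forall>z\<in>insert x J. S z = (S0(x := u)) z} \<le> D ^ m" for u
    unfolding m by (rule Suc.hyps(1)[OF m]) (use Suc.prems xy in auto)
  have "{S \<in> homs (tree s k). \<forall>z\<in>J. S z = S0 z} \<subseteq>
     (\<Union>u\<in>nb (S0 y). {S \<in> homs (tree s k). \<forall>z\<in>insert x J. S z = (S0(x := u)) z})"
  proof
    fix S assume S: "S \<in> {S \<in> homs (tree s k). \<forall>z\<in>J. S z = S0 z}"
    hence "S x \<in> nb (S0 y)" using homs_nb[of S s k x y] xy by auto
    thus "S \<in> (\<Union>u\<in>nb (S0 y). {S \<in> homs (tree s k). \<forall>z\<in>insert x J. S z = (S0(x := u)) z})"
      using S by (intro UN_I[of "S x"]) auto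
  qed
  hence "card {S \<in> homs (tree s k). \<forall>z\<in>J. S z = S0 z} \<le>
     card (\<Union>u\<in>nb (S0 y). {S \<in> homs (tree s k). \<forall>z\<in>insert x J. S z = (S0(x := u)) z})"
    by (rule card_mono[rotated]) (use finite_homs[of "tree s k"] in auto)
  also have "\<dots> \<le> (\<Sum>u\<in>nb (S0 y). card {S \<in> homs (tree s k). \<forall>z\<in>insert x J. S z = (S0(x := u)) z})"
    by (rule card_UN_le) simp
  also have "\<dots> \<le> (\<Sum>u\<in>nb (S0 y). D ^ m)" by (rule sum_mono) (rule IH)
  also have "\<dots> \<le> D * D ^ m" using card_nb[of "S0 y"] by simp
  finally show ?case using Suc.hyps(2)[symmetric] by simp
qed

text \<open>Greedy embedding: the image of the parent has at least \<delta> neighbours, at most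
  \<open>N\<close> of which are already used. The induction removes a position of greatest depth,
  which is the parent of no other.\<close>

lemma card_homs_ge:
  assumes deg: "\<And>v. v \<in> V \<Longrightarrow> \<delta> \<le> card (nb v)" and J: "finite J" "(0, 0) \<in> J" "card J \<le> Suc N"
    and cl: "\<And>x. x \<in> J \<Longrightarrow> snd x = 0 \<Longrightarrow> x = (0, 0)" "\<And>x. x \<in> J \<Longrightarrow> 0 < snd x \<Longrightarrow> parent x \<in> J"
  shows "card V * (\<delta> - N) ^ (card J - 1) \<le> card (homs J)"
  using J cl
proof (induction "card J" arbitrary: J)
  case 0
  thus ?case by auto
next
  case (Suc m)
  show ?case
  proof (cases "J = {(0, 0)}")
    case True
    have "inj_on (\<lambda>v. \<lambda>x\<in>J. v) V" unfolding True by (auto simp: inj_on_def dest: fun_cong[of _ _ "(0, 0)"])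
    hence "card V = card ((\<lambda>v. \<lambda>x\<in>J. v) ` V)" by (simp add: card_image)
    also have "\<dots> \<le> card (homs J)"
    proof (rule card_mono[OF finite_homs[OF Suc.prems(1)]], rule image_subsetI)
      fix v assume "v \<in> V"
      hence "(\<lambda>x\<in>J. v) \<in> J \<rightarrow>\<^sub>E V" by (intro restrict_PiE_iff[THEN iffD2]) simp
      moreover have "inj_on (\<lambda>x\<in>J. v) J" by (simp add: True)
      ultimately show "(\<lambda>x\<in>J. v) \<in> homs J" by (simp add: homs_def True)
    qed
    finally show ?thesis by (simp add: True)
  next
    case False
    have "\<exists>x\<in>J. \<forall>y\<in>J. snd y \<le> snd x"
    proof -
      have "Max (snd ` J) \<in> snd ` J" using Suc.prems(1,2) by (intro Max_in) auto
      then obtain x where "x \<in> J" "snd x = Max (snd ` J)" by auto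
      moreover have "snd y \<le> Max (snd ` J)" if "y \<in> J" for y using Suc.prems(1) that by simp
      ultimately show ?thesis by metis
    qed
    then obtain x where x: "x \<in> J" "\<forall>y\<in>J. snd y \<le> snd x" by blast
    have sx: "snd x > 0"
    proof (rule ccontr)
      assume "\<not> 0 < snd x"
      hence "snd y = 0" if "y \<in> J" for y using x(2) that by auto
      hence "J = {(0, 0)}" using Suc.prems(2,4) by blast
      thus False using False by simp
    qed
    define J' where "J' = J - {x}"
    have x0: "x \<noteq> (0, 0)" using sx by auto
    have J': "finite J'" "(0, 0) \<in> J'" "m = card J'" "card J' \<le> Suc N"
      using Suc.prems(1-3) Suc.hyps(2) x(1) x0 by (auto simp: J'_def)
    have px: "parent x \<in> J'" using Suc.prems(5)[OF x(1) sx] sx snd_parent[of x] by (auto simp: J'_def)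
    have cl': "parent y \<in> J'" if "y \<in> J'" "0 < snd y" for y
    proof -
      have "parent y \<in> J" using Suc.prems(5) that by (auto simp: J'_def)
      moreover have "parent y \<noteq> x"
      proof
        assume "parent y = x"
        hence "snd x < snd y" using snd_parent[of y] that(2) by simp
        thus False using x(2) that(1) by (auto simp: J'_def dest!: bspec[of J _ y])
      qed
      ultimately show ?thesis by (simp add: J'_def)
    qed
    have "card V * (\<delta> - N) ^ (card J' - 1) \<le> card (homs J')"
      using Suc.hyps(1)[OF J'(3) J'(1,2,4) _ cl'] Suc.prems(4) by (simp add: J'_def)
    define ext where "ext S = nb (S (parent x)) - S ` J'" for S
    have cext: "\<delta> - N \<le> card (ext S)" if "S \<in> homs J'" for S
    proof -
      have "S (parent x) \<in> V" using that px by (auto simp: homs_def)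
      hence "\<delta> \<le> card (nb (S (parent x)))" by (rule deg)
      moreover have "card (S ` J') \<le> N" using card_image_le[OF J'(1), of S] J'(3) Suc.hyps(2) Suc.prems(3) by linarith
      moreover have "card (nb (S (parent x))) - card (S ` J') \<le> card (ext S)"
        unfolding ext_def using J'(1) by (intro diff_card_le_card_Diff) simp
      ultimately show ?thesis by linarith
    qed
    define f where "f p = (fst p)(x := snd p)" for p :: "(nat \<times> nat \<Rightarrow> 'a) \<times> 'a"
    have xJ': "x \<notin> J'" "J = insert x J'" using x(1) by (auto simp: J'_def)
    have "inj_on f (Sigma (homs J') ext)"
    proof
      fix p q assume p: "p \<in> Sigma (homs J') ext" and q: "q \<in> Sigma (homs J') ext" and e: "f p = f q"
      have "fst p y = fst q y" for y
      proof (cases "y = x")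
        case True
        have "fst p x = undefined" "fst q x = undefined" using p q xJ'(1) by (auto simp: homs_def)
        thus ?thesis using True by simp
      next
        case False
        thus ?thesis using fun_cong[OF e, of y] by (simp add: f_def)
      qed
      moreover have "snd p = snd q" using fun_cong[OF e, of x] by (simp add: f_def)
      ultimately show "p = q" by (auto simp: prod_eq_iff)
    qed
    moreover have "f ` Sigma (homs J') ext \<subseteq> homs J"
    proof
      fix h assume "h \<in> f ` Sigma (homs J') ext"
      then obtain S u where S: "S \<in> homs J'" "u \<in> nb (S (parent x))" "u \<notin> S ` J'" "h = S(x := u)"
        by (auto simp: f_def ext_def)
      have hJ: "h y = S y" if "y \<in> J'" for y using that xJ' S(4) by auto
      have "h \<in> J \<rightarrow>\<^sub>E V" unfolding xJ'(2) S(4) using S(1,2) nb_V by (intro PiE_fun_upd) (auto simp: homs_def)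
      moreover have "inj_on h J"
      proof -
        have "inj_on h J'" using S(1) hJ by (auto simp: homs_def inj_on_def)
        moreover have "h ` J' = S ` J'" using hJ by (auto simp: image_iff)
        ultimately show ?thesis unfolding xJ'(2) using S(3,4) xJ'(1) by (simp add: insert_Diff_if)
      qed
      moreover have "h y \<in> nb (h (parent y))" if "y \<in> J" "0 < snd y" for y
      proof (cases "y = x")
        case True
        thus ?thesis using S(2,4) hJ[OF px] by simp
      next
        case False
        hence "y \<in> J'" using that by (simp add: J'_def)
        thus ?thesis using S(1) hJ[of y] hJ[OF cl'[of y]] that(2) by (auto simp: homs_def)
      qed
      ultimately show "h \<in> homs J" by (auto simp: homs_def)
    qed
    ultimately have "card (Sigma (homs J') ext) \<le> card (homs J)"
      using card_inj_on_le finite_homs[OF Suc.prems(1)] by blast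
    moreover have "card (homs J') * (\<delta> - N) \<le> card (Sigma (homs J') ext)"
    proof -
      have "(\<Sum>S\<in>homs J'. \<delta> - N) \<le> (\<Sum>S\<in>homs J'. card (ext S))" by (rule sum_mono) (rule cext)
      moreover have "card (Sigma (homs J') ext) = (\<Sum>S\<in>homs J'. card (ext S))"
        using finite_homs[OF J'(1)] by (intro card_SigmaI) (auto simp: ext_def)
      ultimately show ?thesis by simp
    qed
    moreover have "card V * (\<delta> - N) ^ (card J - 1) \<le> card (homs J') * (\<delta> - N)"
    proof -
      have "card J' > 0" using J'(1,2) by (auto simp: card_gt_0_iff)
      hence "card J - 1 = Suc (card J' - 1)" using J'(3) Suc.hyps(2) by simp
      thus ?thesis using mult_le_mono1[OF \<open>card V * (\<delta> - N) ^ (card J' - 1) \<le> card (homs J')\<close>, of "\<delta> - N"]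
        by (simp add: mult_ac)
    qed
    ultimately show ?thesis by linarith
  qed
qed

lemma spider_map_sp:
  assumes S: "S \<in> homs (tree s k)" and \<sigma>: "\<sigma> \<in> tree.sp s k \<kappa>"
  shows "spider_map S \<sigma> \<in> sp \<kappa>"
proof -
  obtain c L where cL: "\<sigma> = (c, L)" by (cases \<sigma>)
  note T = tree.spD[OF \<sigma>[unfolded cL]]
  have inj: "inj_on S (tree s k)" using S by (auto simp: homs_def)
  have SV: "S x \<in> V" if "x \<in> tree s k" for x using S that by (auto simp: homs_def)
  have Lt: "set (L i) \<subseteq> tree s k" for i using T(3)[of i] by (auto simp: tree.wlk_def)
  have "wlk (map S (L i @ [c]))" for i
  proof -
    have "successively (\<lambda>x y. y \<in> tree_nb s k x) (L i @ [c])" using T(3)[of i] by (simp add: tree.wlk_def)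
    hence "successively (\<lambda>x y. S y \<in> nb (S x)) (L i @ [c])"
      by (rule successively_mono) (use homs_nb[OF S] in auto)
    moreover have "set (map S (L i @ [c])) \<subseteq> V" using Lt[of i] SV T(1) by auto
    ultimately show ?thesis unfolding wlk_def successively_map by simp
  qed
  moreover have "distinct (map S (L i @ [c]))" for i
    using T(1) T(4,5)[of i] Lt[of i] inj by (auto simp: distinct_map intro: inj_on_subset dest: inj_onD)
  moreover have "set (map S (L i)) \<inter> set (map S (L j)) = {}" if "i \<noteq> j" for i j
    using T(6)[OF that] Lt[of i] Lt[of j] inj_onD[OF inj] by fastforce
  ultimately show ?thesis using SV[OF T(1)] T(2) unfolding cL spider_map_def sp_def by simp
qed

end

context bounded_graph begin

lemma card_spider_verts:
  assumes S: "S \<in> sp \<kappa>" and supp: "\<And>i. i \<ge> r \<Longrightarrow> \<kappa> i = 0"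
  shows "card (spider_verts S) = Suc (\<Sum>i<r. \<kappa> i)" "spider_verts S \<subseteq> V" "finite (spider_verts S)"
proof -
  obtain c L where cL: "S = (c, L)" by (cases S)
  note T = spD[OF S[unfolded cL]]
  have "(\<Union>i. set (L i)) = (\<Union>i<r. set (L i))"
  proof (intro equalityI UN_least)
    fix i show "set (L i) \<subseteq> (\<Union>i<r. set (L i))"
    proof (cases "i < r")
      case False
      hence "L i = []" using T(2)[of i] supp[of i] by simp
      thus ?thesis by simp
    qed blast
  qed blast
  hence eq: "spider_verts S = insert c (\<Union>i<r. set (L i))" by (simp add: spider_verts_def cL)
  have "card (\<Union>i<r. set (L i)) = (\<Sum>i<r. card (set (L i)))"
    by (rule card_UN_disjoint) (use T(6) in auto)
  also have "\<dots> = (\<Sum>i<r. \<kappa> i)" using T(2,4) by (simp add: distinct_card)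
  finally show "card (spider_verts S) = Suc (\<Sum>i<r. \<kappa> i)" unfolding eq using T(5) by simp
  show "finite (spider_verts S)" unfolding eq by simp
  have "set (L i) \<subseteq> V" for i using T(3)[of i] by (auto simp: wlk_def)
  thus "spider_verts S \<subseteq> V" unfolding eq using T(1) by blast
qed

end

section \<open>Bounding the fibres over the leaves\<close>

text \<open>The situation throughout the discarding. Absence of the subdivision is included, so the
  whole process runs inside a proof by contradiction.\<close>

definition dense_homs :: "nat \<Rightarrow> nat \<Rightarrow> nat \<Rightarrow> nat \<Rightarrow> real \<Rightarrow> 'a set \<Rightarrow> ('a \<Rightarrow> 'a set) \<Rightarrow> nat \<Rightarrow> (nat \<times> nat \<Rightarrow> 'a) set \<Rightarrow> bool" where
  "dense_homs s t k D0 \<epsilon> V nb D \<S> \<longleftrightarrow> bounded_graph V nb D \<and> V \<noteq> {} \<and> D0 \<le> D \<and>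
     \<not> bounded_graph.has_subdivision V nb s t k \<and> \<S> \<subseteq> bounded_graph.homs V nb (tree s k) \<and>
     \<epsilon> * card V * real D ^ (s * k) \<le> card \<S>"

definition reach_with :: "'a itself \<Rightarrow> nat \<Rightarrow> nat \<Rightarrow> nat \<Rightarrow> ((nat \<times> nat) set \<times> (nat \<times> nat) set) set \<Rightarrow>
    real \<Rightarrow> nat \<Rightarrow> nat \<Rightarrow> real \<Rightarrow> bool" where
  "reach_with TT s t k U \<epsilon>0 F D0 \<epsilon> \<longleftrightarrow> (\<forall>(V :: 'a set) nb D \<S>0. dense_homs s t k D0 \<epsilon>0 V nb D \<S>0 \<longrightarrow>
     (\<exists>\<S>\<subseteq>\<S>0. \<epsilon> * card V * real D ^ (s * k) \<le> card \<S> \<and> (\<forall>\<tau>\<in>U. inv_bounded \<S> F \<tau>)))"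

text \<open>With \<open>refinable\<close> below, this gives the state and the single step of the
  discarding process. The constants are quantified before the graph, which keeps them uniform; a
  step has to cope with an arbitrary bound \<open>F\<close> for the trees treated before.\<close>

definition reach :: "'a itself \<Rightarrow> nat \<Rightarrow> nat \<Rightarrow> nat \<Rightarrow> ((nat \<times> nat) set \<times> (nat \<times> nat) set) set \<Rightarrow> bool" where
  "reach TT s t k U \<longleftrightarrow> (\<forall>\<epsilon>0>0. \<exists>F D0. \<exists>\<epsilon>>0. reach_with TT s t k U \<epsilon>0 F D0 \<epsilon>)"

definition refines_with :: "'a itself \<Rightarrow> nat \<Rightarrow> nat \<Rightarrow> nat \<Rightarrow> ((nat \<times> nat) set \<times> (nat \<times> nat) set) set \<Rightarrow>
    (nat \<times> nat) set \<times> (nat \<times> nat) set \<Rightarrow> real \<Rightarrow> nat \<Rightarrow> nat \<Rightarrow> nat \<Rightarrow> bool" where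
  "refines_with TT s t k U \<tau> \<epsilon> F F' D0 \<longleftrightarrow> (\<forall>(V :: 'a set) nb D \<S>. dense_homs s t k D0 \<epsilon> V nb D \<S> \<longrightarrow>
     (\<forall>\<sigma>\<in>U. inv_bounded \<S> F \<sigma>) \<longrightarrow>
     (\<exists>\<S>'\<subseteq>\<S>. \<epsilon> / 2 * card V * real D ^ (s * k) \<le> card \<S>' \<and> inv_bounded \<S>' F' \<tau>))"

definition refinable :: "'a itself \<Rightarrow> nat \<Rightarrow> nat \<Rightarrow> nat \<Rightarrow> ((nat \<times> nat) set \<times> (nat \<times> nat) set) set \<Rightarrow>
    (nat \<times> nat) set \<times> (nat \<times> nat) set \<Rightarrow> bool" where
  "refinable TT s t k U \<tau> \<longleftrightarrow> (\<forall>\<epsilon>>0. \<forall>F. \<exists>F' D0. refines_with TT s t k U \<tau> \<epsilon> F F' D0)"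

lemma dense_homs_finite: "dense_homs s t k D0 \<epsilon> V nb D \<S> \<Longrightarrow> finite \<S>"
  unfolding dense_homs_def using bounded_graph.finite_homs[OF _ finite_tree] finite_subset by metis

lemma reach_empty: "reach TYPE('a) s t k {}"
  unfolding reach_def
proof (intro allI impI)
  fix \<epsilon>0 :: real assume e0: "\<epsilon>0 > 0"
  have "reach_with TYPE('a) s t k {} \<epsilon>0 0 0 \<epsilon>0" by (auto simp: reach_with_def dense_homs_def)
  thus "\<exists>F D0. \<exists>\<epsilon>>0. reach_with TYPE('a) s t k {} \<epsilon>0 F D0 \<epsilon>" using e0 by blast
qed

text \<open>Bounds pass to subfamilies, so trees treated earlier remain treated after further
  discarding; the maximum of the two bounds serves for all.\<close>

lemma reach_insert:
  assumes "reach TYPE('a) s t k U" "refinable TYPE('a) s t k U \<tau>"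
  shows "reach TYPE('a) s t k (insert \<tau> U)"
  unfolding reach_def
proof (intro allI impI)
  fix \<epsilon>0 :: real assume "\<epsilon>0 > 0"
  note \<epsilon>0 = this
  obtain F1 D1 and \<epsilon>1 :: real where 1: "\<epsilon>1 > 0" "\<And>(V :: 'a set) nb D \<S>0. dense_homs s t k D1 \<epsilon>0 V nb D \<S>0 \<Longrightarrow>
     (\<exists>\<S>\<subseteq>\<S>0. \<epsilon>1 * card V * real D ^ (s * k) \<le> card \<S> \<and> (\<forall>\<tau>\<in>U. inv_bounded \<S> F1 \<tau>))"
    using assms(1)[unfolded reach_def reach_with_def, rule_format, OF \<epsilon>0] by blast
  obtain F2 D2 where 2: "\<And>(V :: 'a set) nb D \<S>. dense_homs s t k D2 \<epsilon>1 V nb D \<S> \<Longrightarrow>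
     (\<forall>\<sigma>\<in>U. inv_bounded \<S> F1 \<sigma>) \<Longrightarrow>
     (\<exists>\<S>'\<subseteq>\<S>. \<epsilon>1 / 2 * card V * real D ^ (s * k) \<le> card \<S>' \<and> inv_bounded \<S>' F2 \<tau>)"
    using assms(2)[unfolded refinable_def refines_with_def, rule_format, OF 1(1), of F1] by blast
  have "\<exists>\<S>\<subseteq>\<S>0. \<epsilon>1 / 2 * card V * real D ^ (s * k) \<le> card \<S> \<and> (\<forall>\<sigma>\<in>insert \<tau> U. inv_bounded \<S> (max F1 F2) \<sigma>)"
    if d: "dense_homs s t k (max D1 D2) \<epsilon>0 V nb D \<S>0" for V :: "'a set" and nb D \<S>0
  proof -
    have "dense_homs s t k D1 \<epsilon>0 V nb D \<S>0" using d by (simp add: dense_homs_def)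
    from 1(2)[OF this] obtain \<S> where S: "\<S> \<subseteq> \<S>0" "\<epsilon>1 * card V * real D ^ (s * k) \<le> card \<S>" "\<forall>\<tau>\<in>U. inv_bounded \<S> F1 \<tau>"
      by blast
    have dS: "dense_homs s t k D2 \<epsilon>1 V nb D \<S>"
      using d order.trans[OF S(1)] S(2) unfolding dense_homs_def by simp
    from 2[OF dS S(3)] obtain \<S>' where S': "\<S>' \<subseteq> \<S>" "\<epsilon>1 / 2 * card V * real D ^ (s * k) \<le> card \<S>'" "inv_bounded \<S>' F2 \<tau>"
      by blast
    have fin: "finite \<S>" "finite \<S>'" using dense_homs_finite[OF dS] S'(1) finite_subset by auto
    have "inv_bounded \<S>' (max F1 F2) \<sigma>" if "\<sigma> \<in> insert \<tau> U" for \<sigma>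
    proof (cases "\<sigma> = \<tau>")
      case True
      thus ?thesis using inv_bounded_mono[OF S'(3) fin(2) order.refl] by simp
    next
      case False
      hence "inv_bounded \<S> F1 \<sigma>" using that S(3) by simp
      from inv_bounded_mono[OF this fin(1) S'(1)] show ?thesis by simp
    qed
    thus ?thesis using S'(1,2) S(1) by (intro exI[of _ \<S>']) auto
  qed
  hence "reach_with TYPE('a) s t k (insert \<tau> U) \<epsilon>0 (max F1 F2) (max D1 D2) (\<epsilon>1 / 2)"
    unfolding reach_with_def by blast
  thus "\<exists>F D0. \<exists>\<epsilon>>0. reach_with TYPE('a) s t k (insert \<tau> U) \<epsilon>0 F D0 \<epsilon>" using half_gt_zero[OF 1(1)] by blast
qed

lemma refinable_mono:
  assumes "refinable TYPE('a) s t k U \<tau>" "U \<subseteq> U'"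
  shows "refinable TYPE('a) s t k U' \<tau>"
proof -
  have "refines_with TYPE('a) s t k U' \<tau> \<epsilon> F F' D0" if r: "refines_with TYPE('a) s t k U \<tau> \<epsilon> F F' D0" for \<epsilon> F F' D0
    unfolding refines_with_def
  proof (intro allI impI)
    fix V :: "'a set" and nb D \<S>
    assume d: "dense_homs s t k D0 \<epsilon> V nb D \<S>" and i: "\<forall>\<sigma>\<in>U'. inv_bounded \<S> F \<sigma>"
    have "\<forall>\<sigma>\<in>U. inv_bounded \<S> F \<sigma>" using i assms(2) by blast
    from r[unfolded refines_with_def, rule_format, OF d, OF this[rule_format]]
    show "\<exists>\<S>'\<subseteq>\<S>. \<epsilon> / 2 * card V * real D ^ (s * k) \<le> card \<S>' \<and> inv_bounded \<S>' F' \<tau>" .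
  qed
  thus ?thesis using assms(1) unfolding refinable_def by blast
qed

lemma reach_Un:
  assumes "finite X" "reach TYPE('a) s t k U" "\<And>\<tau>. \<tau> \<in> X \<Longrightarrow> refinable TYPE('a) s t k U \<tau>"
  shows "reach TYPE('a) s t k (U \<union> X)"
  using assms(1,3)
proof (induction X rule: finite_induct)
  case empty
  thus ?case using assms(2) by simp
next
  case (insert \<tau> X)
  have "refinable TYPE('a) s t k (U \<union> X) \<tau>" by (rule refinable_mono[OF insert.prems]) auto
  from reach_insert[OF insert.IH this] show ?case using insert.prems by simp
qed

text \<open>For a tree whose bound follows from those in \<open>U\<close> no copy is
  discarded.\<close>

lemma refinable_bounded:
  assumes "\<And>F. \<exists>F'. \<forall>(V :: 'a set) nb D \<S>. bounded_graph V nb D \<longrightarrow> \<S> \<subseteq> bounded_graph.homs V nb (tree s k) \<longrightarrow> finite \<S> \<longrightarrow>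
    (\<forall>\<sigma>\<in>U. inv_bounded \<S> F \<sigma>) \<longrightarrow> inv_bounded \<S> F' \<tau>"
  shows "refinable TYPE('a) s t k U \<tau>"
  unfolding refinable_def
proof (intro allI impI)
  fix \<epsilon> :: real and F assume \<epsilon>: "\<epsilon> > 0"
  obtain F' where F': "\<And>(V :: 'a set) nb D \<S>. bounded_graph V nb D \<Longrightarrow> \<S> \<subseteq> bounded_graph.homs V nb (tree s k) \<Longrightarrow> finite \<S> \<Longrightarrow>
    (\<forall>\<sigma>\<in>U. inv_bounded \<S> F \<sigma>) \<Longrightarrow> inv_bounded \<S> F' \<tau>" using assms[of F] by blast
  have "\<exists>\<S>'\<subseteq>\<S>. \<epsilon> / 2 * card V * real D ^ (s * k) \<le> card \<S>' \<and> inv_bounded \<S>' F' \<tau>"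
    if d: "dense_homs s t k 0 \<epsilon> V nb D \<S>" and i: "\<forall>\<sigma>\<in>U. inv_bounded \<S> F \<sigma>" for V :: "'a set" and nb D \<S>
  proof -
    have "inv_bounded \<S> F' \<tau>"
      by (rule F'[of V nb D, OF _ _ dense_homs_finite[OF d] i]) (use d in \<open>simp_all add: dense_homs_def\<close>)
    moreover have "\<epsilon> / 2 * card V * real D ^ (s * k) \<le> \<epsilon> * card V * real D ^ (s * k)"
      using \<epsilon> by (intro mult_right_mono) auto
    hence "\<epsilon> / 2 * card V * real D ^ (s * k) \<le> card \<S>" using d unfolding dense_homs_def by linarith
    ultimately show ?thesis by blast
  qed
  thus "\<exists>F' D0. refines_with TYPE('a) s t k U \<tau> \<epsilon> F F' D0" unfolding refines_with_def by blast
qed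

text \<open>The condition of \<open>forces_with\<close> on the number of spiders through a vertex, for restrictions of copies.\<close>

definition via_bounded :: "'a itself \<Rightarrow> nat \<Rightarrow> nat \<Rightarrow> ((nat \<times> nat) set \<times> (nat \<times> nat) set) set \<Rightarrow>
    (nat \<times> nat) spider \<Rightarrow> nat \<Rightarrow> nat \<Rightarrow> bool" where
  "via_bounded TT s k U \<sigma> F q \<longleftrightarrow> (\<forall>(V :: 'a set) nb D \<S> S0 z T. bounded_graph V nb D \<longrightarrow> \<S> \<subseteq> bounded_graph.homs V nb (tree s k) \<longrightarrow>
       finite \<S> \<longrightarrow> (\<forall>\<sigma>\<in>U. inv_bounded \<S> F \<sigma>) \<longrightarrow> S0 \<in> \<S> \<longrightarrow> z \<in> non_leaves \<sigma> \<longrightarrow> T \<subseteq> \<S> \<longrightarrow>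
       (\<forall>S\<in>T. (\<forall>b\<in>spider_leaves \<sigma>. S b = S0 b) \<and> S z = S0 z) \<longrightarrow>
       card ((\<lambda>S. restrict S (spider_verts \<sigma>)) ` T) \<le> q)"

text \<open>The copies with more than \<open>C\<close> companions are discarded. If they exceeded
  half of the guaranteed number, their restrictions would be a dense family of spiders, because a
  spider extends to at most \<open>D ^ card (tree s k - J)\<close> copies, and \<open>forces\<close>
  would give the excluded subdivision.\<close>

lemma refinable_forces:
  fixes \<sigma> :: "(nat \<times> nat) spider"
  assumes \<sigma>: "\<sigma> \<in> tree.sp s k \<kappa>" and supp: "\<And>i. i \<ge> r \<Longrightarrow> \<kappa> i = 0" and f: "forces TYPE('a) s t k r \<kappa>"
    and via: "\<And>F. \<exists>q. via_bounded TYPE('a) s k U \<sigma> F q"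
  shows "refinable TYPE('a) s t k U (spider_verts \<sigma>, spider_leaves \<sigma>)"
  unfolding refinable_def
proof (intro allI impI)
  fix \<epsilon> :: real and F assume \<epsilon>: "\<epsilon> > 0"
  define J where "J = spider_verts \<sigma>"
  define B where "B = spider_leaves \<sigma>"
  note J = tree.card_spider_verts[OF \<sigma> supp, folded J_def]
  have J0: "J \<noteq> {}" by (simp add: J_def spider_verts_def)
  obtain q where q: "\<And>(V :: 'a set) nb D \<S> S0 z T. bounded_graph V nb D \<Longrightarrow> \<S> \<subseteq> bounded_graph.homs V nb (tree s k) \<Longrightarrow>
       finite \<S> \<Longrightarrow> (\<forall>\<sigma>\<in>U. inv_bounded \<S> F \<sigma>) \<Longrightarrow> S0 \<in> \<S> \<Longrightarrow> z \<in> non_leaves \<sigma> \<Longrightarrow> T \<subseteq> \<S> \<Longrightarrow>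
       (\<forall>S\<in>T. (\<forall>b\<in>B. S b = S0 b) \<and> S z = S0 z) \<Longrightarrow> card ((\<lambda>S. restrict S J) ` T) \<le> q"
    using via[of F] unfolding via_bounded_def J_def B_def by blast
  have \<epsilon>2: "\<epsilon> / 2 > 0" using \<epsilon> by simp
  \<comment> \<open>A vertex of the graph may be the image of any non-leaf position. As
    \<open>q\<close> bounds the copies for one position, \<open>card J * q\<close> bounds them for
    all.\<close>
  obtain C D0 where CD: "\<And>(V :: 'a set) nb D P0.
     bounded_graph V nb D \<Longrightarrow> V \<noteq> {} \<Longrightarrow> D0 \<le> D \<Longrightarrow> P0 \<subseteq> bounded_graph.sp V nb \<kappa> \<Longrightarrow>
     \<epsilon> / 2 * card V * real D ^ (\<Sum>i<r. \<kappa> i) \<le> card P0 \<Longrightarrow>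
     (\<forall>S\<in>P0. \<forall>w. card {S'\<in>P0. leaf_key S' = leaf_key S \<and> w \<in> non_leaves S'} \<le> card J * q) \<Longrightarrow>
     C * card (leaf_key ` P0) \<le> card P0 \<Longrightarrow> bounded_graph.has_subdivision V nb s t k"
    using f[unfolded forces_def forces_with_def, rule_format, OF \<epsilon>2, of "card J * q"] by blast
  have "\<exists>\<S>'\<subseteq>\<S>. \<epsilon> / 2 * card V * real D ^ (s * k) \<le> card \<S>' \<and> inv_bounded \<S>' C (J, B)"
    if d: "dense_homs s t k (max 1 D0) \<epsilon> V nb D \<S>" and inv: "\<forall>\<sigma>\<in>U. inv_bounded \<S> F \<sigma>" for V :: "'a set" and nb D \<S>
  proof -
    interpret bounded_graph V nb D using d by (simp add: dense_homs_def)
    have d': "V \<noteq> {}" "D0 \<le> D" "0 < D" "\<not> has_subdivision s t k" "\<S> \<subseteq> homs (tree s k)" "\<epsilon> * card V * real D ^ (s * k) \<le> card \<S>"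
      using d by (auto simp: dense_homs_def)
    have fin: "finite \<S>" by (rule dense_homs_finite[OF d])
    define fib where "fib S = {S'\<in>\<S>. \<forall>b\<in>B. S' b = S b}" for S
    define bad where "bad = {S\<in>\<S>. C < card ((\<lambda>S'. restrict S' J) ` fib S)}"
    define m where "m S = spider_map S \<sigma>" for S :: "nat \<times> nat \<Rightarrow> 'a"
    have meq: "m S = m S' \<longleftrightarrow> restrict S J = restrict S' J" for S S' by (simp add: m_def J_def spider_map_eq_iff)
    have lk: "leaf_key (m S) = leaf_key (m S') \<longleftrightarrow> (\<forall>b\<in>B. S b = S' b)" for S S'
      by (simp add: m_def B_def leaf_key_spider_map)
    have cm: "card (m ` T) = card ((\<lambda>S. restrict S J) ` T)" if "finite T" for T
      by (intro antisym card_image_le_determined[OF that]) (simp_all add: meq)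
    have finb: "finite bad" using fin by (simp add: bad_def)
    define P0 where "P0 = m ` bad"
    have finP0: "finite P0" using finb by (simp add: P0_def)
    have small: "real (card bad) \<le> \<epsilon> / 2 * card V * real D ^ (s * k)"
    proof (rule ccontr)
      assume big: "\<not> ?thesis"
      have cb: "card bad \<le> card P0 * D ^ card (tree s k - J)"
      proof -
        have "card ((\<lambda>S. S) ` bad) \<le> card (m ` bad) * D ^ card (tree s k - J)"
        proof (rule card_image_le_fibres[OF finb])
          fix S0 assume "S0 \<in> bad"
          have "{S\<in>bad. m S = m S0} \<subseteq> {S \<in> homs (tree s k). \<forall>x\<in>J. S x = S0 x}"
          proof
            fix S assume S: "S \<in> {S\<in>bad. m S = m S0}"
            hence r: "restrict S J = restrict S0 J" using meq by simp
            have "S x = S0 x" if "x \<in> J" for x using fun_cong[OF r, of x] that by simp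
            moreover have "S \<in> homs (tree s k)" using S d'(5) by (auto simp: bad_def)
            ultimately show "S \<in> {S \<in> homs (tree s k). \<forall>x\<in>J. S x = S0 x}" by blast
          qed
          hence "card {S\<in>bad. m S = m S0} \<le> card {S \<in> homs (tree s k). \<forall>x\<in>J. S x = S0 x}"
            by (rule card_mono[rotated]) (use finite_homs[of "tree s k"] in simp)
          also have "\<dots> \<le> D ^ card (tree s k - J)" by (rule card_homs_extending[OF J(2) J0])
          finally show "card ((\<lambda>S. S) ` {S \<in> bad. m S = m S0}) \<le> D ^ card (tree s k - J)" by simp
        qed
        thus ?thesis by (simp add: P0_def)
      qed
      have cJ: "card (tree s k - J) + (\<Sum>i<r. \<kappa> i) = s * k"
        using J card_Diff_subset[OF J(3,2)] card_mono[OF finite_tree J(2)] by (simp add: card_tree)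
      have "\<epsilon> / 2 * card V * real D ^ (s * k) < real (card P0 * D ^ card (tree s k - J))"
        using big of_nat_mono[OF cb, where 'a = real] by linarith
      hence "(\<epsilon> / 2 * card V * real D ^ (\<Sum>i<r. \<kappa> i)) * real D ^ card (tree s k - J) < card P0 * real D ^ card (tree s k - J)"
        unfolding cJ[symmetric] by (simp add: power_add mult_ac)
      hence dense: "\<epsilon> / 2 * card V * real D ^ (\<Sum>i<r. \<kappa> i) \<le> card P0" using d'(3) by simp
      have sub: "P0 \<subseteq> sp \<kappa>" using spider_map_sp[OF _ \<sigma>] d'(5) by (auto simp: P0_def m_def bad_def)
      \<comment> \<open>Being bad depends only on the images of the leaves, so passing to the bad
        copies does not shrink their leaf fibres.\<close>
      have fibbad: "fib S \<subseteq> bad" if "S \<in> bad" for S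
      proof
        fix S' assume S': "S' \<in> fib S"
        hence "fib S' = fib S" by (auto simp: fib_def)
        thus "S' \<in> bad" using S' that by (auto simp: bad_def fib_def)
      qed
      have many: "C * card (leaf_key ` P0) \<le> card P0"
      proof -
        have "C \<le> card {p\<in>P0. leaf_key p = y}" if y: "y \<in> leaf_key ` P0" for y
        proof -
          obtain S where S: "S \<in> bad" "y = leaf_key (m S)" using y unfolding P0_def by blast
          have "m ` fib S \<subseteq> {p\<in>P0. leaf_key p = y}"
            using fibbad[OF S(1)] lk by (auto simp: P0_def S(2) fib_def)
          hence "card (m ` fib S) \<le> card {p\<in>P0. leaf_key p = y}" using finP0 by (intro card_mono) auto
          moreover have "C < card (m ` fib S)" using S(1) cm[of "fib S"] fin by (simp add: bad_def fib_def)
          ultimately show ?thesis by linarith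
        qed
        hence "(\<Sum>y\<in>leaf_key ` P0. C) \<le> (\<Sum>y\<in>leaf_key ` P0. card {p\<in>P0. leaf_key p = y})" by (rule sum_mono)
        also have "\<dots> = card P0"
          using sum.image_gen[OF finP0, of "\<lambda>_. 1 :: nat" leaf_key] by simp
        finally show ?thesis by (simp add: mult.commute)
      qed
      have "card {p\<in>P0. leaf_key p = leaf_key p0 \<and> w \<in> non_leaves p} \<le> card J * q" if p0: "p0 \<in> P0" for p0 w
      proof -
        obtain S0 where S0: "S0 \<in> bad" "p0 = m S0" using p0 by (auto simp: P0_def)
        have nJ: "non_leaves \<sigma> \<subseteq> J" unfolding J_def spider_verts_split by blast
        hence finN: "finite (non_leaves \<sigma>)" using J(3) finite_subset by blast
        define TT where "TT z = {S\<in>\<S>. (\<forall>b\<in>B. S b = S0 b) \<and> S z = w}" for z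
        have cT: "card (m ` TT z) \<le> q" if z: "z \<in> non_leaves \<sigma>" for z
        proof (cases "TT z = {}")
          case False
          then obtain S1 where S1: "S1 \<in> TT z" by blast
          have "card ((\<lambda>S. restrict S J) ` TT z) \<le> q"
            by (rule q[OF bounded_graph_axioms d'(5) fin inv _ z, of S1]) (use S1 in \<open>auto simp: TT_def\<close>)
          thus ?thesis using cm[of "TT z"] fin by (simp add: TT_def)
        qed simp
        have "{p\<in>P0. leaf_key p = leaf_key p0 \<and> w \<in> non_leaves p} \<subseteq> (\<Union>z\<in>non_leaves \<sigma>. m ` TT z)"
        proof
          fix p assume p: "p \<in> {p\<in>P0. leaf_key p = leaf_key p0 \<and> w \<in> non_leaves p}"
          then obtain S where S: "S \<in> bad" "p = m S" by (auto simp: P0_def)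
          have "w \<in> S ` non_leaves \<sigma>" using p S(2) by (simp add: m_def non_leaves_spider_map)
          then obtain z where z: "z \<in> non_leaves \<sigma>" "S z = w" by auto
          have "\<forall>b\<in>B. S b = S0 b" using p lk S(2) S0(2) by simp
          hence "S \<in> TT z" using S(1) z(2) by (simp add: TT_def bad_def)
          thus "p \<in> (\<Union>z\<in>non_leaves \<sigma>. m ` TT z)" using z(1) S(2) by blast
        qed
        hence "card {p\<in>P0. leaf_key p = leaf_key p0 \<and> w \<in> non_leaves p} \<le> card (\<Union>z\<in>non_leaves \<sigma>. m ` TT z)"
          using finN fin by (intro card_mono) (auto simp: TT_def)
        also have "\<dots> \<le> (\<Sum>z\<in>non_leaves \<sigma>. card (m ` TT z))" using finN by (rule card_UN_le)
        also have "\<dots> \<le> card (non_leaves \<sigma>) * q" using sum_bounded_above[of "non_leaves \<sigma>" "\<lambda>z. card (m ` TT z)" q] cT by simp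
        also have "\<dots> \<le> card J * q" using card_mono[OF J(3) nJ] by simp
        finally show ?thesis .
      qed
      hence "has_subdivision s t k"
        using CD[OF bounded_graph_axioms d'(1,2) sub dense _ many] by blast
      thus False using d'(4) by simp
    qed
    define \<S>' where "\<S>' = \<S> - bad"
    have "card \<S>' = card \<S> - card bad" unfolding \<S>'_def by (rule card_Diff_subset[OF finb]) (auto simp: bad_def)
    moreover have "card bad \<le> card \<S>" using fin by (intro card_mono) (auto simp: bad_def)
    ultimately have "real (card \<S>') = real (card \<S>) - real (card bad)" by (simp add: of_nat_diff)
    hence "\<epsilon> / 2 * card V * real D ^ (s * k) \<le> card \<S>'" using small d'(6) by linarith
    moreover have "inv_bounded \<S>' C (J, B)" unfolding inv_bounded_def
    proof
      fix S0 assume S0: "S0 \<in> \<S>'"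
      have "card ((\<lambda>S. restrict S J) ` {S\<in>\<S>'. \<forall>b\<in>B. S b = S0 b}) \<le> card ((\<lambda>S. restrict S J) ` fib S0)"
        using fin by (intro card_mono) (auto simp: \<S>'_def fib_def)
      also have "\<dots> \<le> C" using S0 by (auto simp: \<S>'_def bad_def)
      finally show "card ((\<lambda>S. restrict S (fst (J, B))) ` {S\<in>\<S>'. \<forall>b\<in>snd (J, B). S b = S0 b}) \<le> C" by simp
    qed
    ultimately show ?thesis by (intro exI[of _ \<S>']) (auto simp: \<S>'_def)
  qed
  thus "\<exists>F' D0. refines_with TYPE('a) s t k U (spider_verts \<sigma>, spider_leaves \<sigma>) \<epsilon> F F' D0"
    unfolding refines_with_def J_def B_def by blast
qed


section \<open>Segments, cherries and smaller spiders in the index tree\<close>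

definition seg :: "nat \<Rightarrow> nat \<Rightarrow> nat \<Rightarrow> (nat \<times> nat) set \<times> (nat \<times> nat) set" where
  "seg i a b = (leg_pos i ` {a..b}, {leg_pos i a, leg_pos i b})"

definition cherry :: "nat \<Rightarrow> nat \<Rightarrow> (nat \<times> nat) set \<times> (nat \<times> nat) set" where
  "cherry i j = ({(0, 0), (i, 1), (j, 1)}, {(i, 1), (j, 1)})"

definition subspider :: "nat \<Rightarrow> (nat \<Rightarrow> nat) \<Rightarrow> (nat \<times> nat) set \<times> (nat \<times> nat) set" where
  "subspider s \<kappa> = (insert (0, 0) (SIGMA i:{..<s}. {1..\<kappa> i}), (\<lambda>i. (i, \<kappa> i)) ` {..<s})"

text \<open>Legs are listed from the leaf towards the centre, hence the reversal. A list with
  \<open>m = 0 < n\<close> ends at the centre.\<close>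

definition down :: "nat \<Rightarrow> nat \<Rightarrow> nat \<Rightarrow> (nat \<times> nat) list" where
  "down i m n = map (leg_pos i) (rev [m..<n])"

lemma set_down: "set (down i m n) = leg_pos i ` {m..<n}"
  by (simp add: down_def)

lemma length_down: "length (down i m n) = n - m"
  by (simp add: down_def)

lemma down_snoc: "m < n \<Longrightarrow> down i m n = down i (Suc m) n @ [leg_pos i m]"
  by (simp add: down_def upt_conv_Cons)

lemma down_Suc: "m \<le> n \<Longrightarrow> down i m (Suc n) = leg_pos i n # down i m n"
  by (simp add: down_def)

lemma hd_down: "m < n \<Longrightarrow> hd (down i m n) = leg_pos i (n - 1)"
  using down_Suc[of m "n - 1" i] by (cases n) auto

lemma inj_leg_pos: "inj (leg_pos i)"
  by (auto simp: inj_def leg_pos_def split: if_splits)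

lemma distinct_down: "distinct (down i m n)"
  using inj_leg_pos[of i] by (simp add: down_def distinct_map inj_on_def)

lemma parent_leg_pos: "parent (leg_pos i (Suc j)) = leg_pos i j"
  by (simp add: parent_def leg_pos_def)

lemma wlk_down: "i < s \<Longrightarrow> m < n \<Longrightarrow> n \<le> Suc k \<Longrightarrow> tree.wlk s k (down i m n)"
proof (induction n)
  case (Suc n)
  show ?case
  proof (cases "m = n")
    case True
    thus ?thesis using leg_pos_tree[of i s n k] Suc.prems by (simp add: down_def tree.wlk_def)
  next
    case False
    hence mn: "m < n" using Suc.prems by simp
    have "leg_pos i (n - 1) \<in> tree_nb s k (leg_pos i n)"
      using leg_pos_tree[of i s n k] leg_pos_tree[of i s "n - 1" k] Suc.prems mn parent_leg_pos[of i "n - 1"]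
      by (auto simp: tree_nb_def)
    moreover have "down i m n \<noteq> []" using mn length_down[of i m n] by auto
    ultimately show ?thesis using Suc mn by (simp add: down_Suc tree.wlk_Cons hd_down)
  qed
qed simp

text \<open>To match \<open>path_type\<close>, the spider is centred at position
  \<open>a + 1\<close>: position \<open>a\<close> is the leg of length 1, and positions
  \<open>b\<close> down to \<open>a + 2\<close> form the other leg.\<close>

lemma seg_spider:
  assumes i: "i < s" and ab: "a + 2 \<le> b" "b \<le> k"
  obtains \<sigma> where "\<sigma> \<in> tree.sp s k (path_type (b - a))" "(spider_verts \<sigma>, spider_leaves \<sigma>) = seg i a b"
    "non_leaves \<sigma> = leg_pos i ` {a<..<b}"
proof
  define L where "L = (\<lambda>l :: nat. if l = 0 then [leg_pos i a] else if l = 1 then down i (a + 2) (Suc b) else [])"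
  define \<sigma> where "\<sigma> = (leg_pos i (a + 1), L)"
  have b0: "down i (a + 2) (Suc b) = leg_pos i b # down i (a + 2) b" using ab by (intro down_Suc) simp
  have inj: "leg_pos i x = leg_pos i y \<longleftrightarrow> x = y" for x y using inj_leg_pos[of i] by (auto dest: injD)
  have un: "(\<Union>l. f (L l)) = f (L 0) \<union> f (L 1)" if "f [] = {}" for f :: "_ \<Rightarrow> (nat \<times> nat) set"
    using that by (auto simp: L_def split: if_splits)
  have L01: "L 0 = [leg_pos i a]" "L 1 = leg_pos i b # down i (a + 2) b" using b0 by (simp_all add: L_def)
  have w1: "tree.wlk s k (down i (a + 2) (Suc b) @ [leg_pos i (a + 1)])"
    using wlk_down[OF i, of "a + 1" "Suc b" k] down_snoc[of "a + 1" "Suc b" i] ab by simp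
  have w0: "tree.wlk s k ([leg_pos i a] @ [leg_pos i (a + 1)])"
  proof -
    have "tree.wlk s k (down i a (a + 2))" using wlk_down[OF i, of a "a + 2" k] ab by simp
    moreover have "down i a (a + 2) = rev ([leg_pos i a] @ [leg_pos i (a + 1)])" by (simp add: down_def)
    ultimately show ?thesis using tree.wlk_rev by metis
  qed
  have c: "leg_pos i (a + 1) \<in> tree s k" using leg_pos_tree[OF i, of "a + 1" k] ab by simp
  have w2: "tree.wlk s k [leg_pos i (a + 1)]" using c by (simp add: tree.wlk_def)
  have "length (L l) = path_type (b - a) l \<and> tree.wlk s k (L l @ [leg_pos i (a + 1)]) \<and> distinct (L l @ [leg_pos i (a + 1)])" for l
  proof -
    consider "l = 0" | "l = 1" | "l \<ge> 2" by linarith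
    thus ?thesis
    proof cases
      case 1
      thus ?thesis using w0 by (simp add: L_def path_type_def inj)
    next
      case 2
      thus ?thesis using w1 ab distinct_down[of i "a + 2" "Suc b"]
        by (auto simp: L_def path_type_def length_down set_down inj)
    next
      case 3
      thus ?thesis using w2 by (simp add: L_def path_type_def)
    qed
  qed
  moreover have "set (L l) \<inter> set (L l') = {}" if "l \<noteq> l'" for l l'
    using that by (auto simp: L_def set_down inj)
  ultimately show "\<sigma> \<in> tree.sp s k (path_type (b - a))"
    using c unfolding tree.sp_def \<sigma>_def by blast
  have "spider_verts \<sigma> = insert (leg_pos i (a + 1)) (insert (leg_pos i a) (leg_pos i ` {a + 2..b}))"
    using un[of set] by (simp add: spider_verts_def \<sigma>_def) (simp add: L_def set_down atLeastLessThanSuc_atLeastAtMost)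
  also have "\<dots> = leg_pos i ` (insert (a + 1) (insert a {a + 2..b}))" by simp
  also have "insert (a + 1) (insert a {a + 2..b}) = {a..b}" using ab by auto
  finally have v: "spider_verts \<sigma> = leg_pos i ` {a..b}" .
  have "spider_leaves \<sigma> = {leg_pos i a, leg_pos i b}"
  proof -
    have "spider_leaves \<sigma> = (\<Union>l. set (take 1 (L l)))" by (simp add: spider_leaves_def \<sigma>_def)
    also have "\<dots> = set (take 1 (L 0)) \<union> set (take 1 (L 1))" by (rule un) simp
    finally show ?thesis unfolding L01 by auto
  qed
  thus "(spider_verts \<sigma>, spider_leaves \<sigma>) = seg i a b" unfolding seg_def v by simp
  have "non_leaves \<sigma> = insert (leg_pos i (a + 1)) (leg_pos i ` {a + 2..<b})"
  proof -
    have "non_leaves \<sigma> = insert (leg_pos i (a + 1)) (\<Union>l. set (tl (L l)))" by (simp add: non_leaves_def \<sigma>_def)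
    also have "(\<Union>l. set (tl (L l))) = set (tl (L 0)) \<union> set (tl (L 1))" by (rule un) simp
    finally show ?thesis unfolding L01 by (simp add: set_down)
  qed
  also have "\<dots> = leg_pos i ` (insert (a + 1) {a + 2..<b})" by simp
  also have "insert (a + 1) {a + 2..<b} = {a<..<b}" using ab by auto
  finally show "non_leaves \<sigma> = leg_pos i ` {a<..<b}" .
qed

lemma cherry_spider:
  assumes ij: "i < s" "j < s" "i \<noteq> j" and k: "1 \<le> k"
  obtains \<sigma> where "\<sigma> \<in> tree.sp s k (path_type 2)" "(spider_verts \<sigma>, spider_leaves \<sigma>) = cherry i j"
    "non_leaves \<sigma> = {(0, 0)}"
proof
  define L where "L = (\<lambda>l :: nat. if l = 0 then [(i, 1)] else if l = 1 then [(j, 1)] else [] :: (nat \<times> nat) list)"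
  define \<sigma> where "\<sigma> = ((0 :: nat, 0 :: nat), L)"
  have un: "(\<Union>l. f (L l)) = f (L 0) \<union> f (L 1)" if "f [] = {}" for f :: "_ \<Rightarrow> (nat \<times> nat) set"
    using that by (auto simp: L_def split: if_splits)
  have c: "(0, 0) \<in> tree s k" by (simp add: tree_def)
  have w: "tree.wlk s k ([(l, 1)] @ [(0, 0)])" if "l < s" for l
  proof -
    have "tree.wlk s k (down l 0 2)" using wlk_down[OF that, of 0 2 k] k by simp
    moreover have "down l 0 2 = [(l, 1)] @ [(0, 0)]" by (simp add: down_def leg_pos_def numeral_2_eq_2)
    ultimately show ?thesis by simp
  qed
  have w2: "tree.wlk s k [(0, 0)]" using c by (simp add: tree.wlk_def)
  have "length (L l) = path_type 2 l \<and> tree.wlk s k (L l @ [(0, 0)]) \<and> distinct (L l @ [(0, 0)])" for l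
    using w[OF ij(1)] w[OF ij(2)] w2 by (simp add: L_def path_type_def)
  moreover have "set (L l) \<inter> set (L l') = {}" if "l \<noteq> l'" for l l'
    using that ij by (auto simp: L_def)
  ultimately show "\<sigma> \<in> tree.sp s k (path_type 2)"
    using c unfolding tree.sp_def \<sigma>_def by blast
  show "(spider_verts \<sigma>, spider_leaves \<sigma>) = cherry i j"
    using un[of set] un[of "\<lambda>l. set (take 1 l)"]
    by (simp add: spider_verts_def spider_leaves_def \<sigma>_def cherry_def) (simp add: L_def insert_commute)
  show "non_leaves \<sigma> = {(0, 0)}"
    using un[of "\<lambda>l. set (tl l)"] by (simp add: non_leaves_def \<sigma>_def) (simp add: L_def)
qed

lemma subspider_spider:
  assumes \<kappa>: "\<And>i. i < s \<Longrightarrow> 1 \<le> \<kappa> i \<and> \<kappa> i \<le> k" "\<And>i. i \<ge> s \<Longrightarrow> \<kappa> i = 0"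
  obtains \<sigma> where "\<sigma> \<in> tree.sp s k \<kappa>" "(spider_verts \<sigma>, spider_leaves \<sigma>) = subspider s \<kappa>"
    "non_leaves \<sigma> = insert (0, 0) (SIGMA i:{..<s}. {1..<\<kappa> i})"
proof
  define L where "L = (\<lambda>i. if i < s then down i 1 (Suc (\<kappa> i)) else [])"
  define \<sigma> where "\<sigma> = ((0 :: nat, 0 :: nat), L)"
  have c: "(0, 0) \<in> tree s k" by (simp add: tree_def)
  have w2: "tree.wlk s k [(0, 0)]" using c by (simp add: tree.wlk_def)
  have lp: "set (down i 1 n) = {i} \<times> {1..<n}" for i n
    unfolding set_down by (auto simp: leg_pos_def image_iff)
  have un: "(\<Union>l. f (L l)) = (\<Union>i<s. f (down i 1 (Suc (\<kappa> i))))" if "f [] = {}" for f :: "_ \<Rightarrow> (nat \<times> nat) set"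
    using that by (auto simp: L_def split: if_splits)
  have b0: "down i 1 (Suc (\<kappa> i)) = (i, \<kappa> i) # down i 1 (\<kappa> i)" if "i < s" for i
    using down_Suc[of 1 "\<kappa> i" i] \<kappa>(1)[OF that] by (auto simp: leg_pos_def)
  have "length (L l) = \<kappa> l \<and> tree.wlk s k (L l @ [(0, 0)]) \<and> distinct (L l @ [(0, 0)])" for l
  proof (cases "l < s")
    case True
    have "tree.wlk s k (down l 0 (Suc (\<kappa> l)))" using wlk_down[OF True, of 0 "Suc (\<kappa> l)" k] \<kappa>(1)[OF True] by simp
    moreover have "down l 0 (Suc (\<kappa> l)) = down l 1 (Suc (\<kappa> l)) @ [(0, 0)]" using down_snoc[of 0 "Suc (\<kappa> l)" l] by simp
    moreover have "(0, 0) \<notin> set (down l 1 (Suc (\<kappa> l)))" unfolding lp by auto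
    ultimately show ?thesis using True distinct_down[of l 1 "Suc (\<kappa> l)"] by (simp add: L_def length_down)
  next
    case False
    thus ?thesis using w2 \<kappa>(2)[of l] by (simp add: L_def)
  qed
  moreover have "set (L l) \<inter> set (L l') = {}" if "l \<noteq> l'" for l l'
    using that by (simp add: L_def del: One_nat_def) (auto simp: lp simp del: One_nat_def)
  ultimately show "\<sigma> \<in> tree.sp s k \<kappa>"
    using c unfolding tree.sp_def \<sigma>_def by blast
  have "(\<Union>l. set (L l)) = (SIGMA i:{..<s}. {1..\<kappa> i})"
  proof -
    have "(\<Union>l. set (L l)) = (\<Union>i<s. set (down i 1 (Suc (\<kappa> i))))" by (rule un) simp
    also have "\<dots> = (SIGMA i:{..<s}. {1..\<kappa> i})" unfolding lp by auto
    finally show ?thesis .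
  qed
  moreover have "(\<Union>l. set (take 1 (L l))) = (\<lambda>i. (i, \<kappa> i)) ` {..<s}"
  proof -
    have "(\<Union>l. set (take 1 (L l))) = (\<Union>i<s. set (take 1 (down i 1 (Suc (\<kappa> i)))))" by (rule un) simp
    also have "\<dots> = (\<Union>i<s. {(i, \<kappa> i)})" by (rule SUP_cong[OF refl], subst b0) simp_all
    finally show ?thesis by auto
  qed
  ultimately show "(spider_verts \<sigma>, spider_leaves \<sigma>) = subspider s \<kappa>"
    by (simp add: spider_verts_def spider_leaves_def \<sigma>_def subspider_def)
  have "(\<Union>l. set (tl (L l))) = (\<Union>i<s. set (tl (down i 1 (Suc (\<kappa> i)))))" by (rule un) simp
  also have "\<dots> = (\<Union>i<s. {i} \<times> {1..<\<kappa> i})" by (rule SUP_cong[OF refl]) (simp add: b0 lp del: One_nat_def)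
  finally show "non_leaves \<sigma> = insert (0, 0) (SIGMA i:{..<s}. {1..<\<kappa> i})"
    by (auto simp: non_leaves_def \<sigma>_def)
qed

section \<open>Treating the subtrees in order of size\<close>

lemma card_restrict_le_1:
  assumes "\<And>S x. S \<in> T \<Longrightarrow> x \<in> J \<Longrightarrow> S x = S0 x"
  shows "card ((\<lambda>S. restrict S J) ` T) \<le> 1"
proof -
  have "(\<lambda>S. restrict S J) ` T \<subseteq> {restrict S0 J}"
  proof (rule image_subsetI)
    fix S assume "S \<in> T"
    hence "restrict S J = restrict S0 J" by (intro restrict_ext) (rule assms)
    thus "restrict S J \<in> {restrict S0 J}" by simp
  qed
  from card_mono[OF _ this] show ?thesis by simp
qed

text \<open>An edge has no vertices besides its ends, so these determine the restriction.\<close>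

lemma refinable_edge: "refinable TYPE('a) s t k U (seg i a (Suc a))"
proof (rule refinable_bounded, rule exI[of _ 1], intro allI impI)
  fix F and V :: "'a set" and nb D and \<S> :: "(nat \<times> nat \<Rightarrow> 'a) set"
  have e: "{a..Suc a} = {a, Suc a}" by auto
  show "inv_bounded \<S> 1 (seg i a (Suc a))" unfolding inv_bounded_def
    by (intro ballI, rule card_restrict_le_1) (auto simp: seg_def e)
qed

text \<open>An inner vertex splits the segment into two shorter ones whose ends are fixed, with at
  most \<open>F\<close> restrictions each. Thus at most \<open>F * F\<close> companions pass through
  a given vertex at a given position, as forcing by paths requires.\<close>

lemma refinable_seg:
  assumes i: "i < s" and ab: "a + 2 \<le> b" "b \<le> k" and pos: "s > 0" "t > 0"
    and U: "\<And>m. a < m \<Longrightarrow> m < b \<Longrightarrow> seg i a m \<in> U \<and> seg i m b \<in> U"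
  shows "refinable TYPE('a) s t k U (seg i a b)"
proof -
  obtain \<sigma> where \<sigma>: "\<sigma> \<in> tree.sp s k (path_type (b - a))" "(spider_verts \<sigma>, spider_leaves \<sigma>) = seg i a b"
    "non_leaves \<sigma> = leg_pos i ` {a<..<b}" by (rule seg_spider[OF i ab])
  have v: "spider_verts \<sigma> = leg_pos i ` {a..b}" "spider_leaves \<sigma> = {leg_pos i a, leg_pos i b}"
    using \<sigma>(2) by (simp_all add: seg_def)
  have f: "forces TYPE('a) s t k 2 (path_type (b - a))" by (rule paths_force) (use ab pos in auto)
  show ?thesis unfolding \<sigma>(2)[symmetric]
  proof (rule refinable_forces[OF \<sigma>(1) _ f])
    show "path_type (b - a) l = 0" if "2 \<le> l" for l using that by (simp add: path_type_def)
  next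
    fix F
    show "\<exists>q. via_bounded TYPE('a) s k U \<sigma> F q"
    proof (rule exI[of _ "F * F"], unfold via_bounded_def, intro allI impI)
      fix V :: "'a set" and nb D \<S> S0 z T
      assume fin: "finite \<S>" and inv: "\<forall>\<sigma>\<in>U. inv_bounded \<S> F \<sigma>" and S0: "S0 \<in> \<S>" and z: "z \<in> non_leaves \<sigma>"
        and T: "T \<subseteq> \<S>" and ag: "\<forall>S\<in>T. (\<forall>b\<in>spider_leaves \<sigma>. S b = S0 b) \<and> S z = S0 z"
      obtain m where m: "a < m" "m < b" "z = leg_pos i m" using z \<sigma>(3) by auto
      have "{a..b} = {a..m} \<union> {m..b}" using m by auto
      hence J: "spider_verts \<sigma> \<subseteq> leg_pos i ` {a..m} \<union> leg_pos i ` {m..b}" unfolding v by (simp add: image_Un)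
      have "card ((\<lambda>S. restrict S (leg_pos i ` {a..m})) ` T) \<le> F"
        by (rule inv_boundedD[OF _ fin S0 T, of F _ "{leg_pos i a, leg_pos i m}"])
          (use inv U[OF m(1,2)] ag v m(3) in \<open>auto simp: seg_def\<close>)
      moreover have "card ((\<lambda>S. restrict S (leg_pos i ` {m..b})) ` T) \<le> F"
        by (rule inv_boundedD[OF _ fin S0 T, of F _ "{leg_pos i m, leg_pos i b}"])
          (use inv U[OF m(1,2)] ag v m(3) in \<open>auto simp: seg_def\<close>)
      ultimately show "card ((\<lambda>S. restrict S (spider_verts \<sigma>)) ` T) \<le> F * F"
        using card_restrict_Un[OF finite_subset[OF T fin] J] by (meson mult_le_mono order.trans)
    qed
  qed
qed

definition segs :: "nat \<Rightarrow> nat \<Rightarrow> nat \<Rightarrow> ((nat \<times> nat) set \<times> (nat \<times> nat) set) set" where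
  "segs s k l = (\<lambda>(i, a, b). seg i a b) ` {(i, a, b). i < s \<and> a < b \<and> b \<le> k \<and> b - a \<le> l}"

lemma segI: "i < s \<Longrightarrow> a < b \<Longrightarrow> b \<le> k \<Longrightarrow> b - a \<le> l \<Longrightarrow> seg i a b \<in> segs s k l"
  unfolding segs_def by (rule image_eqI[of _ _ "(i, a, b)"]) auto

lemma reach_segs:
  assumes pos: "s > 0" "t > 0"
  shows "reach TYPE('a) s t k (segs s k l)"
proof (induction l)
  case 0
  have "segs s k 0 = {}" by (auto simp: segs_def)
  thus ?case using reach_empty by simp
next
  case (Suc l)
  define X where "X = (\<lambda>(i, a, b). seg i a b) ` {(i, a, b). i < s \<and> a < b \<and> b \<le> k \<and> b - a = Suc l}"
  have "finite {(i, a, b). i < s \<and> a < b \<and> b \<le> k \<and> b - a = Suc l}"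
    by (rule finite_subset[of _ "{..<s} \<times> {..k} \<times> {..k}"]) auto
  hence finX: "finite X" by (simp add: X_def)
  have "reach TYPE('a) s t k (segs s k l \<union> X)"
  proof (rule reach_Un[OF finX Suc])
    fix \<tau> assume "\<tau> \<in> X"
    then obtain i a b where \<tau>: "\<tau> = seg i a b" "i < s" "a < b" "b \<le> k" "b - a = Suc l" by (auto simp: X_def)
    show "refinable TYPE('a) s t k (segs s k l) \<tau>"
    proof (cases l)
      case 0
      hence "b = Suc a" using \<tau> by simp
      thus ?thesis unfolding \<tau>(1) using refinable_edge by simp
    next
      case (Suc l')
      show ?thesis unfolding \<tau>(1)
        by (rule refinable_seg[OF \<tau>(2) _ \<tau>(4) pos]) (use \<tau> Suc in \<open>auto intro!: segI\<close>)
    qed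
  qed
  moreover have "{(i, a, b). i < s \<and> a < b \<and> b \<le> k \<and> b - a \<le> Suc l} =
      {(i, a, b). i < s \<and> a < b \<and> b \<le> k \<and> b - a \<le> l} \<union> {(i, a, b). i < s \<and> a < b \<and> b \<le> k \<and> b - a = Suc l}"
    by auto
  hence "segs s k (Suc l) = segs s k l \<union> X" unfolding segs_def X_def image_Un[symmetric] by (rule arg_cong)
  ultimately show ?case by simp
qed

definition cherries :: "nat \<Rightarrow> ((nat \<times> nat) set \<times> (nat \<times> nat) set) set" where
  "cherries s = (\<lambda>(i, j). cherry i j) ` {(i, j). i < s \<and> j < s \<and> i \<noteq> j}"

lemma cherryI: "i < s \<Longrightarrow> j < s \<Longrightarrow> i \<noteq> j \<Longrightarrow> cherry i j \<in> cherries s"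
  unfolding cherries_def by (rule image_eqI[of _ _ "(i, j)"]) auto

text \<open>The centre is the only non-leaf, and fixing it as well as the leaves leaves no
  choice.\<close>

lemma refinable_cherry:
  assumes ij: "i < s" "j < s" "i \<noteq> j" and k: "2 \<le> k" and t: "t > 0"
  shows "refinable TYPE('a) s t k U (cherry i j)"
proof -
  have k1: "1 \<le> k" using k by simp
  obtain \<sigma> where \<sigma>: "\<sigma> \<in> tree.sp s k (path_type 2)" "(spider_verts \<sigma>, spider_leaves \<sigma>) = cherry i j"
    "non_leaves \<sigma> = {(0, 0)}" by (rule cherry_spider[OF ij k1])
  have v: "spider_verts \<sigma> = insert (0, 0) (spider_leaves \<sigma>)" using \<sigma>(2) by (simp add: cherry_def)
  have f: "forces TYPE('a) s t k 2 (path_type 2)" by (rule paths_force) (use ij t k in auto)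
  show ?thesis unfolding \<sigma>(2)[symmetric]
  proof (rule refinable_forces[OF \<sigma>(1) _ f])
    show "path_type 2 l = 0" if "2 \<le> l" for l using that by (simp add: path_type_def)
  next
    fix F
    show "\<exists>q. via_bounded TYPE('a) s k U \<sigma> F q"
    proof (rule exI[of _ 1], unfold via_bounded_def, intro allI impI)
      fix V :: "'a set" and nb D \<S> S0 z T
      assume z: "z \<in> non_leaves \<sigma>" and ag: "\<forall>S\<in>T. (\<forall>b\<in>spider_leaves \<sigma>. S b = S0 b) \<and> S z = S0 z"
      show "card ((\<lambda>S. restrict S (spider_verts \<sigma>)) ` T) \<le> 1"
        by (rule card_restrict_le_1[of _ _ S0]) (use z \<sigma>(3) ag v in auto)
    qed
  qed
qed

lemma subspider_verts_subset:
  assumes "\<And>i. i < s \<Longrightarrow> 1 \<le> \<kappa> i" and s: "s > 0"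
  shows "fst (subspider s \<kappa>) \<subseteq> (\<Union>i\<in>{..<s}. leg_pos i ` {0..\<kappa> i})"
proof
  fix x assume "x \<in> fst (subspider s \<kappa>)"
  then consider "x = (0, 0)" | "fst x < s" "1 \<le> snd x" "snd x \<le> \<kappa> (fst x)" by (auto simp: subspider_def)
  thus "x \<in> (\<Union>i\<in>{..<s}. leg_pos i ` {0..\<kappa> i})"
  proof cases
    case 1
    hence "x = leg_pos 0 0" by simp
    thus ?thesis using s by (intro UN_I[of 0] image_eqI[of _ _ 0]) auto
  next
    case 2
    hence "x = leg_pos (fst x) (snd x)" by (simp add: leg_pos_def)
    thus ?thesis using 2 by (intro UN_I[of "fst x"] image_eqI[of _ _ "snd x"]) auto
  qed
qed

text \<open>Once the centre is fixed, every leg is a segment with both ends fixed and has at most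
  \<open>F\<close> restrictions.\<close>

lemma subspider_with_centre:
  assumes \<kappa>: "\<And>i. i < s \<Longrightarrow> 1 \<le> \<kappa> i \<and> \<kappa> i \<le> k" and s: "s > 0"
    and fin: "finite \<S>" and inv: "\<forall>\<tau>\<in>segs s k k. inv_bounded \<S> F \<tau>" and S0: "S0 \<in> \<S>" and T: "T \<subseteq> \<S>"
    and ag: "\<And>S b. S \<in> T \<Longrightarrow> b \<in> snd (subspider s \<kappa>) \<Longrightarrow> S b = S0 b" "\<And>S. S \<in> T \<Longrightarrow> S (0, 0) = S0 (0, 0)"
  shows "card ((\<lambda>S. restrict S (fst (subspider s \<kappa>))) ` T) \<le> F ^ s"
proof -
  have finT: "finite T" using T fin finite_subset by blast
  have "card ((\<lambda>S. restrict S (leg_pos i ` {0..\<kappa> i})) ` T) \<le> F" if i: "i \<in> {..<s}" for i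
  proof (rule inv_boundedD[OF _ fin S0 T])
    have "seg i 0 (\<kappa> i) \<in> segs s k k" using \<kappa>[of i] i by (intro segI) auto
    thus "inv_bounded \<S> F (leg_pos i ` {0..\<kappa> i}, {leg_pos i 0, leg_pos i (\<kappa> i)})" using inv by (simp add: seg_def)
    have "(i, \<kappa> i) \<in> snd (subspider s \<kappa>)" using i by (simp add: subspider_def)
    moreover have "leg_pos i (\<kappa> i) = (i, \<kappa> i)" using \<kappa>[of i] i by (simp add: leg_pos_def)
    ultimately show "S b = S0 b" if "S \<in> T" "b \<in> {leg_pos i 0, leg_pos i (\<kappa> i)}" for S b using that ag by auto
  qed
  from card_restrict_UN[OF finT finite_lessThan this]
  have "card ((\<lambda>S. restrict S (\<Union>i\<in>{..<s}. leg_pos i ` {0..\<kappa> i})) ` T) \<le> F ^ s" by simp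
  moreover have "card ((\<lambda>S. restrict S (fst (subspider s \<kappa>))) ` T) \<le> card ((\<lambda>S. restrict S (\<Union>i\<in>{..<s}. leg_pos i ` {0..\<kappa> i})) ` T)"
  proof (rule card_image_le_determined[OF finT])
    fix S S' assume e: "restrict S (\<Union>i\<in>{..<s}. leg_pos i ` {0..\<kappa> i}) = restrict S' (\<Union>i\<in>{..<s}. leg_pos i ` {0..\<kappa> i})"
    show "restrict S (fst (subspider s \<kappa>)) = restrict S' (fst (subspider s \<kappa>))"
    proof (rule restrict_ext)
      fix x assume "x \<in> fst (subspider s \<kappa>)"
      hence "x \<in> (\<Union>i\<in>{..<s}. leg_pos i ` {0..\<kappa> i})" using subspider_verts_subset[of s \<kappa>] \<kappa> s by blast
      thus "S x = S' x" using fun_cong[OF e, of x] by (simp only: restrict_apply if_True)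
    qed
  qed
  ultimately show ?thesis by linarith
qed

text \<open>Fixing an inner vertex of leg \<open>i\<close> at position \<open>j\<close> splits the
  spider into the one with leg \<open>i\<close> cut at \<open>j\<close> and a segment of the leg;
  fixing the centre splits it into segments. Hence few companions pass through a vertex, and
  \<open>spiders_force\<close> applies unless two legs have length 1.\<close>

lemma refinable_subspider:
  assumes \<kappa>: "\<And>i. i < s \<Longrightarrow> 1 \<le> \<kappa> i \<and> \<kappa> i \<le> k" "\<And>i. i \<ge> s \<Longrightarrow> \<kappa> i = 0" and s: "s > 0" and k: "k > 0"
    and U: "segs s k k \<subseteq> U" "cherries s \<subseteq> U"
    and less: "\<And>i j. i < s \<Longrightarrow> 1 \<le> j \<Longrightarrow> j < \<kappa> i \<Longrightarrow> subspider s (\<kappa>(i := j)) \<in> U"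
  shows "refinable TYPE('a) s t k U (subspider s \<kappa>)"
proof (cases "\<exists>i j. i < s \<and> j < s \<and> i \<noteq> j \<and> \<kappa> i = 1 \<and> \<kappa> j = 1")
  case True \<comment> \<open>the bound for cherries leaves few choices for the centre\<close>
  then obtain i j where ij: "i < s" "j < s" "i \<noteq> j" "\<kappa> i = 1" "\<kappa> j = 1" by blast
  show ?thesis
  proof (rule refinable_bounded)
    fix F
    show "\<exists>F'. \<forall>(V :: 'a set) nb D \<S>. bounded_graph V nb D \<longrightarrow> \<S> \<subseteq> bounded_graph.homs V nb (tree s k) \<longrightarrow> finite \<S> \<longrightarrow>
      (\<forall>\<sigma>\<in>U. inv_bounded \<S> F \<sigma>) \<longrightarrow> inv_bounded \<S> F' (subspider s \<kappa>)"
    proof (rule exI[of _ "F * F ^ s"], intro allI impI)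
      fix V :: "'a set" and nb D \<S>
      assume fin: "finite \<S>" and inv: "\<forall>\<sigma>\<in>U. inv_bounded \<S> F \<sigma>"
      show "inv_bounded \<S> (F * F ^ s) (subspider s \<kappa>)" unfolding inv_bounded_def
      proof
        fix S0 assume S0: "S0 \<in> \<S>"
        define T where "T = {S\<in>\<S>. \<forall>b\<in>snd (subspider s \<kappa>). S b = S0 b}"
        have finT: "finite T" using fin by (simp add: T_def)
        have mem: "(i, 1) \<in> snd (subspider s \<kappa>)" "(j, 1) \<in> snd (subspider s \<kappa>)"
          unfolding subspider_def using ij by (auto intro!: image_eqI)
        have "card ((\<lambda>S. restrict S (fst (subspider s \<kappa>))) ` T) \<le>
           card ((\<lambda>S. restrict S {(0, 0), (i, 1), (j, 1)}) ` T) * F ^ s"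
        proof (rule card_image_le_fibres[OF finT])
          fix S1 assume S1: "S1 \<in> T"
          define T1 where "T1 = {S\<in>T. restrict S {(0, 0), (i, 1), (j, 1)} = restrict S1 {(0, 0), (i, 1), (j, 1)}}"
          have centre: "S (0, 0) = S1 (0, 0)" if "S \<in> T1" for S
          proof -
            have "restrict S {(0, 0), (i, 1), (j, 1)} = restrict S1 {(0, 0), (i, 1), (j, 1)}" using that by (simp add: T1_def)
            from fun_cong[OF this, of "(0, 0)"] show ?thesis by simp
          qed
          have leaves: "S b = S1 b" if "S \<in> T1" "b \<in> snd (subspider s \<kappa>)" for S b
            using that S1 by (simp add: T1_def T_def)
          have "card ((\<lambda>S. restrict S (fst (subspider s \<kappa>))) ` T1) \<le> F ^ s"
          proof (rule subspider_with_centre[where F = F and ?S0.0 = S1, OF \<kappa>(1) s fin])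
            show "\<forall>\<tau>\<in>segs s k k. inv_bounded \<S> F \<tau>" using inv U(1) by blast
            show "S1 \<in> \<S>" using S1 by (simp add: T_def)
            show "T1 \<subseteq> \<S>" unfolding T1_def T_def by blast
          qed (use leaves centre in auto)
          thus "card ((\<lambda>S. restrict S (fst (subspider s \<kappa>))) `
              {S\<in>T. restrict S {(0, 0), (i, 1), (j, 1)} = restrict S1 {(0, 0), (i, 1), (j, 1)}}) \<le> F ^ s"
            by (simp only: T1_def)
        qed
        also have "card ((\<lambda>S. restrict S {(0, 0), (i, 1), (j, 1)}) ` T) \<le> F"
        proof (rule inv_boundedD[OF _ fin S0])
          show "inv_bounded \<S> F ({(0, 0), (i, 1), (j, 1)}, {(i, 1), (j, 1)})"
            using inv U(2) cherryI[OF ij(1-3)] by (auto simp: cherry_def)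
          show "T \<subseteq> \<S>" by (auto simp: T_def)
          show "S b = S0 b" if "S \<in> T" "b \<in> {(i, 1), (j, 1)}" for S b
            using that mem by (auto simp: T_def)
        qed
        finally show "card ((\<lambda>S. restrict S (fst (subspider s \<kappa>))) ` {S\<in>\<S>. \<forall>b\<in>snd (subspider s \<kappa>). S b = S0 b}) \<le> F * F ^ s"
          by (simp add: T_def)
      qed
    qed
  qed
next
  case False
  hence one: "i = j" if "i < s" "j < s" "\<kappa> i = 1" "\<kappa> j = 1" for i j using that by blast
  obtain \<sigma> where \<sigma>: "\<sigma> \<in> tree.sp s k \<kappa>" "(spider_verts \<sigma>, spider_leaves \<sigma>) = subspider s \<kappa>"
    "non_leaves \<sigma> = insert (0, 0) (SIGMA i:{..<s}. {1..<\<kappa> i})" by (rule subspider_spider[OF \<kappa>])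
  have v: "spider_verts \<sigma> = fst (subspider s \<kappa>)" "spider_leaves \<sigma> = snd (subspider s \<kappa>)"
    unfolding \<sigma>(2)[symmetric] by simp_all
  have "\<And>i. i < s \<Longrightarrow> 0 < \<kappa> i \<and> \<kappa> i \<le> k" using \<kappa>(1) by force
  from spiders_force[OF this \<kappa>(2) one k] have f: "forces TYPE('a) s t k s \<kappa>" .
  show ?thesis unfolding \<sigma>(2)[symmetric]
  proof (rule refinable_forces[OF \<sigma>(1) \<kappa>(2) f])
    fix F
    show "\<exists>q. via_bounded TYPE('a) s k U \<sigma> F q"
    \<comment> \<open>The bound is \<open>F ^ s\<close> if the fixed vertex is the centre, and
      \<open>F * F\<close> if it is an inner vertex of a leg; the sum covers both.\<close>
    proof (rule exI[of _ "F ^ s + F * F"], unfold via_bounded_def, intro allI impI)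
      fix V :: "'a set" and nb D \<S> S0 z T
      assume fin: "finite \<S>" and inv: "\<forall>\<sigma>\<in>U. inv_bounded \<S> F \<sigma>" and S0: "S0 \<in> \<S>" and z: "z \<in> non_leaves \<sigma>"
        and T: "T \<subseteq> \<S>" and ag: "\<forall>S\<in>T. (\<forall>b\<in>spider_leaves \<sigma>. S b = S0 b) \<and> S z = S0 z"
      have finT: "finite T" using T fin finite_subset by blast
      have agl: "S b = S0 b" if "S \<in> T" "b \<in> snd (subspider s \<kappa>)" for S b using ag that v(2) by simp
      have agz: "S z = S0 z" if "S \<in> T" for S using ag that by simp
      show "card ((\<lambda>S. restrict S (spider_verts \<sigma>)) ` T) \<le> F ^ s + F * F"
      proof (cases "z = (0, 0)")
        case True
        have "card ((\<lambda>S. restrict S (fst (subspider s \<kappa>))) ` T) \<le> F ^ s"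
          by (rule subspider_with_centre[OF \<kappa>(1) s fin _ S0 T]) (use inv U(1) agl agz True in auto)
        thus ?thesis unfolding v by simp
      next
        case False
        then obtain i j where ij: "z = (i, j)" "i < s" "1 \<le> j" "j < \<kappa> i" using z \<sigma>(3) by auto
        have lp: "leg_pos i j = (i, j)" "leg_pos i (\<kappa> i) = (i, \<kappa> i)" using ij by (simp_all add: leg_pos_def)
        have J: "spider_verts \<sigma> \<subseteq> fst (subspider s (\<kappa>(i := j))) \<union> leg_pos i ` {j..\<kappa> i}"
        proof
          fix x assume "x \<in> spider_verts \<sigma>"
          hence x: "x \<in> fst (subspider s \<kappa>)" by (simp add: v)
          show "x \<in> fst (subspider s (\<kappa>(i := j))) \<union> leg_pos i ` {j..\<kappa> i}"
          proof (cases "fst x = i \<and> j \<le> snd x \<and> x \<noteq> (0, 0)")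
            case True
            hence "x = leg_pos i (snd x)" "snd x \<le> \<kappa> i" using x ij(3) by (auto simp: leg_pos_def subspider_def)
            thus ?thesis using True by (intro UnI2 image_eqI[of _ _ "snd x"]) auto
          next
            case False
            thus ?thesis using x by (auto simp: subspider_def split: if_splits)
          qed
        qed
        have "card ((\<lambda>S. restrict S (fst (subspider s (\<kappa>(i := j))))) ` T) \<le> F"
        proof (rule inv_boundedD[OF _ fin S0 T])
          show "inv_bounded \<S> F (fst (subspider s (\<kappa>(i := j))), snd (subspider s (\<kappa>(i := j))))"
            using inv less[OF ij(2-4)] by simp
          fix S b assume S: "S \<in> T" and b: "b \<in> snd (subspider s (\<kappa>(i := j)))"
          obtain l where l: "l < s" "b = (l, (\<kappa>(i := j)) l)" using b by (auto simp: subspider_def)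
          show "S b = S0 b"
          proof (cases "l = i")
            case True
            thus ?thesis using l agz[OF S] ij(1) by simp
          next
            case False
            hence "b \<in> snd (subspider s \<kappa>)" using l by (simp add: subspider_def)
            thus ?thesis by (rule agl[OF S])
          qed
        qed
        moreover have "card ((\<lambda>S. restrict S (leg_pos i ` {j..\<kappa> i})) ` T) \<le> F"
        proof (rule inv_boundedD[OF _ fin S0 T])
          have "seg i j (\<kappa> i) \<in> segs s k k" using ij \<kappa>(1)[OF ij(2)] by (intro segI) auto
          thus "inv_bounded \<S> F (leg_pos i ` {j..\<kappa> i}, {leg_pos i j, leg_pos i (\<kappa> i)})"
            using inv U(1) by (auto simp: seg_def)
          have "(i, \<kappa> i) \<in> snd (subspider s \<kappa>)" using ij(2) by (simp add: subspider_def)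
          thus "S b = S0 b" if "S \<in> T" "b \<in> {leg_pos i j, leg_pos i (\<kappa> i)}" for S b
            using that agl agz ij(1) lp by auto
        qed
        ultimately show ?thesis
          using card_restrict_Un[OF finT J] by (meson mult_le_mono order.trans trans_le_add2)
      qed
    qed
  qed
qed

text \<open>The shape of the condition is that of \<open>finite_set_of_finite_funs\<close>, which
  gives finiteness.\<close>

definition leg_lengths :: "nat \<Rightarrow> nat \<Rightarrow> (nat \<Rightarrow> nat) set" where
  "leg_lengths s k = {\<kappa>. \<forall>i. (i \<in> {..<s} \<longrightarrow> \<kappa> i \<in> {1..k}) \<and> (i \<notin> {..<s} \<longrightarrow> \<kappa> i = 0)}"

text \<open>Induction on the total leg length, which drops whenever a leg is cut. At total length 0
  there are only segments and cherries, since all \<open>s\<close> legs have length at least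
  1.\<close>

lemma reach_subspiders:
  assumes s: "s > 0" and t: "t > 0" and k: "2 \<le> k"
  shows "reach TYPE('a) s t k (segs s k k \<union> cherries s \<union> subspider s ` {\<kappa>\<in>leg_lengths s k. sum \<kappa> {..<s} \<le> m})"
proof (induction m)
  case 0
  have "finite {(i, j). i < s \<and> j < s \<and> i \<noteq> j}" by (rule finite_subset[of _ "{..<s} \<times> {..<s}"]) auto
  hence "finite (cherries s)" by (simp add: cherries_def)
  hence "reach TYPE('a) s t k (segs s k k \<union> cherries s)"
  proof (rule reach_Un[OF _ reach_segs[OF s t]])
    fix \<tau> assume "\<tau> \<in> cherries s"
    thus "refinable TYPE('a) s t k (segs s k k) \<tau>"
      unfolding cherries_def using refinable_cherry[OF _ _ _ k t] by auto
  qed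
  moreover have "{\<kappa>\<in>leg_lengths s k. sum \<kappa> {..<s} \<le> 0} = {}"
  proof -
    have "sum \<kappa> {..<s} > 0" if "\<kappa> \<in> leg_lengths s k" for \<kappa>
    proof -
      have "\<kappa> 0 \<ge> 1" using that s by (simp add: leg_lengths_def)
      moreover have "\<kappa> 0 \<le> sum \<kappa> {..<s}" using s by (intro member_le_sum) auto
      ultimately show ?thesis by linarith
    qed
    show ?thesis
    proof (rule equals0I)
      fix \<kappa> assume "\<kappa> \<in> {\<kappa>\<in>leg_lengths s k. sum \<kappa> {..<s} \<le> 0}"
      thus False using \<open>\<And>\<kappa>. \<kappa> \<in> leg_lengths s k \<Longrightarrow> sum \<kappa> {..<s} > 0\<close>[of \<kappa>] by simp
    qed
  qed
  ultimately show ?case by (simp only: image_empty Un_empty_right)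
next
  case (Suc m)
  define X where "X = subspider s ` {\<kappa>\<in>leg_lengths s k. sum \<kappa> {..<s} = Suc m}"
  define U where "U = segs s k k \<union> cherries s \<union> subspider s ` {\<kappa>\<in>leg_lengths s k. sum \<kappa> {..<s} \<le> m}"
  have "finite (leg_lengths s k)" unfolding leg_lengths_def by (rule finite_set_of_finite_funs) auto
  hence finX: "finite X" by (simp add: X_def)
  have "reach TYPE('a) s t k (U \<union> X)"
  proof (rule reach_Un[OF finX Suc[folded U_def]])
    fix \<tau> assume "\<tau> \<in> X"
    then obtain \<kappa> where \<kappa>: "\<tau> = subspider s \<kappa>" "\<kappa> \<in> leg_lengths s k" "sum \<kappa> {..<s} = Suc m" by (auto simp: X_def)
    have k1: "1 \<le> \<kappa> i \<and> \<kappa> i \<le> k" if "i < s" for i using \<kappa>(2) that by (simp add: leg_lengths_def)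
    have k0: "\<kappa> i = 0" if "s \<le> i" for i using \<kappa>(2) that by (simp add: leg_lengths_def)
    have less: "subspider s (\<kappa>(i := j)) \<in> U" if ij: "i < s" "1 \<le> j" "j < \<kappa> i" for i j
    proof -
      have "\<kappa>(i := j) \<in> leg_lengths s k" using \<kappa>(2) ij k1[OF ij(1)] by (auto simp: leg_lengths_def)
      moreover have "sum (\<kappa>(i := j)) {..<s} < sum \<kappa> {..<s}"
        by (rule sum_strict_mono_ex1) (use ij in auto)
      ultimately show ?thesis using \<kappa>(3) by (auto simp: U_def)
    qed
    show "refinable TYPE('a) s t k U \<tau>" unfolding \<kappa>(1)
      by (rule refinable_subspider[OF k1 k0 s _ _ _ less]) (use k in \<open>auto simp: U_def\<close>)
  qed
  moreover have "U \<union> X = segs s k k \<union> cherries s \<union> subspider s ` {\<kappa>\<in>leg_lengths s k. sum \<kappa> {..<s} \<le> Suc m}"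
    unfolding U_def X_def by (auto simp: le_Suc_eq)
  ultimately show ?case by simp
qed

section \<open>The subdivision\<close>

text \<open>The full spider is itself one of the treated trees, so the images of its
  \<open>s\<close> leaves fix a copy up to \<open>F\<close> choices.\<close>

lemma (in bounded_graph) card_le_leaf_fibres:
  assumes \<S>: "\<S> \<subseteq> homs (tree s k)" and inv: "inv_bounded \<S> F (subspider s (\<lambda>i. if i < s then k else 0))"
    and k: "k > 0"
  shows "card \<S> \<le> card V ^ s * F"
proof -
  define B where "B = (\<lambda>i. (i, k)) ` {..<s}"
  have "(SIGMA i:{..<s}. {1..if i < s then k else 0}) = {..<s} \<times> {1..k}" by auto
  moreover have "(\<lambda>i. (i, if i < s then k else 0)) ` {..<s} = B" unfolding B_def by (rule image_cong) auto
  ultimately have ss: "subspider s (\<lambda>i. if i < s then k else 0) = (tree s k, B)"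
    by (simp add: subspider_def tree_def)
  have fin: "finite \<S>" using \<S> finite_homs[of "tree s k"] finite_subset by auto
  have Bt: "B \<subseteq> tree s k" using k by (auto simp: B_def tree_def)
  have "(\<lambda>S. restrict S (tree s k)) ` \<S> = \<S>"
  proof -
    have "restrict S (tree s k) = S" if "S \<in> \<S>" for S
      using that \<S> by (intro PiE_restrict) (auto simp: homs_def)
    thus ?thesis by force
  qed
  hence "card \<S> = card ((\<lambda>S. restrict S (tree s k)) ` \<S>)" by simp
  also have "\<dots> \<le> card ((\<lambda>S. restrict S B) ` \<S>) * F"
  proof (rule card_image_le_fibres[OF fin])
    fix S0 assume S0: "S0 \<in> \<S>"
    show "card ((\<lambda>S. restrict S (tree s k)) ` {S\<in>\<S>. restrict S B = restrict S0 B}) \<le> F"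
    proof (rule inv_boundedD[OF inv[unfolded ss] fin S0])
      fix S b assume a: "S \<in> {S\<in>\<S>. restrict S B = restrict S0 B}" "b \<in> B"
      hence "restrict S B = restrict S0 B" by simp
      from fun_cong[OF this, of b] show "S b = S0 b" using a(2) by simp
    qed auto
  qed
  also have "card ((\<lambda>S. restrict S B) ` \<S>) \<le> card (B \<rightarrow>\<^sub>E V)"
  proof (rule card_mono)
    show "finite (B \<rightarrow>\<^sub>E V)" using finV by (intro finite_PiE) (auto simp: B_def)
    show "(\<lambda>S. restrict S B) ` \<S> \<subseteq> B \<rightarrow>\<^sub>E V"
    proof (rule image_subsetI)
      fix S assume "S \<in> \<S>"
      hence "S \<in> tree s k \<rightarrow> V" using \<S> by (auto simp: homs_def)
      hence "S \<in> B \<rightarrow> V" using Bt by blast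
      thus "restrict S B \<in> B \<rightarrow>\<^sub>E V" by (simp add: restrict_PiE_iff Pi_iff)
    qed
  qed
  also have "card (B \<rightarrow>\<^sub>E V) = card V ^ s"
  proof -
    have "card B = s" unfolding B_def by (subst card_image) (auto simp: inj_on_def)
    moreover have "finite B" by (simp add: B_def)
    ultimately show ?thesis by (simp add: card_PiE)
  qed
  finally show ?thesis by simp
qed

text \<open>Without the subdivision, the surviving copies number at least
  \<open>\<epsilon> * card V * D ^ (s * k)\<close> and at most \<open>card V ^ s * F\<close>. This
  bounds \<open>\<delta> ^ (s * k)\<close> by \<open>F / \<epsilon>\<close> times
  \<open>card V ^ (s - 1)\<close>, against the choice of \<omega>.\<close>

lemma almost_regular_has_subdivision:
  fixes K :: real
  assumes s: "s > 0" and t: "t > 0" and k: "2 \<le> k" and K: "K \<ge> 1"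
  shows "\<exists>\<omega> :: real. \<forall>(V :: 'a set) nb D \<delta>. bounded_graph V nb D \<longrightarrow> V \<noteq> {} \<longrightarrow> (\<forall>v\<in>V. \<delta> \<le> card (nb v)) \<longrightarrow>
     real D \<le> K * real \<delta> \<longrightarrow> \<omega> * real (card V) ^ (s - 1) \<le> real \<delta> ^ (s * k) \<longrightarrow>
     bounded_graph.has_subdivision V nb s t k"
proof -
  define N where "N = s * k"
  have N: "N > 0" using s k by (simp add: N_def)
  \<comment> \<open>From \<open>D / (2 * K) \<le> \<delta> / 2 \<le> \<delta> - N\<close>, greedy
    embedding yields this proportion of \<open>card V * D ^ N\<close> copies.\<close>
  define \<epsilon>0 where "\<epsilon>0 = (1 / (2 * K)) ^ N"
  have \<epsilon>0: "\<epsilon>0 > 0" using K by (simp add: \<epsilon>0_def)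
  define full where "full = (\<lambda>i. if i < s then k else 0 :: nat)"
  obtain F D0 and \<epsilon> :: real where r: "\<epsilon> > 0" "\<And>(V :: 'a set) nb D \<S>0. dense_homs s t k D0 \<epsilon>0 V nb D \<S>0 \<Longrightarrow>
     (\<exists>\<S>\<subseteq>\<S>0. \<epsilon> * card V * real D ^ (s * k) \<le> card \<S> \<and>
       (\<forall>\<tau>\<in>segs s k k \<union> cherries s \<union> subspider s ` {\<kappa>\<in>leg_lengths s k. sum \<kappa> {..<s} \<le> s * k}. inv_bounded \<S> F \<tau>))"
    using reach_subspiders[OF s t k, of "s * k", unfolded reach_def reach_with_def, rule_format, OF \<epsilon>0] by blast
  have "full \<in> leg_lengths s k" "sum full {..<s} \<le> s * k" using k by (auto simp: full_def leg_lengths_def)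
  hence full: "subspider s full \<in> segs s k k \<union> cherries s \<union> subspider s ` {\<kappa>\<in>leg_lengths s k. sum \<kappa> {..<s} \<le> s * k}" by blast
  \<comment> \<open>The bound \<open>X \<le> \<delta>\<close> secures both \<open>D0 \<le> D\<close>
    and \<open>N \<le> \<delta> / 2\<close>. It follows from the summand \<open>X ^ N\<close> of
    \<omega>, because \<open>card V \<ge> 1\<close> gives
    \<open>\<omega> \<le> \<delta> ^ N\<close>.\<close>
  define X where "X = max D0 (2 * N)"
  define \<omega> where "\<omega> = real X ^ N + F / \<epsilon> + 1"
  have F0: "F / \<epsilon> \<ge> 0" using r(1) by simp
  hence \<omega>0: "\<omega> > 0" "\<omega> > F / \<epsilon>" "real X ^ N \<le> \<omega>" by (auto simp: \<omega>_def intro: add_nonneg_pos)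
  have "bounded_graph.has_subdivision V nb s t k"
    if "bounded_graph V nb D" and V: "V \<noteq> {}" and \<delta>: "\<forall>v\<in>V. \<delta> \<le> card (nb v)" and D: "real D \<le> K * real \<delta>"
      and large: "\<omega> * real (card V) ^ (s - 1) \<le> real \<delta> ^ (s * k)" for V :: "'a set" and nb D \<delta>
  proof (rule ccontr)
    interpret bounded_graph V nb D by fact
    assume free: "\<not> has_subdivision s t k"
    have n: "real (card V) \<ge> 1" using V finV by (simp add: Suc_le_eq card_gt_0_iff)
    have "\<omega> * 1 \<le> \<omega> * real (card V) ^ (s - 1)" using \<omega>0(1) n by (intro mult_left_mono) auto
    hence "real X ^ N \<le> real \<delta> ^ N" using large \<omega>0(3) unfolding N_def by linarith
    hence X\<delta>: "X \<le> \<delta>" using N power_strict_mono[of "real \<delta>" "real X" N] by (meson not_le of_nat_0_le_iff of_nat_less_iff)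
    obtain v where "v \<in> V" using V by blast
    hence \<delta>D: "\<delta> \<le> D" using \<delta> card_nb[of v] by force
    have D0: "D0 \<le> D" using X\<delta> \<delta>D by (simp add: X_def)
    have tr: "card V * (\<delta> - N) ^ (card (tree s k) - 1) \<le> card (homs (tree s k))"
    proof (rule card_homs_ge)
      show "x = (0, 0)" if "x \<in> tree s k" "snd x = 0" for x using that by (auto simp: tree_def)
      show "parent x \<in> tree s k" if "x \<in> tree s k" "0 < snd x" for x using parent_tree that by blast
      show "(0, 0) \<in> tree s k" by (simp add: tree_def)
    qed (use \<delta> in \<open>auto simp: card_tree N_def\<close>)
    have "real D / (2 * K) \<le> real \<delta> / 2" using D K by (simp add: field_simps)
    also have "\<dots> \<le> real (\<delta> - N)" using X\<delta> by (simp add: X_def of_nat_diff)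
    finally have "(real D / (2 * K)) ^ N \<le> real (\<delta> - N) ^ N" using K by (intro power_mono) auto
    hence "card V * (real D / (2 * K)) ^ N \<le> card V * real (\<delta> - N) ^ N" by (intro mult_left_mono) auto
    also have "\<dots> \<le> card (homs (tree s k))"
      using of_nat_mono[OF tr, where 'a = real] by (simp add: card_tree N_def)
    finally have "\<epsilon>0 * card V * real D ^ (s * k) \<le> card (homs (tree s k))"
      unfolding \<epsilon>0_def N_def[symmetric] by (simp add: power_divide mult_ac)
    hence "dense_homs s t k D0 \<epsilon>0 V nb D (homs (tree s k))"
      using V D0 free bounded_graph_axioms by (simp add: dense_homs_def)
    from r(2)[OF this] full obtain \<S> where S: "\<S> \<subseteq> homs (tree s k)" "\<epsilon> * card V * real D ^ (s * k) \<le> card \<S>"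
      "inv_bounded \<S> F (subspider s full)" by blast
    have "card \<S> \<le> card V ^ s * F" using card_le_leaf_fibres[OF S(1)] S(3) k unfolding full_def by simp
    hence "real (card \<S>) \<le> real (card V ^ s * F)" by (rule of_nat_mono)
    moreover have "real \<delta> ^ (s * k) \<le> real D ^ (s * k)" using \<delta>D by (intro power_mono) auto
    hence "\<epsilon> * card V * (\<omega> * real (card V) ^ (s - 1)) \<le> \<epsilon> * card V * real D ^ (s * k)"
      using large r(1) by (intro mult_left_mono) auto
    ultimately have "\<epsilon> * card V * (\<omega> * real (card V) ^ (s - 1)) \<le> real (card V) ^ s * F" using S(2) by simp
    moreover have "real (card V) ^ s = card V * real (card V) ^ (s - 1)" using s by (cases s) auto
    ultimately have "(\<epsilon> * \<omega>) * real (card V) ^ s \<le> F * real (card V) ^ s" by (simp add: mult_ac)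
    hence "\<epsilon> * \<omega> \<le> F" using n by simp
    moreover have "\<epsilon> * \<omega> > F" using \<omega>0(2) r(1) by (simp add: field_simps)
    ultimately show False by simp
  qed
  thus ?thesis by blast
qed

section \<open>From vertex lists to pair graphs\<close>

lemma vwalk_arcs_verts: "(x, y) \<in> set (vwalk_arcs p) \<Longrightarrow> x \<in> set p \<and> y \<in> set p"
  by (induction p rule: vwalk_arcs.induct) auto

lemma inner_vertices_rev: "inner_vertices (rev p) = inner_vertices p"
proof -
  have "butlast (tl (rev p)) = rev (tl (butlast p))"
    by (metis butlast_rev rev_rev_ident)
  thus ?thesis by (simp add: inner_vertices_def butlast_tl)
qed

lemma (in bounded_graph) wlk_arcs: "wlk p \<Longrightarrow> (x, y) \<in> set (vwalk_arcs p) \<Longrightarrow> y \<in> nb x"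
  by (induction p rule: vwalk_arcs.induct) (auto simp: wlk_Cons)

text \<open>As \<open>k_subdivision\<close> keeps the vertices of \<open>F\<close>, the complete
  bipartite graph is placed on the branch vertices inside the host graph. An edge is a pair of
  opposite arcs, and \<open>P\<close> assigns to an arc from \<open>B\<close> to \<open>A\<close>
  the reversed path.\<close>

lemma (in bounded_graph) has_subdivision_imp_subgraph:
  fixes G :: "'a pair_pre_digraph"
  assumes G: "pair_graph G" and V: "V = pverts G" and nb: "nb = (\<lambda>x. {y. (x, y) \<in> parcs G})"
    and sub: "has_subdivision s t k" and pos: "s > 0" "t > 0"
  shows "\<exists>F H :: 'a pair_pre_digraph. complete_bipartite_digraph s t (with_proj F) \<and> k_subdivision k F H \<and>
     subgraph (with_proj H) (with_proj G)"
proof -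
  interpret pair_graph G by (rule G)
  obtain a b p where a: "inj_on a {..<s}" and b: "inj_on b {..<t}" and ab: "a ` {..<s} \<inter> b ` {..<t} = {}"
    and p: "\<And>i j. i < s \<Longrightarrow> j < t \<Longrightarrow> is_path k (a i) (b j) (p i j)"
      "\<And>i j. i < s \<Longrightarrow> j < t \<Longrightarrow> inner_vertices (p i j) \<inter> (a ` {..<s} \<union> b ` {..<t}) = {}"
      "\<And>i j i' j'. i < s \<Longrightarrow> j < t \<Longrightarrow> i' < s \<Longrightarrow> j' < t \<Longrightarrow> (i, j) \<noteq> (i', j') \<Longrightarrow>
        inner_vertices (p i j) \<inter> inner_vertices (p i' j') = {}"
    using sub unfolding has_subdivision_def by metis
  define A where "A = a ` {..<s}"
  define B where "B = b ` {..<t}"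
  define ia where "ia = inv_into {..<s} a"
  define ib where "ib = inv_into {..<t} b"
  have AB: "A \<inter> B = {}" using ab by (simp add: A_def B_def)
  have ia: "ia u < s" "a (ia u) = u" if "u \<in> A" for u
    using that inv_into_into[of u a "{..<s}"] f_inv_into_f[of u a "{..<s}"] by (auto simp: A_def ia_def)
  have ib: "ib v < t" "b (ib v) = v" if "v \<in> B" for v
    using that inv_into_into[of v b "{..<t}"] f_inv_into_f[of v b "{..<t}"] by (auto simp: B_def ib_def)
  define F where "F = \<lparr>pverts = A \<union> B, parcs = A \<times> B \<union> B \<times> A\<rparr>"
  define q where "q u v = p (ia u) (ib v)" for u v
  define P where "P e = (if fst e \<in> A then q (fst e) (snd e) else rev (q (snd e) (fst e)))" for e
  define H where "H = \<lparr>pverts = pverts F \<union> (\<Union>e\<in>parcs F. set (P e)), parcs = (\<Union>e\<in>parcs F. set (vwalk_arcs (P e)))\<rparr>"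
  have PAB: "P (u, v) = q u v" "P (v, u) = rev (q u v)" if "u \<in> A" "v \<in> B" for u v
    using that AB by (auto simp: P_def)
  have q: "is_path k u v (q u v)" "inner_vertices (q u v) \<inter> (A \<union> B) = {}" if "u \<in> A" "v \<in> B" for u v
    using p(1)[OF ia(1)[OF that(1)] ib(1)[OF that(2)]] p(2)[OF ia(1)[OF that(1)] ib(1)[OF that(2)]] ia(2)[OF that(1)] ib(2)[OF that(2)]
    by (simp_all add: q_def A_def B_def)
  have qq: "inner_vertices (q u v) \<inter> inner_vertices (q x y) = {}"
    if "u \<in> A" "v \<in> B" "x \<in> A" "y \<in> B" "(u, v) \<noteq> (x, y)" for u v x y
  proof -
    have "(ia u, ib v) \<noteq> (ia x, ib y)"
    proof
      assume "(ia u, ib v) = (ia x, ib y)"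
      hence "a (ia u) = a (ia x)" "b (ib v) = b (ib y)" by simp_all
      thus False using that(5) unfolding ia(2)[OF that(1)] ia(2)[OF that(3)] ib(2)[OF that(2)] ib(2)[OF that(4)] by simp
    qed
    thus ?thesis unfolding q_def by (intro p(3) ia(1) ib(1) that)
  qed
  have arcsF: "\<exists>u\<in>A. \<exists>v\<in>B. e = (u, v) \<or> e = (v, u)" if "e \<in> parcs F" for e using that by (auto simp: F_def)
  have Pwlk: "wlk (P e) \<and> distinct (P e) \<and> length (P e) = Suc k \<and> hd (P e) = fst e \<and> last (P e) = snd e \<and>
      inner_vertices (P e) \<inter> pverts F = {}" if e: "e \<in> parcs F" for e
  proof -
    obtain u v where uv: "u \<in> A" "v \<in> B" "e = (u, v) \<or> e = (v, u)" using arcsF[OF e] by blast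
    have qu: "wlk (q u v)" "distinct (q u v)" "length (q u v) = Suc k" "hd (q u v) = u" "last (q u v) = v" "q u v \<noteq> []"
      using q(1)[OF uv(1,2)] by (auto simp: is_path_def)
    have i: "inner_vertices (q u v) \<inter> pverts F = {}" using q(2)[OF uv(1,2)] by (simp add: F_def)
    from uv(3) show ?thesis
    proof
      assume "e = (u, v)"
      thus ?thesis using qu i PAB(1)[OF uv(1,2)] by simp
    next
      assume "e = (v, u)"
      thus ?thesis using qu i PAB(2)[OF uv(1,2)] by (simp add: wlk_rev hd_rev last_rev inner_vertices_rev)
    qed
  qed
  have Prev: "P (v, u) = rev (P (u, v))" if uv: "(u, v) \<in> parcs F" for u v
    using arcsF[OF uv] PAB by auto
  have PV: "set (P e) \<subseteq> pverts G" if "e \<in> parcs F" for e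
  proof -
    have "set (P e) \<subseteq> V" using Pwlk[OF that] by (simp add: wlk_def)
    thus ?thesis unfolding V .
  qed
  have Parcs: "set (vwalk_arcs (P e)) \<subseteq> parcs G" if "e \<in> parcs F" for e
  proof
    fix z assume "z \<in> set (vwalk_arcs (P e))"
    hence "snd z \<in> nb (fst z)" using wlk_arcs[of "P e" "fst z" "snd z"] Pwlk[OF that] by simp
    thus "z \<in> parcs G" by (simp add: nb)
  qed
  have Pdisj: "inner_vertices (P e) \<inter> inner_vertices (P e') = {}"
    if e: "e \<in> parcs F" "e' \<in> parcs F" "{fst e, snd e} \<noteq> {fst e', snd e'}" for e e'
  proof -
    obtain u v where uv: "u \<in> A" "v \<in> B" "e = (u, v) \<or> e = (v, u)" using arcsF[OF e(1)] by blast
    obtain x y where xy: "x \<in> A" "y \<in> B" "e' = (x, y) \<or> e' = (y, x)" using arcsF[OF e(2)] by blast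
    have "(u, v) \<noteq> (x, y)" using e(3) uv(3) xy(3) by auto
    from qq[OF uv(1,2) xy(1,2) this]
    have "inner_vertices (q u v) \<inter> inner_vertices (q x y) = {}" .
    moreover have "inner_vertices (P e) = inner_vertices (q u v)"
      using uv(3) PAB[OF uv(1,2)] by (auto simp: inner_vertices_rev)
    moreover have "inner_vertices (P e') = inner_vertices (q x y)"
      using xy(3) PAB[OF xy(1,2)] by (auto simp: inner_vertices_rev)
    ultimately show ?thesis by simp
  qed
  have "complete_bipartite_digraph s t (with_proj F)"
    unfolding complete_bipartite_digraph_pair_def
  proof (intro conjI exI)
    show "pverts F = A \<union> B" "parcs F = A \<times> B \<union> B \<times> A" by (simp_all add: F_def)
    show "finite (pverts F)" by (simp add: F_def A_def B_def)
    show "card A = s" "card B = t" using a b by (simp_all add: A_def B_def card_image)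
  qed (rule AB)
  moreover have "k_subdivision k F H"
    unfolding k_subdivision_def
  proof (intro exI[of _ P] conjI)
    show "\<forall>(u, v)\<in>parcs F. vpath (P (u, v)) (with_proj H) \<and> vwalk_length (P (u, v)) = k \<and> hd (P (u, v)) = u \<and>
        last (P (u, v)) = v \<and> P (v, u) = rev (P (u, v)) \<and> inner_vertices (P (u, v)) \<inter> pverts F = {}"
    proof (intro ballI, clarify)
      fix u v assume uv: "(u, v) \<in> parcs F"
      note W = Pwlk[OF uv]
      have "vpath (P (u, v)) (with_proj H)"
      proof (intro vpathI vwalkI)
        show "set (P (u, v)) \<subseteq> verts (with_proj H)" using uv by (auto simp: H_def)
        show "set (vwalk_arcs (P (u, v))) \<subseteq> arcs_ends (with_proj H)" using uv by (auto simp: H_def)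
      qed (use W in auto)
      thus "vpath (P (u, v)) (with_proj H) \<and> vwalk_length (P (u, v)) = k \<and> hd (P (u, v)) = u \<and>
        last (P (u, v)) = v \<and> P (v, u) = rev (P (u, v)) \<and> inner_vertices (P (u, v)) \<inter> pverts F = {}"
        using W Prev[OF uv] by simp
    qed
    show "\<forall>(u, v)\<in>parcs F. \<forall>(x, y)\<in>parcs F. {u, v} \<noteq> {x, y} \<longrightarrow>
        inner_vertices (P (u, v)) \<inter> inner_vertices (P (x, y)) = {}"
    proof (intro ballI, clarify)
      fix u v x y z assume "(u, v) \<in> parcs F" "(x, y) \<in> parcs F" "{u, v} \<noteq> {x, y}"
      thus "inner_vertices (P (u, v)) \<inter> inner_vertices (P (x, y)) = {}" using Pdisj[of "(u, v)" "(x, y)"] by simp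
    qed
  qed (simp_all add: H_def)
  moreover have "subgraph (with_proj H) (with_proj G)"
  proof -
    have "pverts F \<subseteq> pverts G"
    proof
      fix x assume x: "x \<in> pverts F"
      \<comment> \<open>Both sides are nonempty, so every branch vertex is incident to an edge and
        lies on one of the paths, whose vertices belong to the host graph.\<close>
      have "a 0 \<in> A" "b 0 \<in> B" using pos by (auto simp: A_def B_def)
      hence "\<exists>y. (x, y) \<in> parcs F" using x by (auto simp: F_def)
      then obtain y where xy: "(x, y) \<in> parcs F" by blast
      have "hd (P (x, y)) = x" "P (x, y) \<noteq> []" using Pwlk[OF xy] by auto
      hence "x \<in> set (P (x, y))" using hd_in_set by metis
      thus "x \<in> pverts G" using PV[OF xy] by blast
    qed
    hence "pverts H \<subseteq> pverts G" using PV by (auto simp: H_def)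
    moreover have "parcs H \<subseteq> parcs G" using Parcs by (auto simp: H_def)
    moreover have "wf_digraph (with_proj H)"
    proof
      fix e assume "e \<in> arcs (with_proj H)"
      then obtain e' where e': "e' \<in> parcs F" "(fst e, snd e) \<in> set (vwalk_arcs (P e'))" by (auto simp: H_def)
      from vwalk_arcs_verts[OF e'(2)]
      show "tail (with_proj H) e \<in> verts (with_proj H)" "head (with_proj H) e \<in> verts (with_proj H)"
        using e'(1) by (auto simp: H_def)
    qed
    ultimately show ?thesis using wf_digraph_axioms by (simp add: subgraph_def compatible_def)
  qed
  ultimately show ?thesis by blast
qed

lemma bounded_graph_of_pair_graph:
  fixes G :: "'a pair_pre_digraph"
  assumes G: "pair_graph G"
  defines "nb \<equiv> \<lambda>x. {y. (x, y) \<in> parcs G}"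
  shows "bounded_graph (pverts G) nb (max_degree G)" "\<And>v. v \<in> pverts G \<Longrightarrow> min_degree G \<le> card (nb v)"
proof -
  interpret pair_graph G by (rule G)
  have deg: "out_degree (with_proj G) v = card (nb v)" for v
  proof -
    have "out_arcs (with_proj G) v = Pair v ` nb v" by (auto simp: out_arcs_def nb_def)
    moreover have "inj_on (Pair v) (nb v)" by (simp add: inj_on_def)
    ultimately show ?thesis by (simp add: out_degree_def card_image)
  qed
  show "min_degree G \<le> card (nb v)" if "v \<in> pverts G" for v
    unfolding min_degree_def deg[symmetric] using that pair_finite_verts by (intro Min_le) auto
  show "bounded_graph (pverts G) nb (max_degree G)"
  proof
    show "finite (pverts G)" by (rule pair_finite_verts)
    show "nb x \<subseteq> pverts G" for x using in_arcsD2 by (auto simp: nb_def)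
    show "y \<in> nb x \<Longrightarrow> x \<in> nb y" for x y
      using pair_sym_arcs by (auto simp: nb_def symmetric_def dest: symD)
    show "x \<notin> nb x" for x using pair_no_loops[of "(x, x)"] by (auto simp: nb_def)
    show "card (nb x) \<le> max_degree G" for x
    proof (cases "x \<in> pverts G")
      case True
      thus ?thesis unfolding max_degree_def deg[symmetric] using pair_finite_verts by (intro Max_ge) auto
    next
      case False
      hence "nb x = {}" using in_arcsD1 by (auto simp: nb_def)
      thus ?thesis by simp
    qed
  qed
qed

theorem theorem2p2:
  fixes s t k :: nat and K :: real and G :: "nat \<Rightarrow> 'a pair_pre_digraph"
  assumes "s \<ge> 2" and "t \<ge> 2" and "k \<ge> 2" and "K \<ge> 1"
    and "\<And>n. n \<ge> 1 \<Longrightarrow> pair_graph (G n)"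
    and "\<And>n. n \<ge> 1 \<Longrightarrow> card (pverts (G n)) = n"
    and "\<And>n. n \<ge> 1 \<Longrightarrow> almost_regular K (G n)"
    and "filterlim (\<lambda>n. real (min_degree (G n)) / real n powr ((real s - 1) / (real s * real k)))
           at_top sequentially"
  shows "\<forall>\<^sub>F n in sequentially. \<exists>F H :: 'a pair_pre_digraph.
           complete_bipartite_digraph s t (with_proj F) \<and> k_subdivision k F H \<and>
           subgraph (with_proj H) (with_proj (G n))"
proof -
  have pos: "s > 0" "t > 0" "k > 0" using assms(1-3) by auto
  obtain \<omega> :: real where \<omega>: "\<And>(V :: 'a set) nb D \<delta>. bounded_graph V nb D \<Longrightarrow> V \<noteq> {} \<Longrightarrow> (\<forall>v\<in>V. \<delta> \<le> card (nb v)) \<Longrightarrow>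
     real D \<le> K * real \<delta> \<Longrightarrow> \<omega> * real (card V) ^ (s - 1) \<le> real \<delta> ^ (s * k) \<Longrightarrow>
     bounded_graph.has_subdivision V nb s t k"
    using almost_regular_has_subdivision[OF pos(1,2) assms(3,4)] by blast
  \<comment> \<open>The limit hypothesis is raised to the power \<open>s * k\<close>; the maximum
    with 1 ensures that \<open>R ^ (s * k)\<close> still is at least \<omega>.\<close>
  define R where "R = max 1 \<omega>"
  have "\<forall>\<^sub>F n in sequentially. R \<le> real (min_degree (G n)) / real n powr ((real s - 1) / (real s * real k))"
    using assms(8) by (simp add: filterlim_at_top)
  moreover have "\<forall>\<^sub>F n in sequentially. n \<ge> (1 :: nat)" by (rule eventually_ge_at_top)
  ultimately show ?thesis
  proof eventually_elim
    case (elim n)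
    define \<alpha> where "\<alpha> = (real s - 1) / (real s * real k)"
    define nb where "nb = (\<lambda>x. {y. (x, y) \<in> parcs (G n)})"
    have G: "pair_graph (G n)" by (rule assms(5)[OF elim(2)])
    note B = bounded_graph_of_pair_graph[OF G, folded nb_def]
    have n: "card (pverts (G n)) = n" by (rule assms(6)[OF elim(2)])
    hence ne: "pverts (G n) \<noteq> {}" using elim(2) by auto
    have np: "real n powr \<alpha> > 0" using elim(2) by simp
    have "R * real n powr \<alpha> \<le> real (min_degree (G n))"
      using elim(1) np unfolding \<alpha>_def[symmetric] by (simp add: field_simps)
    moreover have "0 \<le> R * real n powr \<alpha>" by (simp add: R_def)
    ultimately have "(R * real n powr \<alpha>) ^ (s * k) \<le> real (min_degree (G n)) ^ (s * k)" by (rule power_mono)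
    moreover have "(real n powr \<alpha>) ^ (s * k) = real n ^ (s - 1)"
    proof -
      have "(real n powr \<alpha>) ^ (s * k) = real n powr (\<alpha> * real (s * k))"
        using elim(2) by (simp add: powr_powr powr_realpow[symmetric])
      also have "\<alpha> * real (s * k) = real (s - 1)" using pos by (simp add: \<alpha>_def of_nat_diff)
      also have "real n powr real (s - 1) = real n ^ (s - 1)" using elim(2) by (intro powr_realpow) simp
      finally show ?thesis .
    qed
    ultimately have "R ^ (s * k) * real n ^ (s - 1) \<le> real (min_degree (G n)) ^ (s * k)" by (simp add: power_mult_distrib)
    moreover have "R ^ 1 \<le> R ^ (s * k)" using pos by (intro power_increasing) (auto simp: R_def)
    hence "\<omega> \<le> R ^ (s * k)" by (simp add: R_def)
    hence "\<omega> * real n ^ (s - 1) \<le> R ^ (s * k) * real n ^ (s - 1)" by (intro mult_right_mono) auto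
    ultimately have large: "\<omega> * real (card (pverts (G n))) ^ (s - 1) \<le> real (min_degree (G n)) ^ (s * k)" unfolding n by linarith
    have reg: "real (max_degree (G n)) \<le> K * real (min_degree (G n))"
      using assms(7)[OF elim(2)] by (simp add: almost_regular_def)
    have "\<forall>v\<in>pverts (G n). min_degree (G n) \<le> card (nb v)" using B(2) by (simp add: nb_def)
    from \<omega>[OF B(1) ne this reg large] have "bounded_graph.has_subdivision (pverts (G n)) nb s t k" .
    from bounded_graph.has_subdivision_imp_subgraph[OF B(1) G refl nb_def this pos(1,2)] show ?case .
  qed
qed

end
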